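(* Let $(S,\mathfrak{m},k)$ and $(T,\mathfrak{n},k)$ be local rings with common residue field $k$, with $S\neq k\neq T$, and let $R=S\times_k T$ be their fiber product over $k$. Let $M$ and $N$ be finitely generated $R$-modules with $\operatorname{Tor}_5^R(M,N)=0$. Then at least one of the following holds: (1) $\operatorname{pd}_R M\leq 1$. (2) $\operatorname{pd}_R N\leq 1$. (3) $\Omega^2_R M$ is a free $S$-module and $\Omega^2_R N$ is a free $T$-module. (4) $\Omega^2_R M$ is a free $T$-module and $\Omega^2_R N$ is a free $S$-module.
   Context: A local ring is a commutative Noetherian ring with a unique maximal ideal. With $\pi_S:S\to k$ and $\pi_T:T\to k$ the natural surjections onto the common residue field, the fiber product is the subring $R=S\times_k T=\{(s,t)\in S\times T : \pi_S(s)=\pi_T(t)\}$ of $S\times T$; it is a local ring with maximal ideal $\mathfrak{m}\times\mathfrak{n}$. The projections $R\to S$, $(s,t)\mapsto s$, and $R\to T$, $(s,t)\mapsto t$, are surjective with kernels $0\times\mathfrak{n}$ and $\mathfrak{m}\times 0$ respectively, and $S$-modules and $T$-modules are regarded as $R$-modules via these projections; saying that an $R$-module is a free $S$-module (resp. $T$-module) means that it is annihilated by the kernel of the corresponding projection and is free over $S$ (resp. $T$). For a finitely generated $R$-module $M$, $\Omega^i_R M$ denotes the $i$-th syzygy of $M$ with respect to a minimal $R$-free resolution. $\operatorname{pd}_R$ denotes projective dimension over $R$. *)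

theory Defs
  imports "HOL-Algebra.Algebra" "HOL-Library.Extended_Nat"
begin

section \<open>Local rings and fiber products\<close>

locale local_ring = cring R + noetherian_ring R for R (structure) +
  assumes unique_maximal_ideal: "\<exists>!I. maximalideal I R"

definition maximal_ideal :: "('r, 'c) ring_scheme \<Rightarrow> 'r set" where
  "maximal_ideal R = (THE I. maximalideal I R)"

definition fiber_product ::
  "('s, 'x) ring_scheme \<Rightarrow> ('t, 'y) ring_scheme \<Rightarrow> ('s \<Rightarrow> 'k) \<Rightarrow> ('t \<Rightarrow> 'k) \<Rightarrow> ('s \<times> 't) ring" where
  "fiber_product S T \<pi>S \<pi>T =
     RDirProd S T \<lparr>carrier := {(s, t). s \<in> carrier S \<and> t \<in> carrier T \<and> \<pi>S s = \<pi>T t}\<rparr>"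


section \<open>Modules\<close>

definition mod_hom ::
  "('r, 'c) ring_scheme \<Rightarrow> ('r, 'm) module \<Rightarrow> ('r, 'n) module \<Rightarrow> ('m \<Rightarrow> 'n) set" where
  "mod_hom R M N =
     {f \<in> hom (add_monoid M) (add_monoid N).
        \<forall>r\<in>carrier R. \<forall>x\<in>carrier M. f (r \<odot>\<^bsub>M\<^esub> x) = r \<odot>\<^bsub>N\<^esub> f x}"

definition fg_module :: "('r, 'c) ring_scheme \<Rightarrow> ('r, 'm) module \<Rightarrow> bool" where
  "fg_module R M \<longleftrightarrow> module R M \<and>
     (\<exists>A. finite A \<and> A \<subseteq> carrier M \<and>
        (\<forall>x\<in>carrier M. \<exists>c\<in>A \<rightarrow> carrier R. x = (\<Oplus>\<^bsub>M\<^esub>a\<in>A. c a \<odot>\<^bsub>M\<^esub> a)))"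

definition module_basis :: "('r, 'c) ring_scheme \<Rightarrow> ('r, 'm) module \<Rightarrow> 'm set \<Rightarrow> bool" where
  "module_basis R M B \<longleftrightarrow> B \<subseteq> carrier M \<and>
     (\<forall>x\<in>carrier M. \<exists>!c. c \<in> B \<rightarrow>\<^sub>E carrier R \<and> finite {b \<in> B. c b \<noteq> \<zero>\<^bsub>R\<^esub>} \<and>
        x = (\<Oplus>\<^bsub>M\<^esub>b\<in>{b \<in> B. c b \<noteq> \<zero>\<^bsub>R\<^esub>}. c b \<odot>\<^bsub>M\<^esub> b))"

definition free_module :: "('r, 'c) ring_scheme \<Rightarrow> ('r, 'm) module \<Rightarrow> bool" where
  "free_module R M \<longleftrightarrow> module R M \<and> (\<exists>B. module_basis R M B)"

definition fg_free_module :: "('r, 'c) ring_scheme \<Rightarrow> ('r, 'm) module \<Rightarrow> bool" where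
  "fg_free_module R M \<longleftrightarrow> module R M \<and> (\<exists>B. finite B \<and> module_basis R M B)"

(* A module is projective if it is (isomorphic to) a direct summand of a free module. The type
   'p => 'r of the free module is no restriction: it contains the finitely supported functions on P,
   that is, the free module on the underlying set of P, which maps onto P. *)
definition projective_module :: "('r, 'c) ring_scheme \<Rightarrow> ('r, 'p) module \<Rightarrow> bool" where
  "projective_module R P \<longleftrightarrow> module R P \<and>
     (\<exists>(F :: ('r, 'p \<Rightarrow> 'r) module) i p. free_module R F \<and>
        i \<in> mod_hom R P F \<and> p \<in> mod_hom R F P \<and> (\<forall>x\<in>carrier P. p (i x) = x))"

(* The additive group of products a x with a in I and x in M, i.e. the submodule I M. *)
definition ideal_smult :: "'r set \<Rightarrow> ('r, 'm) module \<Rightarrow> 'm set" where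
  "ideal_smult I M = generate (add_monoid M) {a \<odot>\<^bsub>M\<^esub> x | a x. a \<in> I \<and> x \<in> carrier M}"

(* For a surjective ring homomorphism f from R onto S whose kernel annihilates M: the S-module
   structure on M, with s x = r x for any r in R mapping to s. *)
definition descended_module ::
  "('r, 'c) ring_scheme \<Rightarrow> ('r \<Rightarrow> 's) \<Rightarrow> ('r, 'm) module \<Rightarrow> ('s, 'm) module" where
  "descended_module R f M =
     \<lparr>carrier = carrier M, monoid.mult = monoid.mult M, one = \<one>\<^bsub>M\<^esub>, ring.zero = \<zero>\<^bsub>M\<^esub>, add = add M,
      smult = (\<lambda>s x. inv_into (carrier R) f s \<odot>\<^bsub>M\<^esub> x)\<rparr>"

definition free_along ::
  "('r, 'c) ring_scheme \<Rightarrow> ('s, 'd) ring_scheme \<Rightarrow> ('r \<Rightarrow> 's) \<Rightarrow> ('r, 'm) module \<Rightarrow> bool" where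
  "free_along R S f M \<longleftrightarrow>
     (\<forall>r\<in>a_kernel R S f. \<forall>x\<in>carrier M. r \<odot>\<^bsub>M\<^esub> x = \<zero>\<^bsub>M\<^esub>) \<and>
     free_module S (descended_module R f M)"


section \<open>Resolutions, projective dimension and syzygies\<close>

(* Homological indexing: diff P i maps obj P i to obj P (i - 1) for i > 0; diff P 0 is unused.
   The augmentation maps obj P 0 to the resolved module. *)
record ('r, 'f, 'm) resolution =
  obj :: "nat \<Rightarrow> ('r, 'f) module"
  diff :: "nat \<Rightarrow> 'f \<Rightarrow> 'f"
  aug :: "'f \<Rightarrow> 'm"

definition resolution_of ::
  "('r, 'c) ring_scheme \<Rightarrow> ('r, 'm) module \<Rightarrow> ('r, 'f, 'm) resolution \<Rightarrow> bool" where
  "resolution_of R M P \<longleftrightarrow>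
     (\<forall>i. module R (obj P i)) \<and>
     (\<forall>i. diff P (Suc i) \<in> mod_hom R (obj P (Suc i)) (obj P i)) \<and>
     aug P \<in> mod_hom R (obj P 0) M \<and>
     aug P ` carrier (obj P 0) = carrier M \<and>
     diff P 1 ` carrier (obj P 1) = a_kernel (obj P 0) M (aug P) \<and>
     (\<forall>i. diff P (Suc (Suc i)) ` carrier (obj P (Suc (Suc i))) =
        a_kernel (obj P (Suc i)) (obj P i) (diff P (Suc i)))"

definition fg_free_resolution ::
  "('r, 'c) ring_scheme \<Rightarrow> ('r, 'm) module \<Rightarrow> ('r, 'f, 'm) resolution \<Rightarrow> bool" where
  "fg_free_resolution R M P \<longleftrightarrow> resolution_of R M P \<and> (\<forall>i. fg_free_module R (obj P i))"

definition minimal_free_resolution ::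
  "('r, 'c) ring_scheme \<Rightarrow> ('r, 'm) module \<Rightarrow> ('r, 'f, 'm) resolution \<Rightarrow> bool" where
  "minimal_free_resolution R M P \<longleftrightarrow> fg_free_resolution R M P \<and>
     (\<forall>i. diff P (Suc i) ` carrier (obj P (Suc i)) \<subseteq> ideal_smult (maximal_ideal R) (obj P i))"

(* In the definitions below M is a finitely generated module over a Noetherian ring R. The terms of
   all resolutions considered can then be realised as submodules of the free modules R^n, hence on
   the type nat => 'r. Free resolutions exist, minimal ones over local rings are unique up to
   isomorphism, and the Tor groups do not depend on the resolution; so SOME picks one. *)

definition projective_dimension ::
  "('r, 'c) ring_scheme \<Rightarrow> ('r, 'm) module \<Rightarrow> enat" where
  "projective_dimension R M = Inf (enat ` {n. \<exists>P :: ('r, nat \<Rightarrow> 'r, 'm) resolution.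
     resolution_of R M P \<and> (\<forall>i. projective_module R (obj P i)) \<and>
     (\<forall>i>n. carrier (obj P i) = {\<zero>\<^bsub>obj P i\<^esub>})})"

(* The i-th syzygy for i > 0, as the image of diff P i in obj P (i - 1). *)
definition syzygy ::
  "('r, 'c) ring_scheme \<Rightarrow> nat \<Rightarrow> ('r, 'm) module \<Rightarrow> ('r, nat \<Rightarrow> 'r) module" where
  "syzygy R i M =
     (let P = (SOME P :: ('r, nat \<Rightarrow> 'r, 'm) resolution. minimal_free_resolution R M P)
      in (obj P (i - 1))\<lparr>carrier := diff P i ` carrier (obj P i)\<rparr>)"


section \<open>Tensor products and Tor\<close>

definition tensor_relations ::
  "('r, 'c) ring_scheme \<Rightarrow> ('r, 'm) module \<Rightarrow> ('r, 'n) module \<Rightarrow> ('m \<times> 'n \<Rightarrow>\<^sub>0 int) set" where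
  "tensor_relations R M N = generate (free_Abelian_group (carrier M \<times> carrier N))
     ({frag_of (x \<oplus>\<^bsub>M\<^esub> x', y) - frag_of (x, y) - frag_of (x', y) | x x' y.
         x \<in> carrier M \<and> x' \<in> carrier M \<and> y \<in> carrier N} \<union>
      {frag_of (x, y \<oplus>\<^bsub>N\<^esub> y') - frag_of (x, y) - frag_of (x, y') | x y y'.
         x \<in> carrier M \<and> y \<in> carrier N \<and> y' \<in> carrier N} \<union>
      {frag_of (r \<odot>\<^bsub>M\<^esub> x, y) - frag_of (x, r \<odot>\<^bsub>N\<^esub> y) | r x y.
         r \<in> carrier R \<and> x \<in> carrier M \<and> y \<in> carrier N})"

(* The underlying abelian group of the tensor product over R, written multiplicatively as a
   quotient group. *)
definition tensor_product ::
  "('r, 'c) ring_scheme \<Rightarrow> ('r, 'm) module \<Rightarrow> ('r, 'n) module \<Rightarrow> ('m \<times> 'n \<Rightarrow>\<^sub>0 int) set monoid" where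
  "tensor_product R M N =
     free_Abelian_group (carrier M \<times> carrier N) Mod tensor_relations R M N"

(* The map f (x) id from (M (x) N) to (M' (x) N) induced by f from M to M'. The image of a coset of
   the relations lies in a single coset, which is recovered by adding the relations. *)
definition tensor_map ::
  "('r, 'c) ring_scheme \<Rightarrow> ('r, 'm2) module \<Rightarrow> ('r, 'n) module \<Rightarrow> ('m1 \<Rightarrow> 'm2) \<Rightarrow>
   ('m1 \<times> 'n \<Rightarrow>\<^sub>0 int) set \<Rightarrow> ('m2 \<times> 'n \<Rightarrow>\<^sub>0 int) set" where
  "tensor_map R M' N f K =
     tensor_relations R M' N <#>\<^bsub>free_Abelian_group (carrier M' \<times> carrier N)\<^esub>
       (frag_extend (\<lambda>(x, y). frag_of (f x, y)) ` K)"

(* The i-th homology group of the complex P (x) N obtained from a resolution P of M. *)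
definition tensor_homology ::
  "('r, 'c) ring_scheme \<Rightarrow> ('r, 'f, 'm) resolution \<Rightarrow> ('r, 'n) module \<Rightarrow> nat \<Rightarrow>
   ('f \<times> 'n \<Rightarrow>\<^sub>0 int) set set monoid" where
  "tensor_homology R P N i =
     (let C = (\<lambda>j. tensor_product R (obj P j) N);
          d = (\<lambda>j. tensor_map R (obj P (j - 1)) N (diff P j));
          Z = (if i = 0 then carrier (C 0) else kernel (C i) (C (i - 1)) (d i))
      in (C i)\<lparr>carrier := Z\<rparr> Mod (d (Suc i) ` carrier (C (Suc i))))"

(* The abelian group underlying the R-module Tor. *)
definition Tor ::
  "('r, 'c) ring_scheme \<Rightarrow> nat \<Rightarrow> ('r, 'm) module \<Rightarrow> ('r, 'n) module \<Rightarrow>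
   ((nat \<Rightarrow> 'r) \<times> 'n \<Rightarrow>\<^sub>0 int) set set monoid" where
  "Tor R i M N =
     tensor_homology R (SOME P :: ('r, nat \<Rightarrow> 'r, 'm) resolution. fg_free_resolution R M P) N i"

end

theory Submission
  imports Defs
begin

text \<open>
  Write \<open>\<mm> = I \<oplus> J\<close> for the maximal ideal of \<open>R\<close>, where \<open>I = \<mm>\<^sub>S \<times> 0\<close> and \<open>J = 0 \<times> \<mm>\<^sub>T\<close> annihilate
  each other. A second syzygy lies in \<open>\<mm>F\<close> for a free module \<open>F\<close> and is the kernel of a map of free
  modules, so it is the direct sum of its intersections with \<open>IF\<close> and \<open>JF\<close>, its \<open>I\<close>-part and its
  \<open>J\<close>-part; the same holds for a third syzygy. Let \<open>Z, K\<close> be the second and third syzygies of \<open>M\<close>, and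
  \<open>Z', K'\<close> those of \<open>N\<close>. If \<open>u \<in> K\<close> and \<open>x \<in> Z'\<close> lie in parts belonging to different ideals, all
  products of their coordinates vanish; lifting both one step and chasing the double complex of the
  two resolutions produces a cycle of degree 5. As Tor vanishes there, minimality forces \<open>u \<in> \<mm>K\<close> or
  \<open>x \<in> \<mm>Z'\<close>, and similarly for \<open>u \<in> Z\<close> and \<open>x \<in> K'\<close>. By Nakayama's lemma, \<open>Z\<close> and \<open>Z'\<close> cannot both
  have a nonzero \<open>I\<close>-part (otherwise \<open>J = \<mm>J\<close>), and likewise for \<open>J\<close>; and if \<open>Z'\<close> has a nonzero
  \<open>J\<close>-part, then \<open>K\<close> has no \<open>I\<close>-part. Hence, if neither \<open>Z\<close> nor \<open>Z'\<close> vanishes, one of them is free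
  over \<open>R/J = S\<close> and the other over \<open>R/I = T\<close>.
\<close>

section \<open>Linear combinations\<close>

text \<open>The number 5 is 2 + 3: second and third syzygies are the images of degrees 2 and 3 of
  the minimal resolutions \<open>P\<close> and \<open>Q\<close>, so lifting an element of Z and one
  of K', or of K and Z', gives a tensor of total degree 5. Only its image under both differentials
  vanishes; it need not be a cycle itself, and the zigzag along the diagonal supplies the missing
  components. Third syzygies enter for two reasons. If a' in degree 2 maps into the I-part of Z,
  then t a' lies in K for every t in J, which produces the elements of K that put t into the square
  of \<open>\<mm>\<close>. And Z is P_2 / K, so freeness of Z over R/J follows from K = J P_2. The
  main obstacle is that \<open>Tor\<close> is defined by an arbitrary free resolution of M tensored
  with N, whereas the estimates need minimality on both sides. Balancing is therefore done in
  coordinates, where V tensor Q_j is a finite power of V: vanishing becomes exactness of M tensor Q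
  in degree 5, a statement free of the arbitrary resolution, and only then is the minimal
  \<open>P\<close> brought in.\<close>

lemma mod_hom_closed: "f \<in> mod_hom R M N \<Longrightarrow> x \<in> carrier M \<Longrightarrow> f x \<in> carrier N"
  by (auto simp: mod_hom_def hom_def)

lemma mod_hom_add:
  "f \<in> mod_hom R M N \<Longrightarrow> x \<in> carrier M \<Longrightarrow> y \<in> carrier M \<Longrightarrow> f (x \<oplus>\<^bsub>M\<^esub> y) = f x \<oplus>\<^bsub>N\<^esub> f y"
  by (auto simp: mod_hom_def hom_def)

lemma mod_hom_smult:
  "f \<in> mod_hom R M N \<Longrightarrow> r \<in> carrier R \<Longrightarrow> x \<in> carrier M \<Longrightarrow> f (r \<odot>\<^bsub>M\<^esub> x) = r \<odot>\<^bsub>N\<^esub> f x"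
  by (auto simp: mod_hom_def)

lemma mod_homI:
  assumes "\<And>x. x \<in> carrier M \<Longrightarrow> f x \<in> carrier N"
    and "\<And>x y. x \<in> carrier M \<Longrightarrow> y \<in> carrier M \<Longrightarrow> f (x \<oplus>\<^bsub>M\<^esub> y) = f x \<oplus>\<^bsub>N\<^esub> f y"
    and "\<And>r x. r \<in> carrier R \<Longrightarrow> x \<in> carrier M \<Longrightarrow> f (r \<odot>\<^bsub>M\<^esub> x) = r \<odot>\<^bsub>N\<^esub> f x"
  shows "f \<in> mod_hom R M N"
  using assms by (auto simp: mod_hom_def hom_def)

lemma mod_hom_zero:
  assumes "module R M" "module R N" "f \<in> mod_hom R M N"
  shows "f \<zero>\<^bsub>M\<^esub> = \<zero>\<^bsub>N\<^esub>"
proof -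
  interpret M: module R M by fact
  interpret N: module R N by fact
  have "f (\<zero>\<^bsub>R\<^esub> \<odot>\<^bsub>M\<^esub> \<zero>\<^bsub>M\<^esub>) = \<zero>\<^bsub>R\<^esub> \<odot>\<^bsub>N\<^esub> f \<zero>\<^bsub>M\<^esub>"
    using assms(3) by (intro mod_hom_smult) auto
  then show ?thesis
    using mod_hom_closed[OF assms(3) M.M.zero_closed] by simp
qed

lemma mod_hom_minus:
  assumes "module R M" "module R N" "f \<in> mod_hom R M N" "x \<in> carrier M" "y \<in> carrier M"
  shows "f (x \<ominus>\<^bsub>M\<^esub> y) = f x \<ominus>\<^bsub>N\<^esub> f y"
proof -
  interpret M: module R M by fact
  interpret N: module R N by fact
  have cl: "f x \<in> carrier N" "f y \<in> carrier N"
    using assms by (auto intro: mod_hom_closed)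
  have "f (\<ominus>\<^bsub>M\<^esub> y) = f ((\<ominus>\<^bsub>R\<^esub> \<one>\<^bsub>R\<^esub>) \<odot>\<^bsub>M\<^esub> y)"
    using assms(5) by (simp add: M.smult_l_minus)
  also have "\<dots> = (\<ominus>\<^bsub>R\<^esub> \<one>\<^bsub>R\<^esub>) \<odot>\<^bsub>N\<^esub> f y"
    using assms by (intro mod_hom_smult) auto
  also have "\<dots> = \<ominus>\<^bsub>N\<^esub> f y"
    using cl by (simp add: N.smult_l_minus)
  finally have "f (\<ominus>\<^bsub>M\<^esub> y) = \<ominus>\<^bsub>N\<^esub> f y" .
  then show ?thesis
    using assms mod_hom_add[OF assms(3), of x "\<ominus>\<^bsub>M\<^esub> y"]
    by (simp add: a_minus_def)
qed

text \<open>An indexed family \<open>g\<close>, in place of a set of vectors, keeps repeated vectors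
  apart. Generators, rows of matrices and elements of \<open>power_module\<close> all occur as
  \<open>g\<close>.\<close>

definition lin_comb :: "('r, 'm, 'x) module_scheme \<Rightarrow> 'i set \<Rightarrow> ('i \<Rightarrow> 'r) \<Rightarrow> ('i \<Rightarrow> 'm) \<Rightarrow> 'm" where
  "lin_comb V A c g = (\<Oplus>\<^bsub>V\<^esub>a\<in>A. c a \<odot>\<^bsub>V\<^esub> g a)"

context module
begin

lemma lin_comb_closed:
  "c \<in> A \<rightarrow> carrier R \<Longrightarrow> g \<in> A \<rightarrow> carrier M \<Longrightarrow> lin_comb M A c g \<in> carrier M"
  unfolding lin_comb_def by (auto intro!: M.finsum_closed)

lemma lin_comb_cong:
  assumes "\<And>a. a \<in> A \<Longrightarrow> c a = c' a" "\<And>a. a \<in> A \<Longrightarrow> g a = g' a"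
    "c' \<in> A \<rightarrow> carrier R" "g' \<in> A \<rightarrow> carrier M"
  shows "lin_comb M A c g = lin_comb M A c' g'"
  unfolding lin_comb_def using assms by (intro M.finsum_cong') auto

lemma lin_comb_empty [simp]: "lin_comb M {} c g = \<zero>\<^bsub>M\<^esub>"
  by (simp add: lin_comb_def)

lemma lin_comb_insert:
  assumes "finite A" "a \<notin> A" "c \<in> insert a A \<rightarrow> carrier R" "g \<in> insert a A \<rightarrow> carrier M"
  shows "lin_comb M (insert a A) c g = c a \<odot>\<^bsub>M\<^esub> g a \<oplus>\<^bsub>M\<^esub> lin_comb M A c g"
  unfolding lin_comb_def using assms by (subst M.finsum_insert) (auto simp: Pi_iff)

lemma lin_comb_add:
  assumes "c \<in> A \<rightarrow> carrier R" "c' \<in> A \<rightarrow> carrier R" "g \<in> A \<rightarrow> carrier M"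
  shows "lin_comb M A (\<lambda>a. c a \<oplus> c' a) g = lin_comb M A c g \<oplus>\<^bsub>M\<^esub> lin_comb M A c' g"
proof -
  have "lin_comb M A (\<lambda>a. c a \<oplus> c' a) g = (\<Oplus>\<^bsub>M\<^esub>a\<in>A. c a \<odot>\<^bsub>M\<^esub> g a \<oplus>\<^bsub>M\<^esub> c' a \<odot>\<^bsub>M\<^esub> g a)"
    unfolding lin_comb_def using assms by (intro M.finsum_cong') (auto simp: Pi_iff smult_l_distr)
  also have "\<dots> = lin_comb M A c g \<oplus>\<^bsub>M\<^esub> lin_comb M A c' g"
    unfolding lin_comb_def using assms by (intro M.finsum_addf) (auto simp: Pi_iff)
  finally show ?thesis .
qed

lemma lin_comb_add_right:
  assumes "c \<in> A \<rightarrow> carrier R" "g \<in> A \<rightarrow> carrier M" "g' \<in> A \<rightarrow> carrier M"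
  shows "lin_comb M A c (\<lambda>a. g a \<oplus>\<^bsub>M\<^esub> g' a) = lin_comb M A c g \<oplus>\<^bsub>M\<^esub> lin_comb M A c g'"
proof -
  have "lin_comb M A c (\<lambda>a. g a \<oplus>\<^bsub>M\<^esub> g' a) = (\<Oplus>\<^bsub>M\<^esub>a\<in>A. c a \<odot>\<^bsub>M\<^esub> g a \<oplus>\<^bsub>M\<^esub> c a \<odot>\<^bsub>M\<^esub> g' a)"
    unfolding lin_comb_def using assms by (intro M.finsum_cong') (auto simp: Pi_iff smult_r_distr)
  also have "\<dots> = lin_comb M A c g \<oplus>\<^bsub>M\<^esub> lin_comb M A c g'"
    unfolding lin_comb_def using assms by (intro M.finsum_addf) (auto simp: Pi_iff)
  finally show ?thesis .
qed

lemma lin_comb_smult: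
  assumes "finite A" "r \<in> carrier R" "c \<in> A \<rightarrow> carrier R" "g \<in> A \<rightarrow> carrier M"
  shows "lin_comb M A (\<lambda>a. r \<otimes> c a) g = r \<odot>\<^bsub>M\<^esub> lin_comb M A c g"
  unfolding lin_comb_def using assms
  by (subst finsum_smult_ldistr) (auto intro!: M.finsum_cong' smult_assoc1 simp: Pi_iff)

lemma lin_comb_smult_right:
  assumes "finite A" "r \<in> carrier R" "c \<in> A \<rightarrow> carrier R" "g \<in> A \<rightarrow> carrier M"
  shows "lin_comb M A c (\<lambda>a. r \<odot>\<^bsub>M\<^esub> g a) = r \<odot>\<^bsub>M\<^esub> lin_comb M A c g"
  using assms
  by (subst lin_comb_smult[symmetric])
    (auto simp: lin_comb_def Pi_iff smult_assoc1[symmetric] R.m_comm intro!: M.finsum_cong')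

lemma lin_comb_zero_left:
  assumes "\<And>a. a \<in> A \<Longrightarrow> c a = \<zero>" "g \<in> A \<rightarrow> carrier M"
  shows "lin_comb M A c g = \<zero>\<^bsub>M\<^esub>"
proof -
  have "lin_comb M A c g = (\<Oplus>\<^bsub>M\<^esub>a\<in>A. \<zero>\<^bsub>M\<^esub>)"
    unfolding lin_comb_def using assms by (intro M.finsum_cong') (auto simp: Pi_iff)
  then show ?thesis by simp
qed

lemma lin_comb_mono_neutral:
  assumes "finite B" "A \<subseteq> B" "c \<in> B \<rightarrow> carrier R" "g \<in> B \<rightarrow> carrier M"
    "\<And>b. b \<in> B - A \<Longrightarrow> c b = \<zero>"
  shows "lin_comb M B c g = lin_comb M A c g"
  unfolding lin_comb_def using assms
  by (intro M.add.finprod_mono_neutral_cong_right) (auto simp: Pi_iff)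

lemma lin_comb_single:
  assumes "finite A" "a \<in> A" "g \<in> A \<rightarrow> carrier M"
  shows "lin_comb M A (\<lambda>b. if b = a then \<one> else \<zero>) g = g a"
proof -
  have ga: "g a \<in> carrier M" using assms by auto
  have "lin_comb M A (\<lambda>b. if b = a then \<one> else \<zero>) g = lin_comb M {a} (\<lambda>b. if b = a then \<one> else \<zero>) g"
    using assms by (intro lin_comb_mono_neutral) auto
  also have "\<dots> = \<one> \<odot>\<^bsub>M\<^esub> g a \<oplus>\<^bsub>M\<^esub> lin_comb M {} (\<lambda>b. if b = a then \<one> else \<zero>) g"
    using ga by (subst lin_comb_insert) auto
  finally show ?thesis using ga by simp
qed

lemma lin_comb_minus:
  assumes "finite A" "c \<in> A \<rightarrow> carrier R" "c' \<in> A \<rightarrow> carrier R" "g \<in> A \<rightarrow> carrier M"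
  shows "lin_comb M A (\<lambda>a. c a \<ominus> c' a) g = lin_comb M A c g \<ominus>\<^bsub>M\<^esub> lin_comb M A c' g"
proof -
  have "lin_comb M A (\<lambda>a. c a \<ominus> c' a) g = lin_comb M A (\<lambda>a. c a \<oplus> (\<ominus> \<one>) \<otimes> c' a) g"
    using assms by (intro lin_comb_cong) (auto simp: Pi_iff a_minus_def R.l_minus)
  also have "\<dots> = lin_comb M A c g \<oplus>\<^bsub>M\<^esub> (\<ominus> \<one>) \<odot>\<^bsub>M\<^esub> lin_comb M A c' g"
    using assms by (subst lin_comb_add) (auto simp: Pi_iff lin_comb_smult)
  also have "\<dots> = lin_comb M A c g \<ominus>\<^bsub>M\<^esub> lin_comb M A c' g"
    using assms lin_comb_closed[OF assms(3,4)] by (simp add: smult_l_minus a_minus_def)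
  finally show ?thesis .
qed

lemma finsum_smult_left:
  assumes "finite A" "f \<in> A \<rightarrow> carrier R" "x \<in> carrier M"
  shows "(\<Oplus>a\<in>A. f a) \<odot>\<^bsub>M\<^esub> x = (\<Oplus>\<^bsub>M\<^esub>a\<in>A. f a \<odot>\<^bsub>M\<^esub> x)"
  using assms
proof (induct A rule: finite_induct)
  case (insert a A)
  then show ?case
    by (simp add: Pi_iff smult_l_distr)
qed simp

text \<open>Matrix multiplication with entries of the last factor in a module. The vanishing of
  \<open>delta\<close> after \<open>delta\<close>, exactness with free coefficients and the
  treatment of relations of N all reduce to this interchange.\<close>

lemma lin_comb_lin_comb:
  assumes "finite A" "finite B" "c \<in> A \<rightarrow> carrier R" "\<And>a. a \<in> A \<Longrightarrow> d a \<in> B \<rightarrow> carrier R"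
    "g \<in> B \<rightarrow> carrier M"
  shows "lin_comb M A c (\<lambda>a. lin_comb M B (d a) g) = lin_comb M B (\<lambda>b. \<Oplus>a\<in>A. c a \<otimes> d a b) g"
  using assms(1,3,4)
proof (induct A rule: finite_induct)
  case empty
  then show ?case using assms by (simp add: lin_comb_zero_left)
next
  case (insert a A)
  have cl: "\<And>a'. a' \<in> insert a A \<Longrightarrow> lin_comb M B (d a') g \<in> carrier M"
    using insert assms by (auto intro!: lin_comb_closed)
  have "lin_comb M (insert a A) c (\<lambda>a. lin_comb M B (d a) g)
     = c a \<odot>\<^bsub>M\<^esub> lin_comb M B (d a) g \<oplus>\<^bsub>M\<^esub> lin_comb M A c (\<lambda>a. lin_comb M B (d a) g)"
    using insert cl by (subst lin_comb_insert) auto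
  also have "\<dots> = lin_comb M B (\<lambda>b. c a \<otimes> d a b) g \<oplus>\<^bsub>M\<^esub> lin_comb M B (\<lambda>b. \<Oplus>a\<in>A. c a \<otimes> d a b) g"
    using insert assms by (subst lin_comb_smult) auto
  also have "\<dots> = lin_comb M B (\<lambda>b. c a \<otimes> d a b \<oplus> (\<Oplus>a\<in>A. c a \<otimes> d a b)) g"
    using insert assms by (subst lin_comb_add) (auto intro!: R.finsum_closed simp: Pi_iff)
  also have "\<dots> = lin_comb M B (\<lambda>b. \<Oplus>a\<in>insert a A. c a \<otimes> d a b) g"
    using insert assms
    by (intro lin_comb_cong) (auto intro!: R.finsum_closed simp: Pi_iff)
  finally show ?case .
qed

end

lemma mod_hom_lin_comb:
  assumes "module R V" "module R Y" "f \<in> mod_hom R V Y"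
    and "finite A" "c \<in> A \<rightarrow> carrier R" "g \<in> A \<rightarrow> carrier V"
  shows "f (lin_comb V A c g) = lin_comb Y A c (\<lambda>a. f (g a))"
  using assms(4-6)
proof (induct A rule: finite_induct)
  case empty
  then show ?case using assms by (simp add: module.lin_comb_empty mod_hom_zero)
next
  case (insert a A)
  interpret V: module R V by fact
  interpret Y: module R Y by fact
  have fcl: "\<And>x. x \<in> carrier V \<Longrightarrow> f x \<in> carrier Y"
    using assms(3) by (rule mod_hom_closed)
  have cl: "lin_comb V A c g \<in> carrier V" "c a \<odot>\<^bsub>V\<^esub> g a \<in> carrier V"
    using insert by (auto intro!: V.lin_comb_closed)
  show ?case
    using insert cl fcl
    by (subst V.lin_comb_insert, simp_all, subst Y.lin_comb_insert)
       (auto simp: mod_hom_add[OF assms(3)] mod_hom_smult[OF assms(3)] Pi_iff)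
qed

section \<open>Powers of a module\<close>

definition self_module :: "('r, 'c) ring_scheme \<Rightarrow> ('r, 'r) module" where
  "self_module R = \<lparr>carrier = carrier R, monoid.mult = monoid.mult R, one = \<one>\<^bsub>R\<^esub>,
     ring.zero = \<zero>\<^bsub>R\<^esub>, add = add R, smult = monoid.mult R\<rparr>"

lemma self_module_simps [simp]:
  "carrier (self_module R) = carrier R" "\<zero>\<^bsub>self_module R\<^esub> = \<zero>\<^bsub>R\<^esub>"
  "x \<oplus>\<^bsub>self_module R\<^esub> y = x \<oplus>\<^bsub>R\<^esub> y" "x \<odot>\<^bsub>self_module R\<^esub> y = x \<otimes>\<^bsub>R\<^esub> y"
  by (simp_all add: self_module_def)

lemma (in cring) module_self_module: "module R (self_module R)"
proof (rule moduleI)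
  show "abelian_group (self_module R)"
    by (rule abelian_groupI) (auto simp: a_ac intro!: bexI[of _ "\<ominus> x" for x] l_neg)
qed (auto simp: is_cring l_distr r_distr m_assoc)

lemma finsum_self_module: "finsum (self_module R) f A = finsum R f A"
  by (simp add: finsum_def finprod_def self_module_def)

text \<open>For finite \<open>I\<close> this is V tensor R^I. It allows a complex V tensor Q, with Q
  free, to be handled without forming tensor products.\<close>

definition power_module :: "'i set \<Rightarrow> ('r, 'm) module \<Rightarrow> ('r, 'i \<Rightarrow> 'm) module" where
  "power_module I V = \<lparr>carrier = I \<rightarrow>\<^sub>E carrier V, monoid.mult = (\<lambda>f g. f), one = (\<lambda>i\<in>I. \<zero>\<^bsub>V\<^esub>),
     ring.zero = (\<lambda>i\<in>I. \<zero>\<^bsub>V\<^esub>), add = (\<lambda>f g. \<lambda>i\<in>I. f i \<oplus>\<^bsub>V\<^esub> g i), smult = (\<lambda>r f. \<lambda>i\<in>I. r \<odot>\<^bsub>V\<^esub> f i)\<rparr>"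

lemma power_module_simps:
  "carrier (power_module I V) = I \<rightarrow>\<^sub>E carrier V" "\<zero>\<^bsub>power_module I V\<^esub> = (\<lambda>i\<in>I. \<zero>\<^bsub>V\<^esub>)"
  "f \<oplus>\<^bsub>power_module I V\<^esub> g = (\<lambda>i\<in>I. f i \<oplus>\<^bsub>V\<^esub> g i)"
  "r \<odot>\<^bsub>power_module I V\<^esub> f = (\<lambda>i\<in>I. r \<odot>\<^bsub>V\<^esub> f i)"
  by (simp_all add: power_module_def)

lemma module_power_module:
  assumes "module R V"
  shows "module R (power_module I V)"
proof -
  interpret V: module R V by fact
  show ?thesis
  proof (rule moduleI)
    show "abelian_group (power_module I V)"
    proof (rule abelian_groupI)
      fix f assume "f \<in> carrier (power_module I V)"
      then show "\<exists>g\<in>carrier (power_module I V). g \<oplus>\<^bsub>power_module I V\<^esub> f = \<zero>\<^bsub>power_module I V\<^esub>"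
        by (intro bexI[of _ "\<lambda>i\<in>I. \<ominus>\<^bsub>V\<^esub> f i"])
           (auto simp: power_module_simps PiE_iff V.M.l_neg intro!: restrict_ext)
      show "\<zero>\<^bsub>power_module I V\<^esub> \<oplus>\<^bsub>power_module I V\<^esub> f = f"
        using \<open>f \<in> carrier (power_module I V)\<close>
        by (intro ext) (auto simp: power_module_simps PiE_iff extensional_def restrict_def)
    qed (auto simp: power_module_simps PiE_iff V.M.a_ac intro!: restrict_ext)
  next
    fix f assume "f \<in> carrier (power_module I V)"
    then show "\<one>\<^bsub>R\<^esub> \<odot>\<^bsub>power_module I V\<^esub> f = f"
      by (intro ext) (auto simp: power_module_simps PiE_iff extensional_def restrict_def)
  qed (auto simp: power_module_simps PiE_iff V.smult_l_distr V.smult_r_distr V.smult_assoc1 V.is_cring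
      intro!: restrict_ext)
qed

lemma power_module_minus:
  assumes "module R V" "f \<in> carrier (power_module I V)" "g \<in> carrier (power_module I V)" "i \<in> I"
  shows "(f \<ominus>\<^bsub>power_module I V\<^esub> g) i = f i \<ominus>\<^bsub>V\<^esub> g i"
proof -
  interpret V: module R V by fact
  interpret P: module R "power_module I V" using assms(1) by (rule module_power_module)
  have "\<ominus>\<^bsub>power_module I V\<^esub> g = (\<lambda>i\<in>I. \<ominus>\<^bsub>V\<^esub> g i)"
    by (rule P.M.minus_equality)
       (use assms in \<open>auto simp: power_module_simps PiE_iff V.M.l_neg intro!: restrict_ext\<close>)
  then show ?thesis using assms by (simp add: a_minus_def power_module_simps)
qed

lemma power_module_lin_comb:
  assumes "module R V" "finite A" "c \<in> A \<rightarrow> carrier R" "g \<in> A \<rightarrow> carrier (power_module I V)" "i \<in> I"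
  shows "lin_comb (power_module I V) A c g i = lin_comb V A c (\<lambda>a. g a i)"
proof -
  have "(\<lambda>f. f i) \<in> mod_hom R (power_module I V) V"
    using assms(5) by (intro mod_homI) (auto simp: power_module_simps)
  from mod_hom_lin_comb[OF module_power_module[OF assms(1)] assms(1) this assms(2-4)]
  show ?thesis .
qed

section \<open>Coordinates with respect to a finite basis\<close>

locale finite_basis = module R V for R (structure) and V :: "('r, 'm) module" (structure) +
  fixes B :: "'m set"
  assumes basis: "module_basis R V B" and finite_basis: "finite B"
begin

definition coords :: "'m \<Rightarrow> 'm \<Rightarrow> 'r" where
  "coords x = (THE c. c \<in> B \<rightarrow>\<^sub>E carrier R \<and> x = lin_comb V B c (\<lambda>b. b))"

lemma basis_closed: "b \<in> B \<Longrightarrow> b \<in> carrier V"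
  using basis by (auto simp: module_basis_def)

text \<open>\<open>module_basis\<close> sums over the support of the coefficients. As
  \<open>B\<close> is finite, the vanishing coefficients can be put back, and all later sums run
  over the fixed set \<open>B\<close>.\<close>

lemma ex1_coords:
  assumes "x \<in> carrier V"
  shows "\<exists>!c. c \<in> B \<rightarrow>\<^sub>E carrier R \<and> x = lin_comb V B c (\<lambda>b. b)"
proof -
  have eq: "(\<Oplus>\<^bsub>V\<^esub>b\<in>{b \<in> B. c b \<noteq> \<zero>\<^bsub>R\<^esub>}. c b \<odot>\<^bsub>V\<^esub> b) = lin_comb V B c (\<lambda>b. b)"
    if "c \<in> B \<rightarrow>\<^sub>E carrier R" for c
    using that basis_closed finite_basis
    by (subst lin_comb_mono_neutral[where A = "{b \<in> B. c b \<noteq> \<zero>\<^bsub>R\<^esub>}"]) (auto simp: lin_comb_def)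
  have "\<exists>!c. c \<in> B \<rightarrow>\<^sub>E carrier R \<and> finite {b \<in> B. c b \<noteq> \<zero>\<^bsub>R\<^esub>} \<and>
        x = (\<Oplus>\<^bsub>V\<^esub>b\<in>{b \<in> B. c b \<noteq> \<zero>\<^bsub>R\<^esub>}. c b \<odot>\<^bsub>V\<^esub> b)"
    using basis assms by (auto simp: module_basis_def)
  then show ?thesis
    using eq finite_basis by (metis (no_types, lifting) finite_subset mem_Collect_eq subsetI)
qed

lemma coords_in: "x \<in> carrier V \<Longrightarrow> coords x \<in> B \<rightarrow>\<^sub>E carrier R"
  and lin_comb_coords: "x \<in> carrier V \<Longrightarrow> lin_comb V B (coords x) (\<lambda>b. b) = x"
  using theI'[OF ex1_coords] unfolding coords_def by auto

lemma coords_closed: "x \<in> carrier V \<Longrightarrow> b \<in> B \<Longrightarrow> coords x b \<in> carrier R"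
  using coords_in by auto

lemma coords_unique:
  assumes "c \<in> B \<rightarrow> carrier R" "b \<in> B"
  shows "coords (lin_comb V B c (\<lambda>b. b)) b = c b"
proof -
  let ?c = "\<lambda>b\<in>B. c b"
  have eq: "lin_comb V B ?c (\<lambda>b. b) = lin_comb V B c (\<lambda>b. b)"
    using assms basis_closed by (intro lin_comb_cong) auto
  have x: "lin_comb V B c (\<lambda>b. b) \<in> carrier V"
    using assms basis_closed by (intro lin_comb_closed) auto
  have "coords (lin_comb V B c (\<lambda>b. b)) = ?c"
    unfolding coords_def using assms eq
    by (intro the1_equality[OF ex1_coords[OF x]]) auto
  then show ?thesis using assms by simp
qed

lemma coords_eqI:
  assumes "x \<in> carrier V" "y \<in> carrier V" "\<And>b. b \<in> B \<Longrightarrow> coords x b = coords y b"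
  shows "x = y"
proof -
  have "coords x = coords y"
    using coords_in[OF assms(1)] coords_in[OF assms(2)] assms(3) by (rule PiE_ext)
  then show ?thesis using lin_comb_coords assms by metis
qed

text \<open>With \<open>self_module\<close> as target, the general facts
  \<open>mod_hom_lin_comb\<close>, \<open>mod_hom_zero\<close> and \<open>smult_span_mod_hom\<close>
  apply to coordinates.\<close>

lemma coords_mod_hom:
  assumes "b \<in> B"
  shows "(\<lambda>x. coords x b) \<in> mod_hom R V (self_module R)"
proof (rule mod_homI; simp)
  fix x assume x: "x \<in> carrier V"
  then show "coords x b \<in> carrier R" using assms by (rule coords_closed)
  note cx = coords_closed[OF x]
  {
    fix y assume y: "y \<in> carrier V"
    note cy = coords_closed[OF y]
    have "x \<oplus>\<^bsub>V\<^esub> y = lin_comb V B (\<lambda>b. coords x b \<oplus>\<^bsub>R\<^esub> coords y b) (\<lambda>b. b)"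
      using x y cx cy basis_closed by (subst lin_comb_add) (auto simp: lin_comb_coords)
    then show "coords (x \<oplus>\<^bsub>V\<^esub> y) b = coords x b \<oplus>\<^bsub>R\<^esub> coords y b"
      using assms cx cy by (simp add: coords_unique)
  next
    fix r assume r: "r \<in> carrier R"
    have "r \<odot>\<^bsub>V\<^esub> x = lin_comb V B (\<lambda>b. r \<otimes>\<^bsub>R\<^esub> coords x b) (\<lambda>b. b)"
      using x r cx basis_closed finite_basis by (subst lin_comb_smult) (auto simp: lin_comb_coords)
    then show "coords (r \<odot>\<^bsub>V\<^esub> x) b = r \<otimes>\<^bsub>R\<^esub> coords x b"
      using assms r cx by (simp add: coords_unique)
  }
qed

lemma coords_lin_comb:
  assumes "finite A" "c \<in> A \<rightarrow> carrier R" "g \<in> A \<rightarrow> carrier V" "b \<in> B"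
  shows "coords (lin_comb V A c g) b = (\<Oplus>\<^bsub>R\<^esub>a\<in>A. c a \<otimes>\<^bsub>R\<^esub> coords (g a) b)"
  using mod_hom_lin_comb[OF module_axioms R.module_self_module coords_mod_hom[OF assms(4)] assms(1-3)]
  by (simp add: lin_comb_def finsum_self_module)

lemma coords_smult:
  "r \<in> carrier R \<Longrightarrow> x \<in> carrier V \<Longrightarrow> b \<in> B \<Longrightarrow> coords (r \<odot>\<^bsub>V\<^esub> x) b = r \<otimes>\<^bsub>R\<^esub> coords x b"
  using mod_hom_smult[OF coords_mod_hom] by simp

lemma coords_add:
  "x \<in> carrier V \<Longrightarrow> y \<in> carrier V \<Longrightarrow> b \<in> B \<Longrightarrow> coords (x \<oplus>\<^bsub>V\<^esub> y) b = coords x b \<oplus>\<^bsub>R\<^esub> coords y b"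
  using mod_hom_add[OF coords_mod_hom] by simp

lemma coords_zero: "b \<in> B \<Longrightarrow> coords \<zero>\<^bsub>V\<^esub> b = \<zero>\<^bsub>R\<^esub>"
  using mod_hom_zero[OF module_axioms R.module_self_module coords_mod_hom] by simp

end

section \<open>Resolutions in coordinates\<close>

definition power_map :: "'i set \<Rightarrow> ('m \<Rightarrow> 'n) \<Rightarrow> ('i \<Rightarrow> 'm) \<Rightarrow> 'i \<Rightarrow> 'n" where
  "power_map C h f = (\<lambda>c\<in>C. h (f c))"

text \<open>With V^C read as V tensor R^C, this is the identity of V tensored with the linear map
  that sends the basis vector c to the row \<open>D c\<close>.\<close>

definition matrix_map ::
  "'i set \<Rightarrow> 'j set \<Rightarrow> ('i \<Rightarrow> 'j \<Rightarrow> 'r) \<Rightarrow> ('r, 'm) module \<Rightarrow> ('i \<Rightarrow> 'm) \<Rightarrow> 'j \<Rightarrow> 'm" where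
  "matrix_map C C' D V f = (\<lambda>c'\<in>C'. lin_comb V C (\<lambda>c. D c c') f)"

lemma power_map_mod_hom:
  assumes "h \<in> mod_hom R V W"
  shows "power_map C h \<in> mod_hom R (power_module C V) (power_module C W)"
  using assms by (intro mod_homI)
    (auto simp: power_module_simps power_map_def mod_hom_add mod_hom_smult PiE_iff intro!: restrict_ext
      dest: mod_hom_closed)

lemma matrix_map_mod_hom:
  assumes "module R V" "finite C" "\<And>c c'. c \<in> C \<Longrightarrow> c' \<in> C' \<Longrightarrow> D c c' \<in> carrier R"
  shows "matrix_map C C' D V \<in> mod_hom R (power_module C V) (power_module C' V)"
proof -
  interpret V: module R V by fact
  show ?thesis
  proof (rule mod_homI)
    fix f assume f: "f \<in> carrier (power_module C V)"
    then have f': "f \<in> C \<rightarrow> carrier V" by (auto simp: power_module_simps)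
    show "matrix_map C C' D V f \<in> carrier (power_module C' V)"
      using f' assms by (auto simp: power_module_simps matrix_map_def intro!: V.lin_comb_closed)
    {
      fix g assume "g \<in> carrier (power_module C V)"
      then have g': "g \<in> C \<rightarrow> carrier V" by (auto simp: power_module_simps)
      have "lin_comb V C (\<lambda>c. D c c') (\<lambda>i\<in>C. f i \<oplus>\<^bsub>V\<^esub> g i) =
          lin_comb V C (\<lambda>c. D c c') f \<oplus>\<^bsub>V\<^esub> lin_comb V C (\<lambda>c. D c c') g" if "c' \<in> C'" for c'
        using f' g' that assms
        by (subst V.lin_comb_add_right[symmetric]) (auto intro!: V.lin_comb_cong)
      then show "matrix_map C C' D V (f \<oplus>\<^bsub>power_module C V\<^esub> g) =
          matrix_map C C' D V f \<oplus>\<^bsub>power_module C' V\<^esub> matrix_map C C' D V g"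
        by (auto simp: power_module_simps matrix_map_def intro!: restrict_ext)
    }
    {
      fix r assume r: "r \<in> carrier R"
      have "lin_comb V C (\<lambda>c. D c c') (\<lambda>i\<in>C. r \<odot>\<^bsub>V\<^esub> f i) =
          r \<odot>\<^bsub>V\<^esub> lin_comb V C (\<lambda>c. D c c') f" if "c' \<in> C'" for c'
        using f' r that assms
        by (subst V.lin_comb_smult_right[symmetric]) (auto intro!: V.lin_comb_cong)
      then show "matrix_map C C' D V (r \<odot>\<^bsub>power_module C V\<^esub> f) =
          r \<odot>\<^bsub>power_module C' V\<^esub> matrix_map C C' D V f"
        by (auto simp: power_module_simps matrix_map_def intro!: restrict_ext)
    }
  qed
qed

text \<open>A homomorphism acts on the coefficients and a matrix on the indices, so the two commute.
  This gives the squares of the double complex, which commute without signs.\<close>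

lemma power_map_matrix_map:
  assumes "module R V" "module R W" "h \<in> mod_hom R V W" "finite C"
    and "\<And>c c'. c \<in> C \<Longrightarrow> c' \<in> C' \<Longrightarrow> D c c' \<in> carrier R"
    and "f \<in> carrier (power_module C V)"
  shows "power_map C' h (matrix_map C C' D V f) = matrix_map C C' D W (power_map C h f)"
proof -
  interpret V: module R V by fact
  interpret W: module R W by fact
  have f: "f \<in> C \<rightarrow> carrier V" using assms by (auto simp: power_module_simps)
  have "h (lin_comb V C (\<lambda>c. D c c') f) = lin_comb W C (\<lambda>c. D c c') (\<lambda>c\<in>C. h (f c))" if "c' \<in> C'" for c'
    using assms f that mod_hom_closed[OF assms(3)]
    by (subst mod_hom_lin_comb[OF assms(1-4)]) (auto intro!: W.lin_comb_cong)
  then show ?thesis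
    by (auto simp: power_map_def matrix_map_def)
qed

lemma (in cring) finsum_single_coeff:
  assumes "finite A" "a \<in> A" "f \<in> A \<rightarrow> carrier R"
  shows "(\<Oplus>c\<in>A. f c \<otimes> (if c = a then \<one> else \<zero>)) = f a"
proof -
  have "(\<Oplus>c\<in>A. f c \<otimes> (if c = a then \<one> else \<zero>)) = (\<Oplus>c\<in>A. if a = c then f c else \<zero>)"
    using assms by (intro finsum_cong') (auto simp: Pi_iff)
  also have "\<dots> = f a"
    using assms by (intro finsum_singleton) auto
  finally show ?thesis .
qed

text \<open>A free resolution of N reduced to matrices: \<open>D j c c'\<close> is the coefficient
  of c' in the differential of c, and \<open>e\<close> lists the generators of N. Exactness is asked
  for scalar vectors only; \<open>delta_exact\<close> extends it to free coefficient
  modules.\<close>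

locale coordinate_resolution = N: module R N for R (structure) and N :: "('r, 'n) module" +
  fixes C :: "nat \<Rightarrow> 'c set" and D :: "nat \<Rightarrow> 'c \<Rightarrow> 'c \<Rightarrow> 'r" and e :: "'c \<Rightarrow> 'n"
  assumes finite_C: "finite (C j)"
    and D_closed: "c \<in> C (Suc j) \<Longrightarrow> c' \<in> C j \<Longrightarrow> D j c c' \<in> carrier R"
    and e_closed: "e \<in> C 0 \<rightarrow> carrier N"
    and generates: "y \<in> carrier N \<Longrightarrow> \<exists>v\<in>C 0 \<rightarrow> carrier R. y = lin_comb N (C 0) v e"
    and exact_0: "v \<in> C 0 \<rightarrow> carrier R \<Longrightarrow> lin_comb N (C 0) v e = \<zero>\<^bsub>N\<^esub> \<longleftrightarrow>
      (\<exists>w\<in>C 1 \<rightarrow> carrier R. \<forall>c'\<in>C 0. v c' = (\<Oplus>c\<in>C 1. D 0 c c' \<otimes> w c))"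
    and exact_Suc: "v \<in> C (Suc j) \<rightarrow> carrier R \<Longrightarrow>
      (\<forall>c'\<in>C j. (\<Oplus>c\<in>C (Suc j). D j c c' \<otimes> v c) = \<zero>) \<longleftrightarrow>
      (\<exists>w\<in>C (Suc (Suc j)) \<rightarrow> carrier R.
        \<forall>c'\<in>C (Suc j). v c' = (\<Oplus>c\<in>C (Suc (Suc j)). D (Suc j) c c' \<otimes> w c))"
begin

text \<open>The row \<open>D (Suc j) c\<close> is the image of the unit vector at c, so the
  direction of \<open>exact_Suc\<close> from images to cycles applies to it.\<close>

lemma D_D:
  assumes "c \<in> C (Suc (Suc j))" "c' \<in> C j"
  shows "(\<Oplus>b\<in>C (Suc j). D j b c' \<otimes> D (Suc j) c b) = \<zero>"
proof -
  let ?w = "\<lambda>a. if a = c then \<one> else \<zero>"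
  have "\<forall>b\<in>C (Suc j). D (Suc j) c b = (\<Oplus>a\<in>C (Suc (Suc j)). D (Suc j) a b \<otimes> ?w a)"
    using assms D_closed finite_C N.R.finsum_single_coeff[of "C (Suc (Suc j))" c "\<lambda>a. D (Suc j) a b" for b]
    by (auto simp: Pi_iff)
  then show ?thesis
    using exact_Suc[of "\<lambda>b. D (Suc j) c b" j] assms D_closed by (fastforce intro!: bexI[of _ ?w])
qed

lemma e_D:
  assumes "c \<in> C (Suc 0)"
  shows "lin_comb N (C 0) (\<lambda>c'. D 0 c c') e = \<zero>\<^bsub>N\<^esub>"
proof -
  let ?w = "\<lambda>a. if a = c then \<one> else \<zero>"
  have "\<forall>b\<in>C 0. D 0 c b = (\<Oplus>a\<in>C 1. D 0 a b \<otimes> ?w a)"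
    using assms D_closed finite_C N.R.finsum_single_coeff[of "C (Suc 0)" c "\<lambda>a. D 0 a b" for b]
    by (auto simp: Pi_iff)
  then show ?thesis
    using exact_0[of "\<lambda>b. D 0 c b"] assms D_closed by (fastforce intro!: bexI[of _ ?w])
qed

abbreviation delta :: "('r, 'm) module \<Rightarrow> nat \<Rightarrow> ('c \<Rightarrow> 'm) \<Rightarrow> 'c \<Rightarrow> 'm" where
  "delta V j \<equiv> matrix_map (C (Suc j)) (C j) (D j) V"

lemma delta_mod_hom:
  "module R V \<Longrightarrow> delta V j \<in> mod_hom R (power_module (C (Suc j)) V) (power_module (C j) V)"
  by (intro matrix_map_mod_hom finite_C D_closed)

lemma power_map_delta:
  assumes "module R V" "module R W" "h \<in> mod_hom R V W" "f \<in> carrier (power_module (C (Suc j)) V)"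
  shows "power_map (C j) h (delta V j f) = delta W j (power_map (C (Suc j)) h f)"
  using assms by (intro power_map_matrix_map finite_C) (auto intro: D_closed)

lemma delta_delta:
  assumes "module R V" "f \<in> carrier (power_module (C (Suc (Suc j))) V)"
  shows "delta V j (delta V (Suc j) f) = \<zero>\<^bsub>power_module (C j) V\<^esub>"
proof -
  interpret V: module R V by fact
  have f: "f \<in> C (Suc (Suc j)) \<rightarrow> carrier V" using assms by (auto simp: power_module_simps)
  have "lin_comb V (C (Suc j)) (\<lambda>c. D j c c') (delta V (Suc j) f) = \<zero>\<^bsub>V\<^esub>" if c': "c' \<in> C j" for c'
  proof -
    have "lin_comb V (C (Suc j)) (\<lambda>c. D j c c') (delta V (Suc j) f) =
        lin_comb V (C (Suc j)) (\<lambda>c. D j c c')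
          (\<lambda>c. lin_comb V (C (Suc (Suc j))) (\<lambda>a. D (Suc j) a c) f)"
      using f c' D_closed
      by (intro V.lin_comb_cong) (auto simp: matrix_map_def intro!: V.lin_comb_closed)
    also have "\<dots> = lin_comb V (C (Suc (Suc j))) (\<lambda>a. \<Oplus>b\<in>C (Suc j). D j b c' \<otimes> D (Suc j) a b) f"
      using f c' D_closed finite_C by (intro V.lin_comb_lin_comb) auto
    also have "\<dots> = \<zero>\<^bsub>V\<^esub>"
      using D_D c' f by (intro V.lin_comb_zero_left) auto
    finally show ?thesis .
  qed
  then show ?thesis by (auto simp: matrix_map_def power_module_simps)
qed

text \<open>Coordinates with respect to \<open>B\<close> split the complex V tensor Q into copies of
  the exact complex of scalars, one for each basis element. Preimages are taken in each copy and
  become the coordinates of \<open>g\<close>.\<close>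

lemma delta_exact:
  assumes "finite_basis R V B" "f \<in> carrier (power_module (C (Suc j)) V)"
    and "delta V j f = \<zero>\<^bsub>power_module (C j) V\<^esub>"
  shows "\<exists>g\<in>carrier (power_module (C (Suc (Suc j))) V). delta V (Suc j) g = f"
proof -
  interpret V: finite_basis R V B by fact
  let ?C1 = "C (Suc j)" and ?C2 = "C (Suc (Suc j))"
  have f: "f \<in> ?C1 \<rightarrow> carrier V" using assms by (auto simp: power_module_simps)
  have "\<exists>w\<in>?C2 \<rightarrow> carrier R. \<forall>c'\<in>?C1. V.coords (f c') b = (\<Oplus>c\<in>?C2. D (Suc j) c c' \<otimes> w c)"
    if b: "b \<in> B" for b
  proof -
    have "(\<Oplus>c\<in>?C1. D j c c' \<otimes> V.coords (f c) b) = \<zero>" if c': "c' \<in> C j" for c'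
    proof -
      have "(\<Oplus>c\<in>?C1. D j c c' \<otimes> V.coords (f c) b) = V.coords (lin_comb V ?C1 (\<lambda>c. D j c c') f) b"
        using finite_C D_closed f c' b by (intro V.coords_lin_comb[symmetric]) auto
      also have "lin_comb V ?C1 (\<lambda>c. D j c c') f = \<zero>\<^bsub>V\<^esub>"
        using fun_cong[OF assms(3), of c'] c' by (simp add: matrix_map_def power_module_simps)
      finally show ?thesis using b by (simp add: V.coords_zero)
    qed
    then show ?thesis
      using exact_Suc[of "\<lambda>c. V.coords (f c) b" j] f b V.coords_closed by (auto simp: Pi_iff)
  qed
  then obtain w where w: "\<And>b. b \<in> B \<Longrightarrow> w b \<in> ?C2 \<rightarrow> carrier R"
    "\<And>b c'. b \<in> B \<Longrightarrow> c' \<in> ?C1 \<Longrightarrow> V.coords (f c') b = (\<Oplus>c\<in>?C2. D (Suc j) c c' \<otimes> w b c)"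
    by metis
  define g where "g = (\<lambda>c\<in>?C2. lin_comb V B (\<lambda>b. w b c) (\<lambda>b. b))"
  have g: "g \<in> carrier (power_module ?C2 V)"
    using w V.basis_closed by (auto simp: g_def power_module_simps intro!: V.lin_comb_closed)
  have "delta V (Suc j) g c' = f c'" if c': "c' \<in> ?C1" for c'
  proof -
    have "delta V (Suc j) g c' = lin_comb V ?C2 (\<lambda>c. D (Suc j) c c') (\<lambda>c. lin_comb V B (\<lambda>b. w b c) (\<lambda>b. b))"
      using c' w V.basis_closed D_closed unfolding matrix_map_def
      by (auto simp: g_def intro!: V.lin_comb_cong V.lin_comb_closed)
    also have "\<dots> = lin_comb V B (\<lambda>b. \<Oplus>c\<in>?C2. D (Suc j) c c' \<otimes> w b c) (\<lambda>b. b)"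
      using c' w V.basis_closed D_closed finite_C V.finite_basis
      by (intro V.lin_comb_lin_comb) auto
    also have "\<dots> = lin_comb V B (V.coords (f c')) (\<lambda>b. b)"
      using c' f V.basis_closed V.coords_closed
      by (intro V.lin_comb_cong) (auto simp: w(2)[symmetric] Pi_iff)
    finally show ?thesis using f c' by (simp add: V.lin_comb_coords Pi_iff)
  qed
  then have "delta V (Suc j) g = f"
    using assms(2) by (intro ext) (auto simp: matrix_map_def power_module_simps PiE_iff extensional_def)
  then show ?thesis using g by blast
qed

end

section \<open>The diagonal chase\<close>

text \<open>Commuting squares, with \<open>p\<close> lowering the first index and \<open>q\<close>
  the second. Exactness is asked only at positive index in the direction concerned: at index 0 the
  cokernels carry M tensor Q and P tensor N, whose homology is to be compared.\<close>

locale double_complex =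
  fixes R :: "('r, 'x) ring_scheme" and E :: "nat \<Rightarrow> nat \<Rightarrow> ('r, 'e) module"
    and p q :: "nat \<Rightarrow> nat \<Rightarrow> 'e \<Rightarrow> 'e"
  assumes E: "module R (E i j)"
    and p: "p i j \<in> mod_hom R (E (Suc i) j) (E i j)"
    and q: "q i j \<in> mod_hom R (E i (Suc j)) (E i j)"
    and p_q: "w \<in> carrier (E (Suc i) (Suc j)) \<Longrightarrow> p i j (q (Suc i) j w) = q i j (p i (Suc j) w)"
    and p_p: "w \<in> carrier (E (Suc (Suc i)) j) \<Longrightarrow> p i j (p (Suc i) j w) = \<zero>\<^bsub>E i j\<^esub>"
    and q_q: "w \<in> carrier (E i (Suc (Suc j))) \<Longrightarrow> q i j (q i (Suc j) w) = \<zero>\<^bsub>E i j\<^esub>"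
    and p_exact: "w \<in> carrier (E (Suc i) j) \<Longrightarrow> p i j w = \<zero>\<^bsub>E i j\<^esub> \<Longrightarrow>
      \<exists>v\<in>carrier (E (Suc (Suc i)) j). p (Suc i) j v = w"
    and q_exact: "w \<in> carrier (E i (Suc j)) \<Longrightarrow> q i j w = \<zero>\<^bsub>E i j\<^esub> \<Longrightarrow>
      \<exists>v\<in>carrier (E i (Suc (Suc j))). q i (Suc j) v = w"
begin

lemma transpose: "double_complex R (\<lambda>i j. E j i) (\<lambda>i j. q j i) (\<lambda>i j. p j i)"
  by (rule double_complex.intro) (auto simp: E p q p_q p_p q_q p_exact q_exact)

text \<open>Induction on the first index. From a pair (w, w') in position i + 1, \<open>p w\<close>
  is killed by \<open>q\<close> because \<open>p p w'\<close> vanishes, hence it equals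
  \<open>q v\<close>; so (v, w) is a pair in position i on the same diagonal. A solution (a, b)
  there makes w minus \<open>q a\<close> a cycle for \<open>p\<close>, and a preimage of it
  completes the solution for w. The hypothesis \<open>base\<close> is the case at the edge.\<close>

lemma chase:
  assumes base: "\<And>w w'. w \<in> carrier (E 0 (Suc n)) \<Longrightarrow> w' \<in> carrier (E (Suc 0) n) \<Longrightarrow> q 0 n w = p 0 n w' \<Longrightarrow>
      \<exists>a\<in>carrier (E (Suc 0) (Suc n)). \<exists>b\<in>carrier (E 0 (Suc (Suc n))). w = p 0 (Suc n) a \<oplus>\<^bsub>E 0 (Suc n)\<^esub> q 0 (Suc n) b"
    and "i + m = n" "w \<in> carrier (E i (Suc m))" "w' \<in> carrier (E (Suc i) m)" "q i m w = p i m w'"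
  shows "\<exists>a\<in>carrier (E (Suc i) (Suc m)). \<exists>b\<in>carrier (E i (Suc (Suc m))).
    w = p i (Suc m) a \<oplus>\<^bsub>E i (Suc m)\<^esub> q i (Suc m) b"
  using assms(2-)
proof (induct i arbitrary: m w w')
  case 0
  then show ?case using base by auto
next
  case (Suc i)
  interpret E1: module R "E i (Suc m)" by (rule E)
  interpret E2: module R "E (Suc i) (Suc m)" by (rule E)
  note cl = mod_hom_closed[OF p] mod_hom_closed[OF q]
  let ?u = "p i (Suc m) w"
  have "q i m ?u = p i m (q (Suc i) m w)"
    using Suc by (intro p_q[symmetric])
  also have "\<dots> = \<zero>\<^bsub>E i m\<^esub>" using Suc by (simp add: p_p)
  finally obtain v where v: "v \<in> carrier (E i (Suc (Suc m)))" "q i (Suc m) v = ?u"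
    using q_exact[of ?u i m] cl Suc by blast
  obtain a b where ab: "a \<in> carrier (E (Suc i) (Suc (Suc m)))" "b \<in> carrier (E i (Suc (Suc (Suc m))))"
    "v = p i (Suc (Suc m)) a \<oplus>\<^bsub>E i (Suc (Suc m))\<^esub> q i (Suc (Suc m)) b"
    using Suc(1)[of "Suc m" v w] Suc(2-) v by auto
  have "?u = q i (Suc m) (p i (Suc (Suc m)) a) \<oplus>\<^bsub>E i (Suc m)\<^esub> q i (Suc m) (q i (Suc (Suc m)) b)"
    using v ab cl by (metis mod_hom_add[OF q])
  also have "\<dots> = p i (Suc m) (q (Suc i) (Suc m) a)"
    using ab cl by (simp add: q_q p_q)
  finally have u: "?u = p i (Suc m) (q (Suc i) (Suc m) a)" .
  have qa: "q (Suc i) (Suc m) a \<in> carrier (E (Suc i) (Suc m))" using ab cl by blast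
  have "p i (Suc m) (w \<ominus>\<^bsub>E (Suc i) (Suc m)\<^esub> q (Suc i) (Suc m) a) = ?u \<ominus>\<^bsub>E i (Suc m)\<^esub> ?u"
    using Suc qa by (subst mod_hom_minus[OF E E p]) (auto simp: u)
  also have "\<dots> = \<zero>\<^bsub>E i (Suc m)\<^esub>" using Suc cl by (simp add: E1.M.r_neg a_minus_def)
  finally obtain d where d: "d \<in> carrier (E (Suc (Suc i)) (Suc m))"
    "p (Suc i) (Suc m) d = w \<ominus>\<^bsub>E (Suc i) (Suc m)\<^esub> q (Suc i) (Suc m) a"
    using p_exact Suc qa by (metis E2.M.minus_closed)
  have "w = p (Suc i) (Suc m) d \<oplus>\<^bsub>E (Suc i) (Suc m)\<^esub> q (Suc i) (Suc m) a"
    unfolding d using Suc qa by (simp add: a_minus_def E2.M.a_assoc E2.M.l_neg)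
  then show ?case using d ab by blast
qed

end

section \<open>Tensor products against a presented module\<close>

context
  fixes R :: "('r, 'x) ring_scheme" and V :: "('r, 'v) module" and N :: "('r, 'n) module"
  assumes V: "module R V" and N: "module R N"
begin

interpretation V: module R V by (rule V)
interpretation N: module R N by (rule N)

private abbreviation "rel \<equiv> tensor_relations R V N"

text \<open>The inverse in \<open>free_Abelian_group\<close> is known to be negation for elements
  supported on the generating set. The bound on the support is what gives access to the
  \<open>inv\<close> clause of \<open>generate\<close>.\<close>

lemma tensor_relations_keys: "a \<in> rel \<Longrightarrow> Poly_Mapping.keys a \<subseteq> carrier V \<times> carrier N"
  unfolding tensor_relations_def
proof (induct rule: generate.induct)
  case (incl h)
  then show ?case
    by (elim UnE CollectE exE conjE; hypsubst) (intro order_trans[OF keys_diff] Un_least; simp)+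
next
  case (inv h)
  then have "Poly_Mapping.keys h \<subseteq> carrier V \<times> carrier N"
    by (elim UnE CollectE exE conjE; hypsubst) (intro order_trans[OF keys_diff] Un_least; simp)+
  then show ?case by simp
next
  case (eng a b)
  then show ?case
    using order_trans[OF keys_add[of a b] Un_least] by simp
qed simp

lemma tensor_relations_subgroup: "subgroup rel (free_Abelian_group (carrier V \<times> carrier N))"
proof -
  have gen: "\<And>a. a \<in> {frag_of (x \<oplus>\<^bsub>V\<^esub> x', y) - frag_of (x, y) - frag_of (x', y) | x x' y.
         x \<in> carrier V \<and> x' \<in> carrier V \<and> y \<in> carrier N} \<union>
      {frag_of (x, y \<oplus>\<^bsub>N\<^esub> y') - frag_of (x, y) - frag_of (x, y') | x y y'.
         x \<in> carrier V \<and> y \<in> carrier N \<and> y' \<in> carrier N} \<union>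
      {frag_of (r \<odot>\<^bsub>V\<^esub> x, y) - frag_of (x, r \<odot>\<^bsub>N\<^esub> y) | r x y.
         r \<in> carrier R \<and> x \<in> carrier V \<and> y \<in> carrier N} \<Longrightarrow> a \<in> rel"
    unfolding tensor_relations_def by (rule generate.incl)
  show ?thesis
    unfolding tensor_relations_def
    by (rule group.generate_is_subgroup[OF group_free_Abelian_group], rule subsetI, drule gen,
      drule tensor_relations_keys, simp)
qed

lemma tensor_relations_add: "a \<in> rel \<Longrightarrow> b \<in> rel \<Longrightarrow> a + b \<in> rel"
  using subgroup.m_closed[OF tensor_relations_subgroup, of a b] by simp

lemma tensor_relations_minus: "a \<in> rel \<Longrightarrow> - a \<in> rel"
  using subgroup.m_inv_closed[OF tensor_relations_subgroup, of a] tensor_relations_keys[of a] by simp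

lemma tensor_relations_zero: "0 \<in> rel"
  using subgroup.one_closed[OF tensor_relations_subgroup] by simp

lemma tensor_relations_diff: "a \<in> rel \<Longrightarrow> b \<in> rel \<Longrightarrow> a - b \<in> rel"
  using tensor_relations_add[OF _ tensor_relations_minus] by fastforce

lemma tensor_relations_sum: "(\<And>i. i \<in> A \<Longrightarrow> f i - g i \<in> rel) \<Longrightarrow> sum f A - sum g A \<in> rel"
proof (induct A rule: infinite_finite_induct)
  case (insert a A)
  then show ?case using tensor_relations_add[of "f a - g a" "sum f A - sum g A"]
    by (simp add: algebra_simps)
qed (auto simp: tensor_relations_zero)

lemma tensor_relations_left:
  "x \<in> carrier V \<Longrightarrow> x' \<in> carrier V \<Longrightarrow> y \<in> carrier N \<Longrightarrow>
    frag_of (x \<oplus>\<^bsub>V\<^esub> x', y) - frag_of (x, y) - frag_of (x', y) \<in> rel"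
  and tensor_relations_right:
  "x \<in> carrier V \<Longrightarrow> y \<in> carrier N \<Longrightarrow> y' \<in> carrier N \<Longrightarrow>
    frag_of (x, y \<oplus>\<^bsub>N\<^esub> y') - frag_of (x, y) - frag_of (x, y') \<in> rel"
  and tensor_relations_smult:
  "r \<in> carrier R \<Longrightarrow> x \<in> carrier V \<Longrightarrow> y \<in> carrier N \<Longrightarrow>
    frag_of (r \<odot>\<^bsub>V\<^esub> x, y) - frag_of (x, r \<odot>\<^bsub>N\<^esub> y) \<in> rel"
  unfolding tensor_relations_def by (rule generate.incl, blast)+

lemma tensor_relations_zero_left: "y \<in> carrier N \<Longrightarrow> frag_of (\<zero>\<^bsub>V\<^esub>, y) \<in> rel"
  using tensor_relations_minus[OF tensor_relations_left[of "\<zero>\<^bsub>V\<^esub>" "\<zero>\<^bsub>V\<^esub>" y]] by simp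

lemma tensor_relations_zero_right: "x \<in> carrier V \<Longrightarrow> frag_of (x, \<zero>\<^bsub>N\<^esub>) \<in> rel"
  using tensor_relations_minus[OF tensor_relations_right[of x "\<zero>\<^bsub>N\<^esub>" "\<zero>\<^bsub>N\<^esub>"]] by simp

lemma tensor_relations_lin_comb_left:
  assumes "finite A" "c \<in> A \<rightarrow> carrier R" "g \<in> A \<rightarrow> carrier V" "y \<in> carrier N"
  shows "frag_of (lin_comb V A c g, y) - (\<Sum>a\<in>A. frag_of (g a, c a \<odot>\<^bsub>N\<^esub> y)) \<in> rel"
  using assms(1-3)
proof (induct A rule: finite_induct)
  case empty
  then show ?case by (simp add: tensor_relations_zero_left assms)
next
  case (insert a A)
  let ?l = "lin_comb V A c g"
  have cl: "?l \<in> carrier V" "c a \<odot>\<^bsub>V\<^esub> g a \<in> carrier V" "c a \<in> carrier R" "g a \<in> carrier V"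
    using insert by (auto intro!: V.lin_comb_closed)
  have eq: "lin_comb V (insert a A) c g = c a \<odot>\<^bsub>V\<^esub> g a \<oplus>\<^bsub>V\<^esub> ?l"
    using insert by (intro V.lin_comb_insert)
  have 1: "frag_of (c a \<odot>\<^bsub>V\<^esub> g a \<oplus>\<^bsub>V\<^esub> ?l, y) - frag_of (c a \<odot>\<^bsub>V\<^esub> g a, y) - frag_of (?l, y) \<in> rel"
    using cl assms by (intro tensor_relations_left)
  have 2: "frag_of (c a \<odot>\<^bsub>V\<^esub> g a, y) - frag_of (g a, c a \<odot>\<^bsub>N\<^esub> y) \<in> rel"
    using cl assms by (intro tensor_relations_smult)
  have 3: "frag_of (?l, y) - (\<Sum>a\<in>A. frag_of (g a, c a \<odot>\<^bsub>N\<^esub> y)) \<in> rel"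
    using insert by auto
  show ?case
    using tensor_relations_add[OF tensor_relations_add[OF 1 2] 3] insert by (simp add: eq algebra_simps)
qed

lemma tensor_relations_lin_comb_right:
  assumes "finite A" "c \<in> A \<rightarrow> carrier R" "g \<in> A \<rightarrow> carrier N" "x \<in> carrier V"
  shows "frag_of (x, lin_comb N A c g) - (\<Sum>a\<in>A. frag_of (x, c a \<odot>\<^bsub>N\<^esub> g a)) \<in> rel"
  using assms(1-3)
proof (induct A rule: finite_induct)
  case empty
  then show ?case by (simp add: tensor_relations_zero_right assms)
next
  case (insert a A)
  let ?l = "lin_comb N A c g"
  have cl: "?l \<in> carrier N" "c a \<odot>\<^bsub>N\<^esub> g a \<in> carrier N"
    using insert by (auto intro!: N.lin_comb_closed)
  have eq: "lin_comb N (insert a A) c g = c a \<odot>\<^bsub>N\<^esub> g a \<oplus>\<^bsub>N\<^esub> ?l"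
    using insert by (intro N.lin_comb_insert)
  have 1: "frag_of (x, c a \<odot>\<^bsub>N\<^esub> g a \<oplus>\<^bsub>N\<^esub> ?l) - frag_of (x, c a \<odot>\<^bsub>N\<^esub> g a) - frag_of (x, ?l) \<in> rel"
    using cl assms by (intro tensor_relations_right)
  have 3: "frag_of (x, ?l) - (\<Sum>a\<in>A. frag_of (x, c a \<odot>\<^bsub>N\<^esub> g a)) \<in> rel"
    using insert by auto
  show ?case
    using tensor_relations_add[OF 1 3] insert by (simp add: eq algebra_simps)
qed

text \<open>The form of induction needed to show that a map on formal sums respects the relations:
  inverses have become negation, and membership of the summands is at hand.\<close>

lemma tensor_relations_induct:
  assumes "a \<in> rel" "P 0" "\<And>a b. a \<in> rel \<Longrightarrow> b \<in> rel \<Longrightarrow> P a \<Longrightarrow> P b \<Longrightarrow> P (a + b)"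
    "\<And>a. a \<in> rel \<Longrightarrow> P a \<Longrightarrow> P (- a)"
    "\<And>x x' y. x \<in> carrier V \<Longrightarrow> x' \<in> carrier V \<Longrightarrow> y \<in> carrier N \<Longrightarrow>
      P (frag_of (x \<oplus>\<^bsub>V\<^esub> x', y) - frag_of (x, y) - frag_of (x', y))"
    "\<And>x y y'. x \<in> carrier V \<Longrightarrow> y \<in> carrier N \<Longrightarrow> y' \<in> carrier N \<Longrightarrow>
      P (frag_of (x, y \<oplus>\<^bsub>N\<^esub> y') - frag_of (x, y) - frag_of (x, y'))"
    "\<And>r x y. r \<in> carrier R \<Longrightarrow> x \<in> carrier V \<Longrightarrow> y \<in> carrier N \<Longrightarrow>
      P (frag_of (r \<odot>\<^bsub>V\<^esub> x, y) - frag_of (x, r \<odot>\<^bsub>N\<^esub> y))"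
  shows "P a"
  using assms(1) unfolding tensor_relations_def
proof (induct rule: generate.induct)
  case (incl h)
  then show ?case by (elim UnE CollectE exE conjE; hypsubst) (rule assms(5-7); assumption)+
next
  case (inv h)
  have h: "h \<in> rel" unfolding tensor_relations_def by (rule generate.incl) (rule inv)
  have "P h"
    using inv by (elim UnE CollectE exE conjE; hypsubst) (rule assms(5-7); assumption)+
  then show ?case using assms(4)[OF h] tensor_relations_keys[OF h] by simp
next
  case (eng a b)
  then show ?case using assms(3) by (simp add: tensor_relations_def)
qed (simp add: assms)

end

lemma frag_map_tensor_relations:
  assumes "module R V" "module R W" "module R N" "f \<in> mod_hom R V W" "a \<in> tensor_relations R V N"
  shows "frag_extend (\<lambda>(x, y). frag_of (f x, y)) a \<in> tensor_relations R W N"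
proof (rule tensor_relations_induct[OF assms(1,3,5),
    where P = "\<lambda>a. frag_extend (\<lambda>(x, y). frag_of (f x, y)) a \<in> tensor_relations R W N"])
qed (simp_all add: tensor_relations_zero[OF assms(2,3)] tensor_relations_add[OF assms(2,3)]
    tensor_relations_minus[OF assms(2,3)] frag_extend_add frag_extend_minus frag_extend_diff
    mod_hom_add[OF assms(4)] mod_hom_smult[OF assms(4)] mod_hom_closed[OF assms(4)]
    tensor_relations_left[OF assms(2,3)] tensor_relations_right[OF assms(2,3)]
    tensor_relations_smult[OF assms(2,3)])

lemma frag_map_keys:
  assumes "f \<in> mod_hom R V W" "Poly_Mapping.keys a \<subseteq> carrier V \<times> Y"
  shows "Poly_Mapping.keys (frag_extend (\<lambda>(x, y). frag_of (f x, y)) a) \<subseteq> carrier W \<times> Y"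
proof
  fix z assume "z \<in> Poly_Mapping.keys (frag_extend (\<lambda>(x, y). frag_of (f x, y)) a)"
  then obtain x y where "(x, y) \<in> Poly_Mapping.keys a" "z = (f x, y)"
    using subsetD[OF keys_frag_extend] by fastforce
  then show "z \<in> carrier W \<times> Y" using assms(2) mod_hom_closed[OF assms(1)] by auto
qed

text \<open>\<open>tensor_map\<close> adds all relations to the image of a whole coset. As relations
  are sent to relations, the outcome is the coset of the image of any one representative.\<close>

lemma tensor_map_coset:
  assumes "module R V" "module R W" "module R N" "f \<in> mod_hom R V W"
    and "Poly_Mapping.keys a \<subseteq> carrier V \<times> carrier N"
  shows "tensor_map R W N f (tensor_relations R V N #>\<^bsub>free_Abelian_group (carrier V \<times> carrier N)\<^esub> a) =
    tensor_relations R W N #>\<^bsub>free_Abelian_group (carrier W \<times> carrier N)\<^esub>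
      frag_extend (\<lambda>(x, y). frag_of (f x, y)) a"
proof -
  let ?F = "frag_extend (\<lambda>(x, y). frag_of (f x, y))"
  have "?F (k' + a) = ?F k' + ?F a" for k' by (rule frag_extend_add)
  moreover have "?F k' \<in> tensor_relations R W N" if "k' \<in> tensor_relations R V N" for k'
    using frag_map_tensor_relations[OF assms(1-4) that] .
  ultimately have 1: "k + ?F (k' + a) \<in> (\<lambda>k. k + ?F a) ` tensor_relations R W N"
    if "k \<in> tensor_relations R W N" "k' \<in> tensor_relations R V N" for k k'
    using that tensor_relations_add[OF assms(2,3), of k "?F k'"]
    by (intro image_eqI[of _ _ "k + ?F k'"]) (simp_all add: add.assoc)
  have 2: "k + ?F a \<in> {k + ?F (k' + a) | k k'. k \<in> tensor_relations R W N \<and> k' \<in> tensor_relations R V N}"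
    if "k \<in> tensor_relations R W N" for k
    using that tensor_relations_zero[OF assms(1,3)] by (intro CollectI exI[of _ k] exI[of _ 0]) simp
  have "tensor_map R W N f (tensor_relations R V N #>\<^bsub>free_Abelian_group (carrier V \<times> carrier N)\<^esub> a) =
      {k + ?F (k' + a) | k k'. k \<in> tensor_relations R W N \<and> k' \<in> tensor_relations R V N}"
    unfolding tensor_map_def r_coset_def set_mult_def mult_free_Abelian_group by blast
  also have "\<dots> = (\<lambda>k. k + ?F a) ` tensor_relations R W N"
    using 1 2 by blast
  also have "\<dots> = tensor_relations R W N #>\<^bsub>free_Abelian_group (carrier W \<times> carrier N)\<^esub> ?F a"
    unfolding r_coset_def mult_free_Abelian_group by blast
  finally show ?thesis .
qed

text \<open>Vanishing homology on the level of representatives. The group is a quotient of a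
  quotient, so the elements of \<open>?B\<close> are themselves cosets, and the class of z has to be
  extracted in two stages.\<close>

lemma trivial_tensor_homology:
  assumes P: "resolution_of R M P" and N: "module R N"
    and trivial: "trivial_group (tensor_homology R P N (Suc i))"
    and z: "Poly_Mapping.keys z \<subseteq> carrier (obj P (Suc i)) \<times> carrier N"
    and cycle: "frag_extend (\<lambda>(x, y). frag_of (diff P (Suc i) x, y)) z \<in> tensor_relations R (obj P i) N"
  shows "\<exists>u. Poly_Mapping.keys u \<subseteq> carrier (obj P (Suc (Suc i))) \<times> carrier N \<and>
    z - frag_extend (\<lambda>(x, y). frag_of (diff P (Suc (Suc i)) x, y)) u \<in> tensor_relations R (obj P (Suc i)) N"
proof -
  have mods: "module R (obj P j)" and homs: "diff P (Suc j) \<in> mod_hom R (obj P (Suc j)) (obj P j)" for j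
    using P by (auto simp: resolution_of_def)
  let ?G = "\<lambda>j. free_Abelian_group (carrier (obj P j) \<times> carrier N)"
  let ?r = "\<lambda>j. tensor_relations R (obj P j) N"
  let ?T = "\<lambda>j. tensor_product R (obj P j) N"
  let ?d = "\<lambda>j. tensor_map R (obj P j) N (diff P (Suc j))"
  let ?Z = "kernel (?T (Suc i)) (?T i) (?d i)"
  let ?B = "?d (Suc i) ` carrier (?T (Suc (Suc i)))"
  note sub = tensor_relations_subgroup[OF mods N]
  have coset0: "?r j #>\<^bsub>?G j\<^esub> a = ?r j" if "a \<in> ?r j" for j a
    by (rule group.coset_join2[OF group_free_Abelian_group _ sub that])
       (use tensor_relations_keys[OF mods N that] in simp)
  let ?\<kappa> = "?r (Suc i) #>\<^bsub>?G (Suc i)\<^esub> z"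
  have "?d i ?\<kappa> = ?r i"
    by (subst tensor_map_coset[OF mods mods N homs z]) (rule coset0[OF cycle])
  then have \<kappa>: "?\<kappa> \<in> ?Z"
    using z by (auto simp: kernel_def tensor_product_def FactGroup_def RCOSETS_def)
  \<comment> \<open>The coset of the relations is the neutral element of the tensor product and is
    the image of the class of 0. Multiplying \<open>?\<kappa>\<close> by it exhibits
    \<open>?\<kappa>\<close> as a member of its own coset modulo \<open>?B\<close>, which is
    \<open>?B\<close> by triviality.\<close>
  have unit: "?r (Suc i) \<in> ?B"
  proof (rule image_eqI)
    show "?r (Suc i) = ?d (Suc i) (?r (Suc (Suc i)) #>\<^bsub>?G (Suc (Suc i))\<^esub> 0)"
      by (subst tensor_map_coset[OF mods mods N homs])
        (use coset0 tensor_relations_zero[OF mods N] in simp_all)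
  qed (auto simp: tensor_product_def FactGroup_def RCOSETS_def)
  let ?H = "tensor_homology R P N (Suc i)"
  have H: "?H = (?T (Suc i))\<lparr>carrier := ?Z\<rparr> Mod ?B"
    by (simp add: tensor_homology_def)
  have "?B #>\<^bsub>(?T (Suc i))\<lparr>carrier := ?Z\<rparr>\<^esub> ?\<kappa> \<in> carrier ?H"
    unfolding H using \<kappa> by (auto simp: FactGroup_def RCOSETS_def)
  then have "?B #>\<^bsub>(?T (Suc i))\<lparr>carrier := ?Z\<rparr>\<^esub> ?\<kappa> = ?B"
    using trivial unfolding H by (auto simp: trivial_group_def FactGroup_def)
  moreover have "?r (Suc i) \<otimes>\<^bsub>?T (Suc i)\<^esub> ?\<kappa> \<in> ?B #>\<^bsub>(?T (Suc i))\<lparr>carrier := ?Z\<rparr>\<^esub> ?\<kappa>"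
    unfolding r_coset_def[where H = ?B] by (rule UN_I[OF unit]) simp
  ultimately have "?r (Suc i) \<otimes>\<^bsub>?T (Suc i)\<^esub> ?\<kappa> \<in> ?B"
    by simp
  moreover have "?\<kappa> \<in> rcosets\<^bsub>?G (Suc i)\<^esub> ?r (Suc i)"
    using z by (auto simp: RCOSETS_def)
  from normal.rcosets_mult_eq[OF comm_group.subgroup_imp_normal[OF abelian_free_Abelian_group sub] this]
  have "?r (Suc i) \<otimes>\<^bsub>?T (Suc i)\<^esub> ?\<kappa> = ?\<kappa>"
    by (simp add: tensor_product_def FactGroup_def)
  ultimately obtain l where l: "l \<in> carrier (?T (Suc (Suc i)))" "?\<kappa> = ?d (Suc i) l" by auto
  then obtain u where u: "Poly_Mapping.keys u \<subseteq> carrier (obj P (Suc (Suc i))) \<times> carrier N"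
    "l = ?r (Suc (Suc i)) #>\<^bsub>?G (Suc (Suc i))\<^esub> u"
    by (auto simp: tensor_product_def FactGroup_def RCOSETS_def)
  have "z \<in> ?\<kappa>"
    using tensor_relations_zero[OF mods N] by (auto simp: r_coset_def intro!: bexI[of _ 0])
  then have "z \<in> ?r (Suc i) #>\<^bsub>?G (Suc i)\<^esub> frag_extend (\<lambda>(x, y). frag_of (diff P (Suc (Suc i)) x, y)) u"
    using l u tensor_map_coset[OF mods mods N homs u(1)] by simp
  then show ?thesis using u by (auto simp: r_coset_def)
qed

section \<open>The tensor product with N as a cokernel of matrices\<close>

context coordinate_resolution
begin

definition lift :: "'n \<Rightarrow> 'c \<Rightarrow> 'r" where
  "lift y = (SOME v. v \<in> C 0 \<rightarrow> carrier R \<and> y = lin_comb N (C 0) v e)"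

lemma lift:
  assumes "y \<in> carrier N"
  shows "lift y \<in> C 0 \<rightarrow> carrier R" "lin_comb N (C 0) (lift y) e = y"
proof -
  have "\<exists>v. v \<in> C 0 \<rightarrow> carrier R \<and> y = lin_comb N (C 0) v e"
    using generates[OF assms] by blast
  then have "lift y \<in> C 0 \<rightarrow> carrier R \<and> y = lin_comb N (C 0) (lift y) e"
    unfolding lift_def by (rule someI_ex)
  then show "lift y \<in> C 0 \<rightarrow> carrier R" "lin_comb N (C 0) (lift y) e = y" by auto
qed

lemma lift_closed: "y \<in> carrier N \<Longrightarrow> c \<in> C 0 \<Longrightarrow> lift y c \<in> carrier R"
  using lift by auto

abbreviation boundaries :: "('r, 'v) module \<Rightarrow> ('c \<Rightarrow> 'v) set" where
  "boundaries V \<equiv> delta V 0 ` carrier (power_module (C (Suc 0)) V)"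

lemma boundaries_add:
  assumes V: "module R V" and "f \<in> boundaries V" "g \<in> boundaries V"
  shows "f \<oplus>\<^bsub>power_module (C 0) V\<^esub> g \<in> boundaries V"
proof -
  interpret P: module R "power_module (C (Suc 0)) V" by (rule module_power_module[OF V])
  obtain f' g' where fg: "f' \<in> carrier (power_module (C (Suc 0)) V)" "f = delta V 0 f'"
    "g' \<in> carrier (power_module (C (Suc 0)) V)" "g = delta V 0 g'"
    using assms(2,3) by (elim imageE)
  have "f \<oplus>\<^bsub>power_module (C 0) V\<^esub> g = delta V 0 (f' \<oplus>\<^bsub>power_module (C (Suc 0)) V\<^esub> g')"
    unfolding fg(2,4) by (rule mod_hom_add[OF delta_mod_hom[OF V] fg(1,3), symmetric])
  then show ?thesis using fg(1,3) by (intro image_eqI[OF _ P.M.a_closed])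
qed

lemma boundaries_minus:
  assumes V: "module R V" and "f \<in> boundaries V" "g \<in> boundaries V"
  shows "f \<ominus>\<^bsub>power_module (C 0) V\<^esub> g \<in> boundaries V"
proof -
  interpret P: module R "power_module (C (Suc 0)) V" by (rule module_power_module[OF V])
  obtain f' g' where fg: "f' \<in> carrier (power_module (C (Suc 0)) V)" "f = delta V 0 f'"
    "g' \<in> carrier (power_module (C (Suc 0)) V)" "g = delta V 0 g'"
    using assms(2,3) by (elim imageE)
  have "f \<ominus>\<^bsub>power_module (C 0) V\<^esub> g = delta V 0 (f' \<ominus>\<^bsub>power_module (C (Suc 0)) V\<^esub> g')"
    unfolding fg(2,4)
    by (rule mod_hom_minus[OF module_power_module[OF V] module_power_module[OF V]
        delta_mod_hom[OF V] fg(1,3), symmetric])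
  then show ?thesis using fg(1,3) by (intro image_eqI[OF _ P.M.minus_closed])
qed

lemma boundaries_zero:
  assumes V: "module R V"
  shows "\<zero>\<^bsub>power_module (C 0) V\<^esub> \<in> boundaries V"
proof -
  interpret P: module R "power_module (C (Suc 0)) V" by (rule module_power_module[OF V])
  show ?thesis
    by (rule image_eqI[OF _ P.M.zero_closed])
      (rule mod_hom_zero[OF module_power_module[OF V] module_power_module[OF V] delta_mod_hom[OF V], symmetric])
qed

text \<open>Each \<open>v a\<close> is a relation among the generators \<open>e\<close>, hence an
  image under \<open>D 0\<close>. The preimages, combined with the coefficients \<open>w\<close>,
  form a preimage under \<open>delta V 0\<close>.\<close>

lemma relation_in_boundaries:
  assumes "module R V" "finite A" "w \<in> A \<rightarrow> carrier V" "\<And>a. a \<in> A \<Longrightarrow> v a \<in> C 0 \<rightarrow> carrier R"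
    and "\<And>a. a \<in> A \<Longrightarrow> lin_comb N (C 0) (v a) e = \<zero>\<^bsub>N\<^esub>"
  shows "(\<lambda>c'\<in>C 0. lin_comb V A (\<lambda>a. v a c') w) \<in> boundaries V"
proof -
  interpret V: module R V by fact
  have "\<exists>u\<in>C 1 \<rightarrow> carrier R. \<forall>c'\<in>C 0. v a c' = (\<Oplus>c\<in>C 1. D 0 c c' \<otimes> u c)" if "a \<in> A" for a
    using assms(4,5) that exact_0 by blast
  then obtain u where u: "\<And>a. a \<in> A \<Longrightarrow> u a \<in> C 1 \<rightarrow> carrier R"
    "\<And>a c'. a \<in> A \<Longrightarrow> c' \<in> C 0 \<Longrightarrow> v a c' = (\<Oplus>c\<in>C 1. D 0 c c' \<otimes> u a c)"
    by metis
  define h where "h = (\<lambda>c\<in>C (Suc 0). lin_comb V A (\<lambda>a. u a c) w)"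
  have h: "h \<in> carrier (power_module (C (Suc 0)) V)"
    using u assms by (auto simp: h_def power_module_simps intro!: V.lin_comb_closed)
  have "delta V 0 h = (\<lambda>c'\<in>C 0. lin_comb V A (\<lambda>a. v a c') w)"
    unfolding matrix_map_def
  proof (rule restrict_ext)
    fix c' assume c': "c' \<in> C 0"
    have "lin_comb V (C (Suc 0)) (\<lambda>c. D 0 c c') h =
        lin_comb V (C (Suc 0)) (\<lambda>c. D 0 c c') (\<lambda>c. lin_comb V A (\<lambda>a. u a c) w)"
      using u assms c' D_closed by (intro V.lin_comb_cong) (auto simp: h_def intro!: V.lin_comb_closed)
    also have "\<dots> = lin_comb V A (\<lambda>a. \<Oplus>c\<in>C (Suc 0). D 0 c c' \<otimes> u a c) w"
      using u assms c' D_closed finite_C by (intro V.lin_comb_lin_comb) auto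
    also have "\<dots> = lin_comb V A (\<lambda>a. v a c') w"
      using assms c' by (intro V.lin_comb_cong) (auto simp: u(2)[unfolded One_nat_def, symmetric] Pi_iff)
    finally show "lin_comb V (C (Suc 0)) (\<lambda>c. D 0 c c') h = lin_comb V A (\<lambda>a. v a c') w" .
  qed
  then show ?thesis using h by (intro image_eqI[OF _ h]) simp
qed

lemma relation_in_boundaries_single:
  assumes "module R V" "x \<in> carrier V" "v \<in> C 0 \<rightarrow> carrier R" "lin_comb N (C 0) v e = \<zero>\<^bsub>N\<^esub>"
  shows "(\<lambda>c\<in>C 0. v c \<odot>\<^bsub>V\<^esub> x) \<in> boundaries V"
proof -
  interpret V: module R V by fact
  have eq: "lin_comb V {()} (\<lambda>a. v c) (\<lambda>_. x) = v c \<odot>\<^bsub>V\<^esub> x" if "c \<in> C 0" for c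
    using that assms by (subst V.lin_comb_insert) (auto simp: Pi_iff)
  have "(\<lambda>c'\<in>C 0. lin_comb V {()} (\<lambda>a. v c') (\<lambda>_. x)) \<in> boundaries V"
    using assms by (intro relation_in_boundaries) auto
  also have "(\<lambda>c'\<in>C 0. lin_comb V {()} (\<lambda>a. v c') (\<lambda>_. x)) = (\<lambda>c\<in>C 0. v c \<odot>\<^bsub>V\<^esub> x)"
    by (rule restrict_ext) (rule eq)
  finally show ?thesis .
qed


text \<open>Tensoring \<open>V\<close> with \<open>N\<close> gives the cokernel of \<open>delta V 0\<close>. The map below sends \<open>x \<otimes> y\<close> to the
  vector \<open>lift y \<cdot> x\<close>, which depends on the choice of \<open>lift y\<close> only up to boundaries.\<close>

definition tensor_eval :: "('r, 'v) module \<Rightarrow> ('v \<times> 'n \<Rightarrow>\<^sub>0 int) \<Rightarrow> 'c \<Rightarrow> 'v" where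
  "tensor_eval V = (SOME \<Psi>.
     \<Psi> \<in> hom (free_Abelian_group (carrier V \<times> carrier N)) (add_monoid (power_module (C 0) V)) \<and>
     (\<forall>z\<in>carrier V \<times> carrier N. \<Psi> (frag_of z) = (\<lambda>c\<in>C 0. lift (snd z) c \<odot>\<^bsub>V\<^esub> fst z)))"

context
  fixes V :: "('r, 'v) module"
  assumes V: "module R V"
begin

interpretation V: module R V by (rule V)
interpretation P: module R "power_module (C 0) V" by (rule module_power_module[OF V])

lemma tensor_eval:
  "tensor_eval V \<in> hom (free_Abelian_group (carrier V \<times> carrier N)) (add_monoid (power_module (C 0) V)) \<and>
   (\<forall>z\<in>carrier V \<times> carrier N. tensor_eval V (frag_of z) = (\<lambda>c\<in>C 0. lift (snd z) c \<odot>\<^bsub>V\<^esub> fst z))"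
proof -
  have "(\<lambda>z. \<lambda>c\<in>C 0. lift (snd z) c \<odot>\<^bsub>V\<^esub> fst z) ` (carrier V \<times> carrier N)
      \<subseteq> carrier (add_monoid (power_module (C 0) V))"
    using lift_closed by (auto simp: power_module_simps)
  from comm_group.free_Abelian_group_universal[OF P.M.a_comm_group this]
  have "\<exists>\<Psi>. \<Psi> \<in> hom (free_Abelian_group (carrier V \<times> carrier N)) (add_monoid (power_module (C 0) V)) \<and>
     (\<forall>z\<in>carrier V \<times> carrier N. \<Psi> (frag_of z) = (\<lambda>c\<in>C 0. lift (snd z) c \<odot>\<^bsub>V\<^esub> fst z))"
    by metis
  then show ?thesis unfolding tensor_eval_def by (rule someI_ex)
qed

lemma tensor_eval_frag_of:
  "x \<in> carrier V \<Longrightarrow> y \<in> carrier N \<Longrightarrow> tensor_eval V (frag_of (x, y)) = (\<lambda>c\<in>C 0. lift y c \<odot>\<^bsub>V\<^esub> x)"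
  using tensor_eval by auto

lemma tensor_eval_closed:
  "Poly_Mapping.keys a \<subseteq> carrier V \<times> carrier N \<Longrightarrow> tensor_eval V a \<in> carrier (power_module (C 0) V)"
  using conjunct1[OF tensor_eval] by (auto simp: hom_def)

lemma tensor_eval_add:
  "Poly_Mapping.keys a \<subseteq> carrier V \<times> carrier N \<Longrightarrow> Poly_Mapping.keys b \<subseteq> carrier V \<times> carrier N \<Longrightarrow>
    tensor_eval V (a + b) = tensor_eval V a \<oplus>\<^bsub>power_module (C 0) V\<^esub> tensor_eval V b"
  using conjunct1[OF tensor_eval] by (auto simp: hom_def)

lemma tensor_eval_zero: "tensor_eval V 0 = \<zero>\<^bsub>power_module (C 0) V\<^esub>"
  using tensor_eval_add[of 0 0] tensor_eval_closed[of 0] by simp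

lemma tensor_eval_diff:
  assumes "Poly_Mapping.keys a \<subseteq> carrier V \<times> carrier N" "Poly_Mapping.keys b \<subseteq> carrier V \<times> carrier N"
  shows "tensor_eval V (a - b) = tensor_eval V a \<ominus>\<^bsub>power_module (C 0) V\<^esub> tensor_eval V b"
proof -
  have k: "Poly_Mapping.keys (a - b) \<subseteq> carrier V \<times> carrier N"
    by (rule order_trans[OF keys_diff Un_least[OF assms]])
  have "tensor_eval V a = tensor_eval V (a - b) \<oplus>\<^bsub>power_module (C 0) V\<^esub> tensor_eval V b"
    using tensor_eval_add[OF k assms(2)] by simp
  then show ?thesis
    using tensor_eval_closed[OF k] tensor_eval_closed[OF assms(2)]
    by (simp add: a_minus_def P.M.a_assoc P.M.r_neg)
qed

lemma tensor_eval_diff_apply: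
  "Poly_Mapping.keys a \<subseteq> carrier V \<times> carrier N \<Longrightarrow> Poly_Mapping.keys b \<subseteq> carrier V \<times> carrier N \<Longrightarrow>
    c \<in> C 0 \<Longrightarrow> tensor_eval V (a - b) c = tensor_eval V a c \<ominus>\<^bsub>V\<^esub> tensor_eval V b c"
  by (simp add: tensor_eval_diff power_module_minus[OF V] tensor_eval_closed)

lemma power_module_eqI:
  assumes "f \<in> carrier (power_module A V)" "g \<in> carrier (power_module A V)"
    "\<And>c. c \<in> A \<Longrightarrow> f c = g c"
  shows "f = g"
  using assms by (auto simp: power_module_simps intro: PiE_ext)

text \<open>Additivity in the V-argument holds exactly. In the N-argument, and for moving a scalar
  across, the two lifts of the same element of N differ by a relation among the generators, which
  contributes a boundary.\<close>

lemma tensor_eval_relations: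
  assumes "a \<in> tensor_relations R V N"
  shows "tensor_eval V a \<in> boundaries V"
  using V N.module_axioms assms
proof (rule tensor_relations_induct[where P = "\<lambda>a. tensor_eval V a \<in> boundaries V"])
  show "tensor_eval V 0 \<in> boundaries V"
    using boundaries_zero[OF V] by (simp add: tensor_eval_zero)
next
  fix a b assume ab: "a \<in> tensor_relations R V N" "b \<in> tensor_relations R V N"
    "tensor_eval V a \<in> boundaries V" "tensor_eval V b \<in> boundaries V"
  then show "tensor_eval V (a + b) \<in> boundaries V"
    using tensor_relations_keys[OF V N.module_axioms] boundaries_add[OF V] by (subst tensor_eval_add)
next
  fix a assume a: "a \<in> tensor_relations R V N" "tensor_eval V a \<in> boundaries V"
  then have "tensor_eval V (0 - a) \<in> boundaries V"
    using tensor_relations_keys[OF V N.module_axioms, of a] boundaries_minus[OF V boundaries_zero[OF V]]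
    by (subst tensor_eval_diff) (auto simp: tensor_eval_zero)
  then show "tensor_eval V (- a) \<in> boundaries V" by simp
next
  fix x x' y assume xy: "x \<in> carrier V" "x' \<in> carrier V" "y \<in> carrier N"
  have k: "Poly_Mapping.keys (frag_of (x \<oplus>\<^bsub>V\<^esub> x', y) - frag_of (x, y)) \<subseteq> carrier V \<times> carrier N"
    using xy by (intro order_trans[OF keys_diff] Un_least) auto
  have "tensor_eval V (frag_of (x \<oplus>\<^bsub>V\<^esub> x', y) - frag_of (x, y) - frag_of (x', y)) =
      \<zero>\<^bsub>power_module (C 0) V\<^esub>" (is "?l = _")
  proof (rule power_module_eqI)
    show "?l \<in> carrier (power_module (C 0) V)"
      using xy by (intro tensor_eval_closed order_trans[OF keys_diff] Un_least k) auto
    fix c assume c: "c \<in> C 0"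
    have l: "lift y c \<odot>\<^bsub>V\<^esub> x \<in> carrier V" "lift y c \<odot>\<^bsub>V\<^esub> x' \<in> carrier V" "lift y c \<in> carrier R"
      using xy c lift_closed by auto
    have "?l c = lift y c \<odot>\<^bsub>V\<^esub> (x \<oplus>\<^bsub>V\<^esub> x') \<ominus>\<^bsub>V\<^esub> lift y c \<odot>\<^bsub>V\<^esub> x \<ominus>\<^bsub>V\<^esub> lift y c \<odot>\<^bsub>V\<^esub> x'"
      using xy c k by (simp add: tensor_eval_diff_apply tensor_eval_frag_of)
    also have "\<dots> = \<zero>\<^bsub>V\<^esub>"
      using l xy by (simp add: V.smult_r_distr a_minus_def V.M.a_ac V.M.r_neg V.M.r_neg1 V.M.r_neg2)
    finally show "?l c = \<zero>\<^bsub>power_module (C 0) V\<^esub> c" using c by (simp add: power_module_simps)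
  qed auto
  then show "tensor_eval V (frag_of (x \<oplus>\<^bsub>V\<^esub> x', y) - frag_of (x, y) - frag_of (x', y)) \<in> boundaries V"
    using boundaries_zero[OF V] by simp
next
  fix x y y' assume xy: "x \<in> carrier V" "y \<in> carrier N" "y' \<in> carrier N"
  let ?v = "\<lambda>c. lift (y \<oplus>\<^bsub>N\<^esub> y') c \<ominus> lift y c \<ominus> lift y' c"
  have k: "Poly_Mapping.keys (frag_of (x, y \<oplus>\<^bsub>N\<^esub> y') - frag_of (x, y)) \<subseteq> carrier V \<times> carrier N"
    using xy by (intro order_trans[OF keys_diff] Un_least) auto
  have lc: "\<And>c. c \<in> C 0 \<Longrightarrow> lift y c \<in> carrier R" "\<And>c. c \<in> C 0 \<Longrightarrow> lift y' c \<in> carrier R"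
    "\<And>c. c \<in> C 0 \<Longrightarrow> lift (y \<oplus>\<^bsub>N\<^esub> y') c \<in> carrier R"
    using xy lift_closed by auto
  have "tensor_eval V (frag_of (x, y \<oplus>\<^bsub>N\<^esub> y') - frag_of (x, y) - frag_of (x, y')) =
      (\<lambda>c\<in>C 0. ?v c \<odot>\<^bsub>V\<^esub> x)" (is "?l = _")
  proof (rule power_module_eqI)
    show "?l \<in> carrier (power_module (C 0) V)"
      using xy by (intro tensor_eval_closed order_trans[OF keys_diff] Un_least k) auto
    fix c assume c: "c \<in> C 0"
    have "?l c = lift (y \<oplus>\<^bsub>N\<^esub> y') c \<odot>\<^bsub>V\<^esub> x \<ominus>\<^bsub>V\<^esub> lift y c \<odot>\<^bsub>V\<^esub> x \<ominus>\<^bsub>V\<^esub> lift y' c \<odot>\<^bsub>V\<^esub> x"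
      using xy c k by (simp add: tensor_eval_diff_apply tensor_eval_frag_of)
    also have "\<dots> = ?v c \<odot>\<^bsub>V\<^esub> x"
      using lc[OF c] xy by (simp add: V.smult_l_distr a_minus_def V.smult_l_minus)
    finally show "?l c = (\<lambda>c\<in>C 0. ?v c \<odot>\<^bsub>V\<^esub> x) c" using c by simp
  qed (use lc xy in \<open>auto simp: power_module_simps\<close>)
  moreover have "(\<lambda>c\<in>C 0. ?v c \<odot>\<^bsub>V\<^esub> x) \<in> boundaries V"
  proof (rule relation_in_boundaries_single[OF V xy(1)])
    have "lin_comb N (C 0) ?v e = (y \<oplus>\<^bsub>N\<^esub> y') \<ominus>\<^bsub>N\<^esub> y \<ominus>\<^bsub>N\<^esub> y'"
      using lc finite_C e_closed xy lift
      by (simp add: N.lin_comb_minus Pi_iff)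
    also have "\<dots> = \<zero>\<^bsub>N\<^esub>"
      using xy by (simp add: a_minus_def N.M.a_ac N.M.r_neg N.M.r_neg1 N.M.r_neg2)
    finally show "lin_comb N (C 0) ?v e = \<zero>\<^bsub>N\<^esub>" .
  qed (use lc in auto)
  ultimately show "tensor_eval V (frag_of (x, y \<oplus>\<^bsub>N\<^esub> y') - frag_of (x, y) - frag_of (x, y')) \<in> boundaries V"
    by simp
next
  fix r x y assume xy: "r \<in> carrier R" "x \<in> carrier V" "y \<in> carrier N"
  let ?v = "\<lambda>c. r \<otimes> lift y c \<ominus> lift (r \<odot>\<^bsub>N\<^esub> y) c"
  have lc: "\<And>c. c \<in> C 0 \<Longrightarrow> lift y c \<in> carrier R" "\<And>c. c \<in> C 0 \<Longrightarrow> lift (r \<odot>\<^bsub>N\<^esub> y) c \<in> carrier R"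
    using xy lift_closed by auto
  have "tensor_eval V (frag_of (r \<odot>\<^bsub>V\<^esub> x, y) - frag_of (x, r \<odot>\<^bsub>N\<^esub> y)) =
      (\<lambda>c\<in>C 0. ?v c \<odot>\<^bsub>V\<^esub> x)" (is "?l = _")
  proof (rule power_module_eqI)
    show "?l \<in> carrier (power_module (C 0) V)"
      using xy by (intro tensor_eval_closed order_trans[OF keys_diff] Un_least) auto
    fix c assume c: "c \<in> C 0"
    have "?l c = lift y c \<odot>\<^bsub>V\<^esub> (r \<odot>\<^bsub>V\<^esub> x) \<ominus>\<^bsub>V\<^esub> lift (r \<odot>\<^bsub>N\<^esub> y) c \<odot>\<^bsub>V\<^esub> x"
      using xy c by (simp add: tensor_eval_diff_apply tensor_eval_frag_of)
    also have "\<dots> = ?v c \<odot>\<^bsub>V\<^esub> x"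
      using lc[OF c] xy by (simp add: V.smult_l_distr a_minus_def V.smult_l_minus
        V.smult_assoc1[symmetric] N.R.m_comm)
    finally show "?l c = (\<lambda>c\<in>C 0. ?v c \<odot>\<^bsub>V\<^esub> x) c" using c by simp
  qed (use lc xy in \<open>auto simp: power_module_simps\<close>)
  moreover have "(\<lambda>c\<in>C 0. ?v c \<odot>\<^bsub>V\<^esub> x) \<in> boundaries V"
  proof (rule relation_in_boundaries_single[OF V xy(2)])
    have "lin_comb N (C 0) ?v e = r \<odot>\<^bsub>N\<^esub> y \<ominus>\<^bsub>N\<^esub> r \<odot>\<^bsub>N\<^esub> y"
      using lc finite_C e_closed xy lift
      by (simp add: N.lin_comb_minus N.lin_comb_smult Pi_iff)
    also have "\<dots> = \<zero>\<^bsub>N\<^esub>"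
      using xy by (simp add: a_minus_def N.M.r_neg)
    finally show "lin_comb N (C 0) ?v e = \<zero>\<^bsub>N\<^esub>" .
  qed (use lc xy in auto)
  ultimately show "tensor_eval V (frag_of (r \<odot>\<^bsub>V\<^esub> x, y) - frag_of (x, r \<odot>\<^bsub>N\<^esub> y)) \<in> boundaries V"
    by simp
qed

end

text \<open>\<open>lift\<close> is chosen once for N and does not depend on the coefficient module,
  so naturality holds exactly and not merely up to boundaries.\<close>

lemma tensor_eval_natural:
  assumes "module R V" "module R W" "f \<in> mod_hom R V W"
    and "Poly_Mapping.keys a \<subseteq> carrier V \<times> carrier N"
  shows "tensor_eval W (frag_extend (\<lambda>(x, y). frag_of (f x, y)) a) = power_map (C 0) f (tensor_eval V a)"
proof (rule free_Abelian_group_induct[OF assms(4), where P = "\<lambda>a.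
    tensor_eval W (frag_extend (\<lambda>(x, y). frag_of (f x, y)) a) = power_map (C 0) f (tensor_eval V a)"])
  show "tensor_eval W (frag_extend (\<lambda>(x, y). frag_of (f x, y)) 0) = power_map (C 0) f (tensor_eval V 0)"
    using mod_hom_zero[OF module_power_module[OF assms(1)] module_power_module[OF assms(2)]
        power_map_mod_hom[OF assms(3)], of "C 0"]
    by (simp add: tensor_eval_zero[OF assms(1)] tensor_eval_zero[OF assms(2)])
next
  fix a b
  assume ab: "Poly_Mapping.keys a \<subseteq> carrier V \<times> carrier N" "Poly_Mapping.keys b \<subseteq> carrier V \<times> carrier N"
    "tensor_eval W (frag_extend (\<lambda>(x, y). frag_of (f x, y)) a) = power_map (C 0) f (tensor_eval V a)"
    "tensor_eval W (frag_extend (\<lambda>(x, y). frag_of (f x, y)) b) = power_map (C 0) f (tensor_eval V b)"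
  then show "tensor_eval W (frag_extend (\<lambda>(x, y). frag_of (f x, y)) (a - b)) =
      power_map (C 0) f (tensor_eval V (a - b))"
    using mod_hom_minus[OF module_power_module[OF assms(1)] module_power_module[OF assms(2)]
        power_map_mod_hom[OF assms(3)] tensor_eval_closed[OF assms(1) ab(1)] tensor_eval_closed[OF assms(1) ab(2)]]
    by (simp add: tensor_eval_diff[OF assms(1)] tensor_eval_diff[OF assms(2)] frag_extend_diff
      frag_map_keys[OF assms(3)])
next
  fix z assume "z \<in> carrier V \<times> carrier N"
  then show "tensor_eval W (frag_extend (\<lambda>(x, y). frag_of (f x, y)) (frag_of z)) =
      power_map (C 0) f (tensor_eval V (frag_of z))"
    using assms lift_closed mod_hom_closed[OF assms(3)]
    by (auto simp: tensor_eval_frag_of power_map_def mod_hom_smult[OF assms(3)] intro!: restrict_ext)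
qed

lemma tensor_eval_sum:
  assumes V: "module R V" and A: "finite A" "g \<in> A \<rightarrow> carrier V" "h \<in> A \<rightarrow> carrier N" and c: "c \<in> C 0"
  shows "Poly_Mapping.keys (\<Sum>a\<in>A. frag_of (g a, h a)) \<subseteq> carrier V \<times> carrier N \<and>
    tensor_eval V (\<Sum>a\<in>A. frag_of (g a, h a)) c = lin_comb V A (\<lambda>a. lift (h a) c) g"
  using A
proof (induct A rule: finite_induct)
  case empty
  interpret V: module R V by fact
  show ?case using c by (simp add: tensor_eval_zero[OF V] power_module_simps)
next
  case (insert a A)
  interpret V: module R V by fact
  have k: "Poly_Mapping.keys (\<Sum>a\<in>A. frag_of (g a, h a)) \<subseteq> carrier V \<times> carrier N"
    "Poly_Mapping.keys (frag_of (g a, h a)) \<subseteq> carrier V \<times> carrier N"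
    using insert by auto
  have e: "tensor_eval V (frag_of (g a, h a)) c = lift (h a) c \<odot>\<^bsub>V\<^esub> g a"
    using insert c by (subst tensor_eval_frag_of[OF V]) auto
  have "lin_comb V (insert a A) (\<lambda>a. lift (h a) c) g =
      lift (h a) c \<odot>\<^bsub>V\<^esub> g a \<oplus>\<^bsub>V\<^esub> lin_comb V A (\<lambda>a. lift (h a) c) g"
    using insert c lift_closed by (subst V.lin_comb_insert) (auto simp: Pi_iff)
  then show ?case
    using insert k c e order_trans[OF keys_add Un_least[OF k(2,1)]]
    by (simp add: tensor_eval_add[OF V] power_module_simps)
qed

text \<open>The vector w stands for the tensor z, the sum of all w c tensor e c, and the hypothesis
  \<open>cycle\<close> makes z a cycle in P tensor N. Vanishing homology bounds z by some u;
  applying \<open>tensor_eval\<close> carries this back to vectors, at the price of boundaries,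
  which are collected in b.\<close>

lemma tensor_homology_boundary:
  assumes P: "resolution_of R M P" and trivial: "trivial_group (tensor_homology R P N (Suc i))"
    and w: "w \<in> carrier (power_module (C 0) (obj P (Suc i)))"
    and h: "h \<in> carrier (power_module (C (Suc 0)) (obj P i))"
    and cycle: "power_map (C 0) (diff P (Suc i)) w = delta (obj P i) 0 h"
  shows "\<exists>a\<in>carrier (power_module (C 0) (obj P (Suc (Suc i)))).
    \<exists>b\<in>carrier (power_module (C (Suc 0)) (obj P (Suc i))).
      w = power_map (C 0) (diff P (Suc (Suc i))) a \<oplus>\<^bsub>power_module (C 0) (obj P (Suc i))\<^esub>
        delta (obj P (Suc i)) 0 b"
proof -
  have mods: "module R (obj P j)" and homs: "diff P (Suc j) \<in> mod_hom R (obj P (Suc j)) (obj P j)" for j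
    using P by (auto simp: resolution_of_def)
  note N = N.module_axioms
  let ?V = "obj P (Suc i)" and ?W = "obj P i" and ?U = "obj P (Suc (Suc i))"
  interpret V: module R ?V by (rule mods)
  interpret PV: module R "power_module (C 0) ?V" by (rule module_power_module[OF mods])
  interpret W: module R ?W by (rule mods)
  have w': "w \<in> C 0 \<rightarrow> carrier ?V" and h': "h \<in> C (Suc 0) \<rightarrow> carrier ?W"
    using w h by (auto simp: power_module_simps)
  define z where "z = (\<Sum>c\<in>C 0. frag_of (w c, e c))"
  have z: "Poly_Mapping.keys z \<subseteq> carrier ?V \<times> carrier N"
    using w' e_closed unfolding z_def by (intro order_trans[OF keys_sum]) auto
  let ?F = "\<lambda>j. frag_extend (\<lambda>(x, y). frag_of (diff P (Suc j) x, y))"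
  have "?F i z = (\<Sum>c\<in>C 0. frag_of (diff P (Suc i) (w c), e c))"
    by (simp add: z_def frag_extend_sum finite_C)
  also have "\<dots> = (\<Sum>c\<in>C 0. frag_of (lin_comb ?W (C (Suc 0)) (\<lambda>c1. D 0 c1 c) h, e c))"
  proof (rule sum.cong)
    fix c assume c: "c \<in> C 0"
    show "frag_of (diff P (Suc i) (w c), e c) = frag_of (lin_comb ?W (C (Suc 0)) (\<lambda>c1. D 0 c1 c) h, e c)"
      using fun_cong[OF cycle, of c] c by (simp add: power_map_def matrix_map_def)
  qed simp
  finally have Fz: "?F i z = \<dots>" .
  \<comment> \<open>The matrix is moved across the tensor sign: D h tensor e becomes h tensor D e,
    and D e is zero in N by \<open>e_D\<close>. The facts 1, 2 and 3 are the stages of this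
    computation modulo relations.\<close>
  have 1: "?F i z - (\<Sum>c\<in>C 0. \<Sum>c1\<in>C (Suc 0). frag_of (h c1, D 0 c1 c \<odot>\<^bsub>N\<^esub> e c))
      \<in> tensor_relations R ?W N"
    unfolding Fz using D_closed h' e_closed finite_C
    by (intro tensor_relations_sum[OF mods N] tensor_relations_lin_comb_left[OF mods N]) auto
  have 2: "(\<Sum>c1\<in>C (Suc 0). frag_of (h c1, lin_comb N (C 0) (D 0 c1) e)) -
      (\<Sum>c1\<in>C (Suc 0). \<Sum>c\<in>C 0. frag_of (h c1, D 0 c1 c \<odot>\<^bsub>N\<^esub> e c)) \<in> tensor_relations R ?W N"
    using D_closed h' e_closed finite_C
    by (intro tensor_relations_sum[OF mods N] tensor_relations_lin_comb_right[OF mods N]) auto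
  have 3: "(\<Sum>c1\<in>C (Suc 0). frag_of (h c1, lin_comb N (C 0) (D 0 c1) e)) - (\<Sum>c1\<in>C (Suc 0). 0)
      \<in> tensor_relations R ?W N"
    using h' by (intro tensor_relations_sum[OF mods N])
      (auto simp: e_D intro!: tensor_relations_zero_right[OF mods N])
  have swap: "(\<Sum>c\<in>C 0. \<Sum>c1\<in>C (Suc 0). frag_of (h c1, D 0 c1 c \<odot>\<^bsub>N\<^esub> e c)) =
      (\<Sum>c1\<in>C (Suc 0). \<Sum>c\<in>C 0. frag_of (h c1, D 0 c1 c \<odot>\<^bsub>N\<^esub> e c))" by (rule sum.swap)
  have "?F i z \<in> tensor_relations R ?W N"
    using tensor_relations_add[OF mods N 1[unfolded swap] tensor_relations_diff[OF mods N 3 2]] by simp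
  from trivial_tensor_homology[OF P N trivial z this] obtain u where
    u: "Poly_Mapping.keys u \<subseteq> carrier ?U \<times> carrier N" "z - ?F (Suc i) u \<in> tensor_relations R ?V N" by blast
  let ?a = "tensor_eval ?U u"
  have Fu: "Poly_Mapping.keys (?F (Suc i) u) \<subseteq> carrier ?V \<times> carrier N"
    using frag_map_keys[OF homs u(1)] .
  let ?pa = "power_map (C 0) (diff P (Suc (Suc i))) ?a"
  have "tensor_eval ?V z \<ominus>\<^bsub>power_module (C 0) ?V\<^esub> ?pa \<in> boundaries ?V"
    using tensor_eval_relations[OF mods u(2)] z Fu
    by (simp add: tensor_eval_diff[OF mods] tensor_eval_natural[OF mods mods homs u(1)])
  moreover have "w \<ominus>\<^bsub>power_module (C 0) ?V\<^esub> tensor_eval ?V z \<in> boundaries ?V"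
  proof -
    \<comment> \<open>Evaluating z uses the vector \<open>lift (e c)\<close> where w uses the unit
      vector at c. Both represent e c, so their difference is a relation.\<close>
    let ?v = "\<lambda>c c'. (if c = c' then \<one> else \<zero>) \<ominus> lift (e c) c'"
    have "w \<ominus>\<^bsub>power_module (C 0) ?V\<^esub> tensor_eval ?V z = (\<lambda>c'\<in>C 0. lin_comb ?V (C 0) (\<lambda>c. ?v c c') w)"
    proof (rule power_module_eqI[OF mods])
      fix c' assume c': "c' \<in> C 0"
      have l: "\<And>c. c \<in> C 0 \<Longrightarrow> lift (e c) c' \<in> carrier R"
        using e_closed lift_closed c' by auto
      have "(w \<ominus>\<^bsub>power_module (C 0) ?V\<^esub> tensor_eval ?V z) c' = w c' \<ominus>\<^bsub>?V\<^esub> tensor_eval ?V z c'"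
        using w z c' tensor_eval_closed[OF mods] by (intro power_module_minus[OF mods]) auto
      also have "tensor_eval ?V z c' = lin_comb ?V (C 0) (\<lambda>c. lift (e c) c') w"
        using tensor_eval_sum[OF mods finite_C w' e_closed c'] by (simp add: z_def)
      also have "w c' = lin_comb ?V (C 0) (\<lambda>c. if c = c' then \<one> else \<zero>) w"
        using w' c' finite_C by (intro V.lin_comb_single[symmetric]) auto
      also have "lin_comb ?V (C 0) (\<lambda>c. if c = c' then \<one> else \<zero>) w \<ominus>\<^bsub>?V\<^esub>
          lin_comb ?V (C 0) (\<lambda>c. lift (e c) c') w = lin_comb ?V (C 0) (\<lambda>c. ?v c c') w"
        using w' l finite_C by (intro V.lin_comb_minus[symmetric]) auto
      finally show "(w \<ominus>\<^bsub>power_module (C 0) ?V\<^esub> tensor_eval ?V z) c' =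
          (\<lambda>c'\<in>C 0. lin_comb ?V (C 0) (\<lambda>c. ?v c c') w) c'" using c' by simp
    next
      show "(\<lambda>c'\<in>C 0. lin_comb ?V (C 0) (\<lambda>c. ?v c c') w) \<in> carrier (power_module (C 0) ?V)"
        using w' e_closed lift_closed by (auto simp: power_module_simps Pi_iff intro!: V.lin_comb_closed)
    qed (use w z tensor_eval_closed[OF mods] in auto)
    also have "\<dots> \<in> boundaries ?V"
    proof (rule relation_in_boundaries[OF mods finite_C w'])
      fix c assume c: "c \<in> C 0"
      have ec: "e c \<in> carrier N" using c e_closed by auto
      show "?v c \<in> C 0 \<rightarrow> carrier R" using lift_closed[OF ec] by auto
      have "lin_comb N (C 0) (?v c) e = lin_comb N (C 0) (\<lambda>c'. if c' = c then \<one> else \<zero>) e \<ominus>\<^bsub>N\<^esub>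
          lin_comb N (C 0) (lift (e c)) e"
        using e_closed lift(1)[OF ec] finite_C
        by (subst N.lin_comb_minus[symmetric]) (auto intro!: N.lin_comb_cong simp: Pi_iff)
      also have "\<dots> = \<zero>\<^bsub>N\<^esub>"
        using c ec e_closed finite_C lift(2)[OF ec] by (simp add: N.lin_comb_single a_minus_def N.M.r_neg)
      finally show "lin_comb N (C 0) (?v c) e = \<zero>\<^bsub>N\<^esub>" .
    qed
    finally show ?thesis .
  qed
  moreover have a: "?a \<in> carrier (power_module (C 0) ?U)"
    using tensor_eval_closed[OF mods u(1)] .
  moreover have cl: "?pa \<in> carrier (power_module (C 0) ?V)" "tensor_eval ?V z \<in> carrier (power_module (C 0) ?V)"
    using tensor_eval_closed[OF mods z] mod_hom_closed[OF power_map_mod_hom[OF homs] a] by auto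
  ultimately have "(w \<ominus>\<^bsub>power_module (C 0) ?V\<^esub> tensor_eval ?V z) \<oplus>\<^bsub>power_module (C 0) ?V\<^esub>
      (tensor_eval ?V z \<ominus>\<^bsub>power_module (C 0) ?V\<^esub> ?pa) \<in> boundaries ?V"
    by (intro boundaries_add[OF mods])
  also have "(w \<ominus>\<^bsub>power_module (C 0) ?V\<^esub> tensor_eval ?V z) \<oplus>\<^bsub>power_module (C 0) ?V\<^esub>
      (tensor_eval ?V z \<ominus>\<^bsub>power_module (C 0) ?V\<^esub> ?pa) = w \<ominus>\<^bsub>power_module (C 0) ?V\<^esub> ?pa"
    using cl w by (simp add: a_minus_def PV.M.a_assoc PV.M.r_neg1)
  finally obtain b where b: "b \<in> carrier (power_module (C (Suc 0)) ?V)"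
    "w \<ominus>\<^bsub>power_module (C 0) ?V\<^esub> ?pa = delta ?V 0 b" by auto
  have "w = ?pa \<oplus>\<^bsub>power_module (C 0) ?V\<^esub> (w \<ominus>\<^bsub>power_module (C 0) ?V\<^esub> ?pa)"
    using cl w by (simp add: a_minus_def PV.M.a_ac PV.M.r_neg2 PV.M.r_neg)
  then show ?thesis using a b by auto
qed

end

section \<open>Vanishing of Tor and the double complex of two resolutions\<close>

locale free_resolution =
  fixes R :: "('r, 'x) ring_scheme" and M :: "('r, 'm) module" and P :: "('r, 'f, 'm) resolution"
    and B :: "nat \<Rightarrow> 'f set"
  assumes M: "module R M" and resolution: "resolution_of R M P"
    and basis: "finite_basis R (obj P i) (B i)"
begin

lemma obj: "module R (obj P i)"
  and diff: "diff P (Suc i) \<in> mod_hom R (obj P (Suc i)) (obj P i)"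
  and aug: "aug P \<in> mod_hom R (obj P 0) M"
  and aug_surj: "aug P ` carrier (obj P 0) = carrier M"
  and aug_exact: "diff P 1 ` carrier (obj P 1) = a_kernel (obj P 0) M (aug P)"
  and diff_exact: "diff P (Suc (Suc i)) ` carrier (obj P (Suc (Suc i))) =
        a_kernel (obj P (Suc i)) (obj P i) (diff P (Suc i))"
  using resolution by (auto simp: resolution_of_def)

sublocale F: finite_basis R "obj P i" "B i" for i by (rule basis)

lemma diff_diff: "x \<in> carrier (obj P (Suc (Suc i))) \<Longrightarrow> diff P (Suc i) (diff P (Suc (Suc i)) x) = \<zero>\<^bsub>obj P i\<^esub>"
  using diff_exact[of i] by (auto simp: a_kernel_def')

lemma aug_diff: "x \<in> carrier (obj P (Suc 0)) \<Longrightarrow> aug P (diff P (Suc 0) x) = \<zero>\<^bsub>M\<^esub>"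
  using aug_exact by (auto simp: a_kernel_def')

lemma diff_lift:
  assumes "x \<in> carrier (obj P (Suc i))" "diff P (Suc i) x = \<zero>\<^bsub>obj P i\<^esub>"
  shows "\<exists>y\<in>carrier (obj P (Suc (Suc i))). diff P (Suc (Suc i)) y = x"
proof -
  have "x \<in> diff P (Suc (Suc i)) ` carrier (obj P (Suc (Suc i)))"
    unfolding diff_exact using assms by (simp add: a_kernel_def')
  then show ?thesis by blast
qed

lemma aug_lift:
  assumes "x \<in> carrier (obj P 0)" "aug P x = \<zero>\<^bsub>M\<^esub>"
  shows "\<exists>y\<in>carrier (obj P (Suc 0)). diff P (Suc 0) y = x"
proof -
  have "x \<in> diff P 1 ` carrier (obj P 1)"
    unfolding aug_exact using assms by (simp add: a_kernel_def')
  then show ?thesis by auto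
qed

definition diff_matrix :: "nat \<Rightarrow> 'f \<Rightarrow> 'f \<Rightarrow> 'r" where
  "diff_matrix j c c' = F.coords j (diff P (Suc j) c) c'"

lemma diff_lin_comb:
  assumes "v \<in> B (Suc j) \<rightarrow> carrier R" "c' \<in> B j"
  shows "F.coords j (diff P (Suc j) (lin_comb (obj P (Suc j)) (B (Suc j)) v (\<lambda>b. b))) c' =
    (\<Oplus>\<^bsub>R\<^esub>c\<in>B (Suc j). diff_matrix j c c' \<otimes>\<^bsub>R\<^esub> v c)"
proof -
  have d: "diff P (Suc j) c \<in> carrier (obj P j)" if "c \<in> B (Suc j)" for c
    using that mod_hom_closed[OF diff] F.basis_closed by blast
  have "diff P (Suc j) (lin_comb (obj P (Suc j)) (B (Suc j)) v (\<lambda>b. b)) =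
      lin_comb (obj P j) (B (Suc j)) v (\<lambda>b. diff P (Suc j) b)"
    using assms F.basis_closed F.finite_basis by (intro mod_hom_lin_comb[OF obj obj diff]) auto
  then have "F.coords j (diff P (Suc j) (lin_comb (obj P (Suc j)) (B (Suc j)) v (\<lambda>b. b))) c' =
      (\<Oplus>\<^bsub>R\<^esub>c\<in>B (Suc j). v c \<otimes>\<^bsub>R\<^esub> F.coords j (diff P (Suc j) c) c')"
    using assms d F.finite_basis by (simp add: F.coords_lin_comb Pi_iff)
  also have "\<dots> = (\<Oplus>\<^bsub>R\<^esub>c\<in>B (Suc j). diff_matrix j c c' \<otimes>\<^bsub>R\<^esub> v c)"
    using assms d unfolding diff_matrix_def
    by (intro F.R.finsum_cong') (auto simp: Pi_iff F.coords_closed F.R.m_comm)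
  finally show ?thesis .
qed

lemma diff_lin_comb_eq_iff:
  assumes "v \<in> B (Suc j) \<rightarrow> carrier R" "x \<in> carrier (obj P j)"
  shows "diff P (Suc j) (lin_comb (obj P (Suc j)) (B (Suc j)) v (\<lambda>b. b)) = x \<longleftrightarrow>
    (\<forall>c'\<in>B j. F.coords j x c' = (\<Oplus>\<^bsub>R\<^esub>c\<in>B (Suc j). diff_matrix j c c' \<otimes>\<^bsub>R\<^esub> v c))"
proof -
  have "lin_comb (obj P (Suc j)) (B (Suc j)) v (\<lambda>b. b) \<in> carrier (obj P (Suc j))"
    using assms F.basis_closed by (intro F.lin_comb_closed) auto
  then have "diff P (Suc j) (lin_comb (obj P (Suc j)) (B (Suc j)) v (\<lambda>b. b)) \<in> carrier (obj P j)"
    by (rule mod_hom_closed[OF diff])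
  from F.coords_eqI[OF this assms(2)] show ?thesis
    by (auto simp: diff_lin_comb[OF assms(1)])
qed

lemma in_diff_image_iff:
  assumes "v \<in> B j \<rightarrow> carrier R"
  shows "lin_comb (obj P j) (B j) v (\<lambda>b. b) \<in> diff P (Suc j) ` carrier (obj P (Suc j)) \<longleftrightarrow>
    (\<exists>w\<in>B (Suc j) \<rightarrow> carrier R. \<forall>c'\<in>B j. v c' = (\<Oplus>\<^bsub>R\<^esub>c\<in>B (Suc j). diff_matrix j c c' \<otimes>\<^bsub>R\<^esub> w c))"
    (is "?x \<in> _ \<longleftrightarrow> ?r")
proof -
  have x: "?x \<in> carrier (obj P j)"
    using assms F.basis_closed by (intro F.lin_comb_closed) auto
  have c: "F.coords j ?x c' = v c'" if "c' \<in> B j" for c'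
    using F.coords_unique[OF assms that] .
  have "?r \<longleftrightarrow> (\<exists>w\<in>B (Suc j) \<rightarrow> carrier R. diff P (Suc j) (lin_comb (obj P (Suc j)) (B (Suc j)) w (\<lambda>b. b)) = ?x)"
    using diff_lin_comb_eq_iff[OF _ x] c by simp
  also have "\<dots> \<longleftrightarrow> ?x \<in> diff P (Suc j) ` carrier (obj P (Suc j))"
  proof
    assume "\<exists>w\<in>B (Suc j) \<rightarrow> carrier R. diff P (Suc j) (lin_comb (obj P (Suc j)) (B (Suc j)) w (\<lambda>b. b)) = ?x"
    then obtain w where w: "w \<in> B (Suc j) \<rightarrow> carrier R"
      "?x = diff P (Suc j) (lin_comb (obj P (Suc j)) (B (Suc j)) w (\<lambda>b. b))" by auto
    have "lin_comb (obj P (Suc j)) (B (Suc j)) w (\<lambda>b. b) \<in> carrier (obj P (Suc j))"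
      using w F.basis_closed by (intro F.lin_comb_closed) auto
    then show "?x \<in> diff P (Suc j) ` carrier (obj P (Suc j))" using w(2) by (rule rev_image_eqI)
  next
    assume "?x \<in> diff P (Suc j) ` carrier (obj P (Suc j))"
    then obtain y where y: "y \<in> carrier (obj P (Suc j))" "?x = diff P (Suc j) y" by auto
    then show "\<exists>w\<in>B (Suc j) \<rightarrow> carrier R. diff P (Suc j) (lin_comb (obj P (Suc j)) (B (Suc j)) w (\<lambda>b. b)) = ?x"
      using F.coords_closed by (intro bexI[of _ "F.coords (Suc j) y"]) (auto simp: F.lin_comb_coords)
  qed
  finally show ?thesis by simp
qed

text \<open>Reading exactness through coordinates makes \<open>delta\<close> and
  \<open>tensor_eval\<close> available for every free resolution with chosen finite bases; the
  augmentation of the basis in degree 0 supplies the generators.\<close>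

sublocale coordinate_resolution R M B diff_matrix "aug P"
proof -
  interpret M: module R M by (rule M)
  show "coordinate_resolution R M B diff_matrix (aug P)"
  proof (unfold_locales)
    show "finite (B j)" for j by (rule F.finite_basis)
    show "diff_matrix j c c' \<in> carrier R" if "c \<in> B (Suc j)" "c' \<in> B j" for j c c'
      unfolding diff_matrix_def using that F.basis_closed
      by (intro F.coords_closed mod_hom_closed[OF diff]) auto
    show "aug P \<in> B 0 \<rightarrow> carrier M"
      using F.basis_closed mod_hom_closed[OF aug] by auto
    show "\<exists>v\<in>B 0 \<rightarrow> carrier R. y = lin_comb M (B 0) v (aug P)" if y: "y \<in> carrier M" for y
    proof -
      obtain x where x: "x \<in> carrier (obj P 0)" "y = aug P x" using y unfolding aug_surj[symmetric] by blast
      then have "y = aug P (lin_comb (obj P 0) (B 0) (F.coords 0 x) (\<lambda>b. b))"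
        by (simp add: F.lin_comb_coords)
      also have "\<dots> = lin_comb M (B 0) (F.coords 0 x) (aug P)"
        using x F.coords_closed F.basis_closed F.finite_basis
        by (intro mod_hom_lin_comb[OF obj M aug]) auto
      finally show ?thesis using x F.coords_closed by (intro bexI[of _ "F.coords 0 x"]) auto
    qed
    show "lin_comb M (B 0) v (aug P) = \<zero>\<^bsub>M\<^esub> \<longleftrightarrow>
      (\<exists>w\<in>B 1 \<rightarrow> carrier R. \<forall>c'\<in>B 0. v c' = (\<Oplus>\<^bsub>R\<^esub>c\<in>B 1. diff_matrix 0 c c' \<otimes>\<^bsub>R\<^esub> w c))"
      if v: "v \<in> B 0 \<rightarrow> carrier R" for v
    proof -
      have "lin_comb (obj P 0) (B 0) v (\<lambda>b. b) \<in> carrier (obj P 0)"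
        using v F.basis_closed by (intro F.lin_comb_closed) auto
      moreover have "aug P (lin_comb (obj P 0) (B 0) v (\<lambda>b. b)) = lin_comb M (B 0) v (aug P)"
        using v F.basis_closed F.finite_basis
        by (intro mod_hom_lin_comb[OF obj M aug]) auto
      ultimately have "lin_comb M (B 0) v (aug P) = \<zero>\<^bsub>M\<^esub> \<longleftrightarrow>
          lin_comb (obj P 0) (B 0) v (\<lambda>b. b) \<in> diff P 1 ` carrier (obj P 1)"
        unfolding aug_exact by (simp add: a_kernel_def')
      then show ?thesis using in_diff_image_iff[OF v] by simp
    qed
    show "(\<forall>c'\<in>B j. (\<Oplus>\<^bsub>R\<^esub>c\<in>B (Suc j). diff_matrix j c c' \<otimes>\<^bsub>R\<^esub> v c) = \<zero>\<^bsub>R\<^esub>) \<longleftrightarrow>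
      (\<exists>w\<in>B (Suc (Suc j)) \<rightarrow> carrier R.
        \<forall>c'\<in>B (Suc j). v c' = (\<Oplus>\<^bsub>R\<^esub>c\<in>B (Suc (Suc j)). diff_matrix (Suc j) c c' \<otimes>\<^bsub>R\<^esub> w c))"
      if v: "v \<in> B (Suc j) \<rightarrow> carrier R" for v j
    proof -
      have "lin_comb (obj P (Suc j)) (B (Suc j)) v (\<lambda>b. b) \<in> carrier (obj P (Suc j))"
        using v F.basis_closed by (intro F.lin_comb_closed) auto
      moreover have "diff P (Suc j) (lin_comb (obj P (Suc j)) (B (Suc j)) v (\<lambda>b. b)) = \<zero>\<^bsub>obj P j\<^esub> \<longleftrightarrow>
          (\<forall>c'\<in>B j. (\<Oplus>\<^bsub>R\<^esub>c\<in>B (Suc j). diff_matrix j c c' \<otimes>\<^bsub>R\<^esub> v c) = \<zero>\<^bsub>R\<^esub>)"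
        unfolding diff_lin_comb_eq_iff[OF v F.M.zero_closed]
        by (intro ball_cong refl) (simp add: F.coords_zero eq_commute)
      ultimately have "(\<forall>c'\<in>B j. (\<Oplus>\<^bsub>R\<^esub>c\<in>B (Suc j). diff_matrix j c c' \<otimes>\<^bsub>R\<^esub> v c) = \<zero>\<^bsub>R\<^esub>) \<longleftrightarrow>
          lin_comb (obj P (Suc j)) (B (Suc j)) v (\<lambda>b. b) \<in> diff P (Suc (Suc j)) ` carrier (obj P (Suc (Suc j)))"
        unfolding diff_exact by (simp add: a_kernel_def')
      then show ?thesis using in_diff_image_iff[OF v] by simp
    qed
  qed
qed

end

lemma power_map_lift:
  assumes "f \<in> carrier (power_module A V)" "\<And>c. c \<in> A \<Longrightarrow> \<exists>y\<in>carrier W. h y = f c"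
  shows "\<exists>g\<in>carrier (power_module A W). power_map A h g = f"
proof -
  obtain g where "\<And>c. c \<in> A \<Longrightarrow> g c \<in> carrier W \<and> h (g c) = f c" using assms(2) by metis
  then show ?thesis using assms(1)
    by (intro bexI[of _ "restrict g A"]) (auto simp: power_module_simps power_map_def PiE_iff extensional_def)
qed

locale resolution_pair = F: free_resolution R M P B + L: free_resolution R N Q C
  for R :: "('r, 'x) ring_scheme" and M :: "('r, 'm) module" and P :: "('r, 'f, 'm) resolution" and B
    and N :: "('r, 'n) module" and Q :: "('r, 'g, 'n) resolution" and C
begin

text \<open>P_i tensor Q_j, as vectors over the basis of Q_j with entries in P_i. The augmentation
  of \<open>P\<close> therefore ends in powers of M, whereas P tensor N is reached as the cokernel
  of \<open>delta\<close> at j = 0.\<close>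

abbreviation "E \<equiv> \<lambda>i j. power_module (C j) (obj P i)"

sublocale double_complex R E "\<lambda>i j. power_map (C j) (diff P (Suc i))" "\<lambda>i j. L.delta (obj P i) j"
proof (rule double_complex.intro)
  show "module R (E i j)" for i j by (rule module_power_module[OF F.obj])
  show "power_map (C j) (diff P (Suc i)) \<in> mod_hom R (E (Suc i) j) (E i j)" for i j
    by (rule power_map_mod_hom[OF F.diff])
  show "L.delta (obj P i) j \<in> mod_hom R (E i (Suc j)) (E i j)" for i j
    by (rule L.delta_mod_hom[OF F.obj])
  show "power_map (C j) (diff P (Suc i)) (L.delta (obj P (Suc i)) j w) =
      L.delta (obj P i) j (power_map (C (Suc j)) (diff P (Suc i)) w)"
    if "w \<in> carrier (E (Suc i) (Suc j))" for w i j
    using that by (rule L.power_map_delta[OF F.obj F.obj F.diff])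
  show "power_map (C j) (diff P (Suc i)) (power_map (C j) (diff P (Suc (Suc i))) w) = \<zero>\<^bsub>E i j\<^esub>"
    if "w \<in> carrier (E (Suc (Suc i)) j)" for w i j
    using that by (auto simp: power_map_def power_module_simps F.diff_diff PiE_iff intro!: restrict_ext)
  show "L.delta (obj P i) j (L.delta (obj P i) (Suc j) w) = \<zero>\<^bsub>E i j\<^esub>"
    if "w \<in> carrier (E i (Suc (Suc j)))" for w i j
    using that by (rule L.delta_delta[OF F.obj])
  show "\<exists>v\<in>carrier (E (Suc (Suc i)) j). power_map (C j) (diff P (Suc (Suc i))) v = w"
    if w: "w \<in> carrier (E (Suc i) j)" "power_map (C j) (diff P (Suc i)) w = \<zero>\<^bsub>E i j\<^esub>" for w i j
  proof (rule power_map_lift[OF w(1)])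
    fix c assume c: "c \<in> C j"
    then have "diff P (Suc i) (w c) = \<zero>\<^bsub>obj P i\<^esub>"
      using fun_cong[OF w(2), of c] by (simp add: power_map_def power_module_simps)
    then show "\<exists>y\<in>carrier (obj P (Suc (Suc i))). diff P (Suc (Suc i)) y = w c"
      using w(1) c by (intro F.diff_lift) (auto simp: power_module_simps)
  qed
  show "\<exists>v\<in>carrier (E i (Suc (Suc j))). L.delta (obj P i) (Suc j) v = w"
    if "w \<in> carrier (E i (Suc j))" "L.delta (obj P i) j w = \<zero>\<^bsub>E i j\<^esub>" for w i j
    using that by (rule L.delta_exact[OF F.basis])
qed

lemma aug_exact_power:
  assumes w: "w \<in> carrier (E 0 j)" "power_map (C j) (aug P) w = \<zero>\<^bsub>power_module (C j) M\<^esub>"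
  shows "\<exists>v\<in>carrier (E (Suc 0) j). power_map (C j) (diff P (Suc 0)) v = w"
proof (rule power_map_lift[OF w(1)])
  fix c assume c: "c \<in> C j"
  then have "aug P (w c) = \<zero>\<^bsub>M\<^esub>"
    using fun_cong[OF w(2), of c] by (simp add: power_map_def power_module_simps)
  then show "\<exists>y\<in>carrier (obj P (Suc 0)). diff P (Suc 0) y = w c"
    using w(1) c by (intro F.aug_lift) (auto simp: power_module_simps)
qed

lemma aug_surj_power:
  assumes z: "z \<in> carrier (power_module (C j) M)"
  shows "\<exists>w\<in>carrier (E 0 j). power_map (C j) (aug P) w = z"
proof (rule power_map_lift[OF z])
  fix c assume "c \<in> C j"
  then have "z c \<in> carrier M" using z by (auto simp: power_module_simps)
  then show "\<exists>y\<in>carrier (obj P 0). aug P y = z c" using F.aug_surj by (metis imageE)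
qed

lemma aug_diff_power:
  "w \<in> carrier (E (Suc 0) j) \<Longrightarrow>
    power_map (C j) (aug P) (power_map (C j) (diff P (Suc 0)) w) = \<zero>\<^bsub>power_module (C j) M\<^esub>"
  by (auto simp: power_map_def power_module_simps F.aug_diff PiE_iff intro!: restrict_ext)

lemma aug_delta:
  "w \<in> carrier (E 0 (Suc j)) \<Longrightarrow>
    power_map (C j) (aug P) (L.delta (obj P 0) j w) = L.delta M j (power_map (C (Suc j)) (aug P) w)"
  by (rule L.power_map_delta[OF F.obj F.M F.aug])

text \<open>Balancing Tor makes the result independent of the resolution \<open>P\<close>, which need not be minimal.\<close>

lemma trivial_Tor_delta_exact:
  assumes trivial: "trivial_group (tensor_homology R P N (Suc n))"
    and z: "z \<in> carrier (power_module (C (Suc n)) M)" "L.delta M n z = \<zero>\<^bsub>power_module (C n) M\<^esub>"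
  shows "\<exists>y\<in>carrier (power_module (C (Suc (Suc n))) M). L.delta M (Suc n) y = z"
proof -
  interpret T: double_complex R "\<lambda>i j. E j i" "\<lambda>i j. L.delta (obj P j) i" "\<lambda>i j. power_map (C i) (diff P (Suc j))"
    by (rule transpose)
  note cl_p = mod_hom_closed[OF power_map_mod_hom[OF F.diff]]
    and cl_q = mod_hom_closed[OF L.delta_mod_hom[OF F.obj]]
  interpret E0: module R "E 0 n" by (rule E)
  interpret E0': module R "E 0 (Suc n)" by (rule E)
  obtain w where w: "w \<in> carrier (E 0 (Suc n))" "power_map (C (Suc n)) (aug P) w = z"
    using aug_surj_power[OF z(1)] by blast
  have "power_map (C n) (aug P) (L.delta (obj P 0) n w) = \<zero>\<^bsub>power_module (C n) M\<^esub>"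
    using w z by (simp add: aug_delta)
  then obtain w' where w': "w' \<in> carrier (E (Suc 0) n)"
    "power_map (C n) (diff P (Suc 0)) w' = L.delta (obj P 0) n w"
    using aug_exact_power[OF cl_q[OF w(1)]] by blast
  have "\<exists>a\<in>carrier (E (Suc 0) (Suc n)). \<exists>b\<in>carrier (E (Suc (Suc 0)) n).
      w' = L.delta (obj P (Suc 0)) n a \<oplus>\<^bsub>E (Suc 0) n\<^esub> power_map (C n) (diff P (Suc (Suc 0))) b"
  \<comment> \<open>In the transposed complex the zigzag starts at \<open>E (Suc 0) n\<close> and
    ends at the edge \<open>E (Suc n) 0\<close>, where vanishing of the homology of P tensor N is
    the base case.\<close>
  proof (rule T.chase[of n n 0, OF _ _ w'(1) w(1) w'(2)])
    fix u v assume "u \<in> carrier (E (Suc n) 0)" "v \<in> carrier (E n (Suc 0))"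
      "power_map (C 0) (diff P (Suc n)) u = L.delta (obj P n) 0 v"
    then obtain a b where ab: "a \<in> carrier (E (Suc (Suc n)) 0)" "b \<in> carrier (E (Suc n) (Suc 0))"
      "u = power_map (C 0) (diff P (Suc (Suc n))) a \<oplus>\<^bsub>E (Suc n) 0\<^esub> L.delta (obj P (Suc n)) 0 b"
      using L.tensor_homology_boundary[OF F.resolution trivial] by blast
    interpret E1: module R "E (Suc n) 0" by (rule E)
    have "u = L.delta (obj P (Suc n)) 0 b \<oplus>\<^bsub>E (Suc n) 0\<^esub> power_map (C 0) (diff P (Suc (Suc n))) a"
      unfolding ab(3) by (rule E1.M.a_comm[OF cl_p[OF ab(1)] cl_q[OF ab(2)]])
    then show "\<exists>a\<in>carrier (E (Suc n) (Suc 0)). \<exists>b\<in>carrier (E (Suc (Suc n)) 0).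
       u = L.delta (obj P (Suc n)) 0 a \<oplus>\<^bsub>E (Suc n) 0\<^esub> power_map (C 0) (diff P (Suc (Suc n))) b"
      using ab(1,2) by blast
  qed simp
  then obtain a b where ab: "a \<in> carrier (E (Suc 0) (Suc n))" "b \<in> carrier (E (Suc (Suc 0)) n)"
    "w' = L.delta (obj P (Suc 0)) n a \<oplus>\<^bsub>E (Suc 0) n\<^esub> power_map (C n) (diff P (Suc (Suc 0))) b" by blast
  let ?pa = "power_map (C (Suc n)) (diff P (Suc 0)) a"
  have "L.delta (obj P 0) n w = power_map (C n) (diff P (Suc 0)) (L.delta (obj P (Suc 0)) n a) \<oplus>\<^bsub>E 0 n\<^esub>
      power_map (C n) (diff P (Suc 0)) (power_map (C n) (diff P (Suc (Suc 0))) b)"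
    unfolding w'(2)[symmetric] ab(3) by (rule mod_hom_add[OF p cl_q[OF ab(1)] cl_p[OF ab(2)]])
  also have "\<dots> = L.delta (obj P 0) n ?pa"
    using p_q[OF ab(1)] p_p[OF ab(2)] cl_q[OF cl_p[OF ab(1)]] by simp
  finally have eq: "L.delta (obj P 0) n w = L.delta (obj P 0) n ?pa" .
  \<comment> \<open>Replacing w by its difference with \<open>?pa\<close> keeps the augmentation z
    and turns w into a genuine cycle for \<open>delta\<close>, which has a preimage because P_0 is
    free.\<close>
  have "L.delta (obj P 0) n (w \<ominus>\<^bsub>E 0 (Suc n)\<^esub> ?pa) = L.delta (obj P 0) n w \<ominus>\<^bsub>E 0 n\<^esub> L.delta (obj P 0) n ?pa"
    by (rule mod_hom_minus[OF E E q w(1) cl_p[OF ab(1)]])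
  also have "\<dots> = \<zero>\<^bsub>E 0 n\<^esub>"
    unfolding eq using cl_q[OF cl_p[OF ab(1)]] by (simp add: a_minus_def E0.M.r_neg)
  finally obtain c where c: "c \<in> carrier (E 0 (Suc (Suc n)))"
    "L.delta (obj P 0) (Suc n) c = w \<ominus>\<^bsub>E 0 (Suc n)\<^esub> ?pa"
    using q_exact[OF E0'.M.minus_closed[OF w(1) cl_p[OF ab(1)]]] by blast
  have "L.delta M (Suc n) (power_map (C (Suc (Suc n))) (aug P) c) =
      power_map (C (Suc n)) (aug P) (w \<ominus>\<^bsub>E 0 (Suc n)\<^esub> ?pa)"
    unfolding c(2)[symmetric] by (rule aug_delta[OF c(1), symmetric])
  also have "\<dots> = z \<ominus>\<^bsub>power_module (C (Suc n)) M\<^esub> \<zero>\<^bsub>power_module (C (Suc n)) M\<^esub>"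
    using mod_hom_minus[OF E module_power_module[OF F.M] power_map_mod_hom[OF F.aug] w(1) cl_p[OF ab(1)]]
    by (simp add: w(2) aug_diff_power[OF ab(1)])
  also have "\<dots> = z"
  proof -
    interpret PM: module R "power_module (C (Suc n)) M" by (rule module_power_module[OF F.M])
    show ?thesis using z(1) by (simp add: a_minus_def)
  qed
  finally show ?thesis
    using mod_hom_closed[OF power_map_mod_hom[OF F.aug] c(1)] by blast
qed

text \<open>As both differentials together kill w, \<open>delta\<close> of w is a cycle in the
  P-direction and equals the image of some w', which starts the zigzag. At its edge the augmentation
  produces a cycle of M tensor Q in degree n + 1; \<open>exact\<close> bounds it, and lifting the
  bounding chain to P_0 leaves an element with zero augmentation, hence an image from P_1.\<close>

lemma delta_exact_chase:
  assumes exact: "\<And>z. z \<in> carrier (power_module (C (Suc n)) M) \<Longrightarrow> L.delta M n z = \<zero>\<^bsub>power_module (C n) M\<^esub> \<Longrightarrow>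
      \<exists>y\<in>carrier (power_module (C (Suc (Suc n))) M). L.delta M (Suc n) y = z"
    and im: "Suc i + m = n" and w: "w \<in> carrier (E (Suc i) (Suc m))"
    and cycle: "L.delta (obj P i) m (power_map (C (Suc m)) (diff P (Suc i)) w) = \<zero>\<^bsub>E i m\<^esub>"
  shows "\<exists>a\<in>carrier (E (Suc (Suc i)) (Suc m)). \<exists>b\<in>carrier (E (Suc i) (Suc (Suc m))).
    w = power_map (C (Suc m)) (diff P (Suc (Suc i))) a \<oplus>\<^bsub>E (Suc i) (Suc m)\<^esub> L.delta (obj P (Suc i)) (Suc m) b"
proof -
  note cl_p = mod_hom_closed[OF power_map_mod_hom[OF F.diff]]
    and cl_q = mod_hom_closed[OF L.delta_mod_hom[OF F.obj]]
  have "power_map (C m) (diff P (Suc i)) (L.delta (obj P (Suc i)) m w) = \<zero>\<^bsub>E i m\<^esub>"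
    using p_q[OF w] cycle by simp
  then obtain w' where w': "w' \<in> carrier (E (Suc (Suc i)) m)"
    "power_map (C m) (diff P (Suc (Suc i))) w' = L.delta (obj P (Suc i)) m w"
    using p_exact[OF cl_q[OF w]] by blast
  show ?thesis
  proof (rule chase[OF _ im w w'(1) w'(2)[symmetric]])
    fix u v assume u: "u \<in> carrier (E 0 (Suc n))" and v: "v \<in> carrier (E (Suc 0) n)"
      and uv: "L.delta (obj P 0) n u = power_map (C n) (diff P (Suc 0)) v"
    interpret E0: module R "E 0 (Suc n)" by (rule E)
    interpret PM: module R "power_module (C (Suc n)) M" by (rule module_power_module[OF F.M])
    let ?z = "power_map (C (Suc n)) (aug P) u"
    have z: "?z \<in> carrier (power_module (C (Suc n)) M)"
      by (rule mod_hom_closed[OF power_map_mod_hom[OF F.aug] u])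
    have "L.delta M n ?z = \<zero>\<^bsub>power_module (C n) M\<^esub>"
      unfolding aug_delta[OF u, symmetric] uv by (rule aug_diff_power[OF v])
    then obtain y where y: "y \<in> carrier (power_module (C (Suc (Suc n))) M)" "L.delta M (Suc n) y = ?z"
      using exact[OF z] by blast
    obtain b where b: "b \<in> carrier (E 0 (Suc (Suc n)))" "power_map (C (Suc (Suc n))) (aug P) b = y"
      using aug_surj_power[OF y(1)] by blast
    have qb: "L.delta (obj P 0) (Suc n) b \<in> carrier (E 0 (Suc n))" by (rule cl_q[OF b(1)])
    have "power_map (C (Suc n)) (aug P) (u \<ominus>\<^bsub>E 0 (Suc n)\<^esub> L.delta (obj P 0) (Suc n) b) =
        ?z \<ominus>\<^bsub>power_module (C (Suc n)) M\<^esub> ?z"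
      using mod_hom_minus[OF E module_power_module[OF F.M] power_map_mod_hom[OF F.aug] u qb]
        aug_delta[OF b(1)] b(2) y(2) by simp
    also have "\<dots> = \<zero>\<^bsub>power_module (C (Suc n)) M\<^esub>" using z by (simp add: a_minus_def PM.M.r_neg)
    finally obtain a where a: "a \<in> carrier (E (Suc 0) (Suc n))"
      "power_map (C (Suc n)) (diff P (Suc 0)) a = u \<ominus>\<^bsub>E 0 (Suc n)\<^esub> L.delta (obj P 0) (Suc n) b"
      using aug_exact_power[OF E0.M.minus_closed[OF u qb]] by blast
    have "u = power_map (C (Suc n)) (diff P (Suc 0)) a \<oplus>\<^bsub>E 0 (Suc n)\<^esub> L.delta (obj P 0) (Suc n) b"
      unfolding a(2) using u qb by (simp add: a_minus_def E0.M.a_assoc E0.M.l_neg)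
    then show "\<exists>a\<in>carrier (E (Suc 0) (Suc n)). \<exists>b\<in>carrier (E 0 (Suc (Suc n))).
       u = power_map (C (Suc n)) (diff P (Suc 0)) a \<oplus>\<^bsub>E 0 (Suc n)\<^esub> L.delta (obj P 0) (Suc n) b"
      using a(1) b(1) by blast
  qed
qed

text \<open>Here w is u tensor x, the vector of multiples of u by the coordinates of x. Both
  differentials together send it to du tensor dx, whose entries vanish by \<open>orth\<close>. The
  conclusion is read off at a single c, so that it can be divided by one coordinate of x.\<close>

lemma elementary_tensor_boundary:
  assumes exact: "\<And>z. z \<in> carrier (power_module (C (Suc n)) M) \<Longrightarrow> L.delta M n z = \<zero>\<^bsub>power_module (C n) M\<^esub> \<Longrightarrow>
      \<exists>y\<in>carrier (power_module (C (Suc (Suc n))) M). L.delta M (Suc n) y = z"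
    and im: "Suc i + m = n" and u: "u \<in> carrier (obj P (Suc i))" and x: "x \<in> carrier (obj Q (Suc m))"
    and orth: "\<And>c. c \<in> C m \<Longrightarrow>
      L.F.coords m (diff Q (Suc m) x) c \<odot>\<^bsub>obj P i\<^esub> diff P (Suc i) u = \<zero>\<^bsub>obj P i\<^esub>"
    and c: "c \<in> C (Suc m)"
  shows "\<exists>a\<in>carrier (obj P (Suc (Suc i))). \<exists>b\<in>C (Suc (Suc m)) \<rightarrow> carrier (obj P (Suc i)).
    L.F.coords (Suc m) x c \<odot>\<^bsub>obj P (Suc i)\<^esub> u =
      diff P (Suc (Suc i)) a \<oplus>\<^bsub>obj P (Suc i)\<^esub>
      lin_comb (obj P (Suc i)) (C (Suc (Suc m))) (\<lambda>c'. L.diff_matrix (Suc m) c' c) b"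
proof -
  let ?x = "L.F.coords (Suc m) x"
  define w where "w = (\<lambda>c\<in>C (Suc m). ?x c \<odot>\<^bsub>obj P (Suc i)\<^esub> u)"
  have xc: "?x \<in> C (Suc m) \<rightarrow> carrier R" using L.F.coords_closed[OF x] by auto
  have w: "w \<in> carrier (E (Suc i) (Suc m))"
    using xc u by (auto simp: w_def power_module_simps)
  have du: "diff P (Suc i) u \<in> carrier (obj P i)" by (rule mod_hom_closed[OF F.diff u])
  have "L.delta (obj P i) m (power_map (C (Suc m)) (diff P (Suc i)) w) = \<zero>\<^bsub>E i m\<^esub>"
    unfolding matrix_map_def power_module_simps
  proof (rule restrict_ext)
    fix c' assume c': "c' \<in> C m"
    have D: "(\<lambda>c. L.diff_matrix m c c') \<in> C (Suc m) \<rightarrow> carrier R" using c' L.D_closed by auto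
    have "lin_comb (obj P i) (C (Suc m)) (\<lambda>c. L.diff_matrix m c c')
        (power_map (C (Suc m)) (diff P (Suc i)) w) =
      (\<Oplus>\<^bsub>obj P i\<^esub>c\<in>C (Suc m). (L.diff_matrix m c c' \<otimes>\<^bsub>R\<^esub> ?x c) \<odot>\<^bsub>obj P i\<^esub> diff P (Suc i) u)"
      unfolding lin_comb_def using D xc du u
      by (intro F.F.M.finsum_cong')
        (auto simp: power_map_def w_def mod_hom_smult[OF F.diff] F.F.smult_assoc1 Pi_iff)
    also have "\<dots> = (\<Oplus>\<^bsub>R\<^esub>c\<in>C (Suc m). L.diff_matrix m c c' \<otimes>\<^bsub>R\<^esub> ?x c) \<odot>\<^bsub>obj P i\<^esub> diff P (Suc i) u"
      using D xc du L.F.finite_basis by (intro F.F.finsum_smult_left[symmetric]) auto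
    also have "(\<Oplus>\<^bsub>R\<^esub>c\<in>C (Suc m). L.diff_matrix m c c' \<otimes>\<^bsub>R\<^esub> ?x c) = L.F.coords m (diff Q (Suc m) x) c'"
      using L.diff_lin_comb[OF xc c'] x by (simp add: L.F.lin_comb_coords)
    finally show "lin_comb (obj P i) (C (Suc m)) (\<lambda>c. L.diff_matrix m c c')
        (power_map (C (Suc m)) (diff P (Suc i)) w) = \<zero>\<^bsub>obj P i\<^esub>"
      using orth[OF c'] by simp
  qed
  then obtain a b where a: "a \<in> carrier (E (Suc (Suc i)) (Suc m))"
    and b: "b \<in> carrier (E (Suc i) (Suc (Suc m)))"
    and ab: "w = power_map (C (Suc m)) (diff P (Suc (Suc i))) a \<oplus>\<^bsub>E (Suc i) (Suc m)\<^esub>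
      L.delta (obj P (Suc i)) (Suc m) b"
    using delta_exact_chase[OF exact im w] by blast
  have "?x c \<odot>\<^bsub>obj P (Suc i)\<^esub> u = diff P (Suc (Suc i)) (a c) \<oplus>\<^bsub>obj P (Suc i)\<^esub>
      lin_comb (obj P (Suc i)) (C (Suc (Suc m))) (\<lambda>c'. L.diff_matrix (Suc m) c' c) b"
    using fun_cong[OF ab, of c] c by (simp add: w_def power_module_simps power_map_def matrix_map_def)
  moreover have "a c \<in> carrier (obj P (Suc (Suc i)))" "b \<in> C (Suc (Suc m)) \<rightarrow> carrier (obj P (Suc i))"
    using a b c by (auto simp: power_module_simps)
  ultimately show ?thesis by blast
qed

end

section \<open>Spans and finitely generated modules\<close>

definition lin_span :: "('r, 'x) ring_scheme \<Rightarrow> ('r, 'm) module \<Rightarrow> 'm set \<Rightarrow> 'm set" where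
  "lin_span R V A = {lin_comb V A c (\<lambda>a. a) | c. c \<in> A \<rightarrow> carrier R}"

text \<open>The products of \<open>I\<close> and \<open>K\<close>, closed under sums by adding one
  product at a time, which gives a direct induction rule. For an ideal and the whole module it
  agrees with \<open>ideal_smult\<close>; with \<open>K\<close> a proper submodule it expresses the
  hypothesis of Nakayama's lemma.\<close>

inductive_set smult_span :: "('r, 'm) module \<Rightarrow> 'r set \<Rightarrow> 'm set \<Rightarrow> 'm set"
  for V :: "('r, 'm) module" and I :: "'r set" and K :: "'m set" where
  zero: "\<zero>\<^bsub>V\<^esub> \<in> smult_span V I K"
| step: "a \<in> I \<Longrightarrow> x \<in> K \<Longrightarrow> y \<in> smult_span V I K \<Longrightarrow> a \<odot>\<^bsub>V\<^esub> x \<oplus>\<^bsub>V\<^esub> y \<in> smult_span V I K"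

lemma (in abelian_group) add_minus_add_cancel:
  assumes "p \<in> carrier G" "q \<in> carrier G" "r \<in> carrier G"
  shows "(p \<oplus> q) \<ominus> (p \<oplus> r) = q \<ominus> r"
proof -
  have "(p \<oplus> q) \<ominus> (p \<oplus> r) = (p \<oplus> \<ominus> p) \<oplus> (q \<oplus> \<ominus> r)"
    using assms by (simp add: a_minus_def minus_add a_ac)
  also have "\<dots> = q \<ominus> r" using assms by (simp add: r_neg a_minus_def)
  finally show ?thesis .
qed

lemma (in additive_subgroup) in_carrier: "a \<in> H \<Longrightarrow> a \<in> carrier G"
  using a_subset by blast

text \<open>The record extension of \<open>V\<close> is fixed to \<open>unit\<close> here because the notions of module theory in
  the definitions, unlike the locale \<open>module\<close>, are not generic in it.\<close>

locale plain_module = module R V for R (structure) and V :: "('r, 'm) module" (structure)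
begin

lemma submodule_subset: "submodule K R V \<Longrightarrow> K \<subseteq> carrier V"
  and submodule_add: "submodule K R V \<Longrightarrow> x \<in> K \<Longrightarrow> y \<in> K \<Longrightarrow> x \<oplus>\<^bsub>V\<^esub> y \<in> K"
  and submodule_smult: "submodule K R V \<Longrightarrow> r \<in> carrier R \<Longrightarrow> x \<in> K \<Longrightarrow> r \<odot>\<^bsub>V\<^esub> x \<in> K"
  and submodule_uminus: "submodule K R V \<Longrightarrow> x \<in> K \<Longrightarrow> \<ominus>\<^bsub>V\<^esub> x \<in> K"
  by (auto dest: submoduleE)

lemma submodule_zero: "submodule K R V \<Longrightarrow> \<zero>\<^bsub>V\<^esub> \<in> K"
  using subgroup.one_closed[OF submodule.axioms(1)] by fastforce

lemma submodule_minus: "submodule K R V \<Longrightarrow> x \<in> K \<Longrightarrow> y \<in> K \<Longrightarrow> x \<ominus>\<^bsub>V\<^esub> y \<in> K"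
  by (simp add: a_minus_def submodule_add submodule_uminus)

lemma submodule_lin_comb:
  assumes K: "submodule K R V" and "finite A" "c \<in> A \<rightarrow> carrier R" "g \<in> A \<rightarrow> K"
  shows "lin_comb V A c g \<in> K"
  using assms(2-4)
proof (induct A rule: finite_induct)
  case empty
  then show ?case using submodule_zero[OF K] by simp
next
  case (insert a A)
  then show ?case
    using submodule_subset[OF K]
    by (subst lin_comb_insert) (auto intro!: submodule_add[OF K] submodule_smult[OF K])
qed

lemma submoduleI':
  assumes "K \<subseteq> carrier V" "\<zero>\<^bsub>V\<^esub> \<in> K" "\<And>x y. x \<in> K \<Longrightarrow> y \<in> K \<Longrightarrow> x \<oplus>\<^bsub>V\<^esub> y \<in> K"
    "\<And>r x. r \<in> carrier R \<Longrightarrow> x \<in> K \<Longrightarrow> r \<odot>\<^bsub>V\<^esub> x \<in> K"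
  shows "submodule K R V"
proof (rule submoduleI)
  fix x assume x: "x \<in> K"
  have "(\<ominus>\<^bsub>R\<^esub> \<one>\<^bsub>R\<^esub>) \<odot>\<^bsub>V\<^esub> x = \<ominus>\<^bsub>V\<^esub> x"
    using x assms(1) by (subst smult_l_minus) auto
  then show "\<ominus>\<^bsub>V\<^esub> x \<in> K" using assms(4)[of "\<ominus>\<^bsub>R\<^esub> \<one>\<^bsub>R\<^esub>" x] x by auto
qed (use assms in auto)

lemma submodule_Int: "submodule K R V \<Longrightarrow> submodule L R V \<Longrightarrow> submodule (K \<inter> L) R V"
  by (rule submoduleI') (auto dest: submodule_subset intro: submodule_zero submodule_add submodule_smult)

lemma submodule_lin_span:
  assumes "finite A" "A \<subseteq> carrier V"
  shows "submodule (lin_span R V A) R V"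
proof (rule submoduleI')
  have A: "(\<lambda>a. a) \<in> A \<rightarrow> carrier V" using assms by auto
  show "lin_span R V A \<subseteq> carrier V"
    unfolding lin_span_def using A by (auto intro!: lin_comb_closed)
  show "\<zero>\<^bsub>V\<^esub> \<in> lin_span R V A"
    unfolding lin_span_def using lin_comb_zero_left[OF _ A, of "\<lambda>_. \<zero>\<^bsub>R\<^esub>"]
    by (intro CollectI exI[of _ "\<lambda>_. \<zero>\<^bsub>R\<^esub>"]) auto
  fix x assume "x \<in> lin_span R V A"
  then obtain c where c: "c \<in> A \<rightarrow> carrier R" "x = lin_comb V A c (\<lambda>a. a)" by (auto simp: lin_span_def)
  {
    fix y assume "y \<in> lin_span R V A"
    then obtain d where d: "d \<in> A \<rightarrow> carrier R" "y = lin_comb V A d (\<lambda>a. a)" by (auto simp: lin_span_def)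
    show "x \<oplus>\<^bsub>V\<^esub> y \<in> lin_span R V A"
      unfolding lin_span_def c d using c d lin_comb_add[OF c(1) d(1) A]
      by (intro CollectI exI[of _ "\<lambda>a. c a \<oplus>\<^bsub>R\<^esub> d a"]) auto
  next
    fix r assume r: "r \<in> carrier R"
    show "r \<odot>\<^bsub>V\<^esub> x \<in> lin_span R V A"
      unfolding lin_span_def c using c r lin_comb_smult[OF assms(1) r c(1) A]
      by (intro CollectI exI[of _ "\<lambda>a. r \<otimes>\<^bsub>R\<^esub> c a"]) auto
  }
qed

lemma lin_span_incl:
  assumes "finite A" "A \<subseteq> carrier V" "a \<in> A"
  shows "a \<in> lin_span R V A"
proof -
  have "lin_comb V A (\<lambda>b. if b = a then \<one>\<^bsub>R\<^esub> else \<zero>\<^bsub>R\<^esub>) (\<lambda>a. a) = a"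
    using assms(2) by (intro lin_comb_single[OF assms(1,3)]) auto
  then show ?thesis
    unfolding lin_span_def
    by (intro CollectI exI[of _ "\<lambda>b. if b = a then \<one>\<^bsub>R\<^esub> else \<zero>\<^bsub>R\<^esub>"]) simp
qed

lemma lin_span_least:
  assumes "submodule K R V" "finite A" "A \<subseteq> K"
  shows "lin_span R V A \<subseteq> K"
  unfolding lin_span_def using assms by (auto intro!: submodule_lin_comb)

lemma lin_span_mono:
  assumes "finite B" "A \<subseteq> B" "B \<subseteq> carrier V"
  shows "lin_span R V A \<subseteq> lin_span R V B"
  using assms finite_subset[OF assms(2,1)]
  by (intro lin_span_least submodule_lin_span) (auto intro: lin_span_incl)

lemma lin_comb_reindex:
  assumes "inj_on h I" "c \<in> h ` I \<rightarrow> carrier R" "h \<in> I \<rightarrow> carrier V"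
  shows "lin_comb V (h ` I) c (\<lambda>a. a) = lin_comb V I (\<lambda>i. c (h i)) h"
  unfolding lin_comb_def using assms
  by (subst M.finsum_reindex) auto

lemma lin_span_exchange:
  assumes A: "finite A" "A \<subseteq> carrier V" and c: "c \<in> A \<rightarrow> carrier R" "lin_comb V A c (\<lambda>a. a) = \<zero>\<^bsub>V\<^esub>"
    and a: "a \<in> A" "c a \<in> Units R"
  shows "lin_span R V A \<subseteq> lin_span R V (A - {a})"
proof
  have A': "(\<lambda>a. a) \<in> A \<rightarrow> carrier V" using A by auto
  fix x assume "x \<in> lin_span R V A"
  then obtain d where d: "d \<in> A \<rightarrow> carrier R" "x = lin_comb V A d (\<lambda>a. a)" by (auto simp: lin_span_def)
  \<comment> \<open>The relation c multiplied by \<open>s\<close> has coefficient \<open>d a\<close>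
    at a, so subtracting it from the expression for x removes a without changing x.\<close>
  define s where "s = d a \<otimes>\<^bsub>R\<^esub> inv\<^bsub>R\<^esub> (c a)"
  have cd: "c a \<in> carrier R" "d a \<in> carrier R" "inv\<^bsub>R\<^esub> (c a) \<in> carrier R" using c d a by auto
  then have s: "s \<in> carrier R" by (simp add: s_def)
  have sc: "s \<otimes>\<^bsub>R\<^esub> c a = d a" using cd a by (simp add: s_def R.m_assoc)
  let ?d = "\<lambda>b. d b \<ominus>\<^bsub>R\<^esub> s \<otimes>\<^bsub>R\<^esub> c b"
  have d': "?d \<in> A \<rightarrow> carrier R" using c d s by auto
  have "lin_comb V A ?d (\<lambda>a. a) = x \<ominus>\<^bsub>V\<^esub> lin_comb V A (\<lambda>b. s \<otimes>\<^bsub>R\<^esub> c b) (\<lambda>a. a)"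
    unfolding d(2) using c s by (intro lin_comb_minus[OF A(1) d(1) _ A']) auto
  also have "lin_comb V A (\<lambda>b. s \<otimes>\<^bsub>R\<^esub> c b) (\<lambda>a. a) = \<zero>\<^bsub>V\<^esub>"
    using lin_comb_smult[OF A(1) s c(1) A'] c(2) s by simp
  finally have "x = lin_comb V A ?d (\<lambda>a. a)"
    using lin_comb_closed[OF d(1) A'] d(2) by (simp add: a_minus_def)
  also have "\<dots> = lin_comb V (A - {a}) ?d (\<lambda>a. a)"
    using A' d' A(1) sc cd by (intro lin_comb_mono_neutral) (auto simp: a_minus_def R.r_neg)
  finally show "x \<in> lin_span R V (A - {a})"
    unfolding lin_span_def using d' by (intro CollectI exI[of _ ?d]) auto
qed

lemma smult_span_closed:
  assumes "I \<subseteq> carrier R" "K \<subseteq> carrier V"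
  shows "smult_span V I K \<subseteq> carrier V"
proof
  fix x assume "x \<in> smult_span V I K"
  then show "x \<in> carrier V" by induct (use assms in auto)
qed

lemma smult_span_incl:
  assumes "I \<subseteq> carrier R" "K \<subseteq> carrier V" "a \<in> I" "x \<in> K"
  shows "a \<odot>\<^bsub>V\<^esub> x \<in> smult_span V I K"
  using smult_span.step[OF assms(3,4) smult_span.zero[of V]] assms by (auto simp: subset_iff)

lemma smult_span_add:
  assumes I: "I \<subseteq> carrier R" and K: "K \<subseteq> carrier V"
    and "x \<in> smult_span V I K" and y: "y \<in> smult_span V I K"
  shows "x \<oplus>\<^bsub>V\<^esub> y \<in> smult_span V I K"
  using assms(3)
proof induct
  case zero
  then show ?case using y smult_span_closed[OF I K] by auto
next
  case (step a x z)
  then have "a \<odot>\<^bsub>V\<^esub> x \<oplus>\<^bsub>V\<^esub> z \<oplus>\<^bsub>V\<^esub> y = a \<odot>\<^bsub>V\<^esub> x \<oplus>\<^bsub>V\<^esub> (z \<oplus>\<^bsub>V\<^esub> y)"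
    using y smult_span_closed[OF I K] I K by (intro M.a_assoc) auto
  then show ?case using step by (simp add: smult_span.step)
qed

lemma submodule_smult_span:
  assumes I: "ideal I R" and K: "K \<subseteq> carrier V"
  shows "submodule (smult_span V I K) R V"
proof (rule submoduleI')
  have I': "I \<subseteq> carrier R" using ideal.axioms(1)[OF I] by (rule additive_subgroup.a_subset)
  show "smult_span V I K \<subseteq> carrier V" by (rule smult_span_closed[OF I' K])
  show "x \<oplus>\<^bsub>V\<^esub> y \<in> smult_span V I K" if "x \<in> smult_span V I K" "y \<in> smult_span V I K" for x y
    using that by (rule smult_span_add[OF I' K])
  fix r x assume r: "r \<in> carrier R" and "x \<in> smult_span V I K"
  from this(2) show "r \<odot>\<^bsub>V\<^esub> x \<in> smult_span V I K"
  proof induct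
    case zero
    then show ?case using r by (simp add: smult_span.zero)
  next
    case (step a x y)
    have cl: "a \<in> carrier R" "x \<in> carrier V" "y \<in> carrier V"
      using step I' K smult_span_closed[OF I' K] by auto
    have "r \<odot>\<^bsub>V\<^esub> (a \<odot>\<^bsub>V\<^esub> x \<oplus>\<^bsub>V\<^esub> y) = (r \<otimes>\<^bsub>R\<^esub> a) \<odot>\<^bsub>V\<^esub> x \<oplus>\<^bsub>V\<^esub> r \<odot>\<^bsub>V\<^esub> y"
      using r cl by (simp add: smult_r_distr smult_assoc1)
    then show ?case using step ideal.I_l_closed[OF I step(1) r] by (auto intro: smult_span.step)
  qed
qed (rule smult_span.zero)

lemma smult_span_lin_span:
  assumes I: "ideal I R" and A: "finite A" "A \<subseteq> carrier V" and "x \<in> smult_span V I (lin_span R V A)"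
  shows "\<exists>c\<in>A \<rightarrow> I. x = lin_comb V A c (\<lambda>a. a)"
  using assms(4)
proof induct
  case zero
  have "\<zero>\<^bsub>R\<^esub> \<in> I" using additive_subgroup.zero_closed[OF ideal.axioms(1)[OF I]] .
  moreover have "lin_comb V A (\<lambda>_. \<zero>\<^bsub>R\<^esub>) (\<lambda>a. a) = \<zero>\<^bsub>V\<^esub>"
    using A by (intro lin_comb_zero_left) auto
  ultimately show ?case by (intro bexI[of _ "\<lambda>_. \<zero>\<^bsub>R\<^esub>"]) auto
next
  case (step a x y)
  have A': "(\<lambda>a. a) \<in> A \<rightarrow> carrier V" using A by auto
  have I': "I \<subseteq> carrier R" using ideal.axioms(1)[OF I] by (rule additive_subgroup.a_subset)
  obtain c where c: "c \<in> A \<rightarrow> I" "y = lin_comb V A c (\<lambda>a. a)" using step by auto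
  obtain d where d: "d \<in> A \<rightarrow> carrier R" "x = lin_comb V A d (\<lambda>a. a)" using step by (auto simp: lin_span_def)
  have ad: "(\<lambda>b. a \<otimes>\<^bsub>R\<^esub> d b) \<in> A \<rightarrow> I" using ideal.I_r_closed[OF I step(1)] d by auto
  have "a \<odot>\<^bsub>V\<^esub> x \<oplus>\<^bsub>V\<^esub> y = lin_comb V A (\<lambda>b. a \<otimes>\<^bsub>R\<^esub> d b \<oplus>\<^bsub>R\<^esub> c b) (\<lambda>a. a)"
    using c d ad step I' A' A(1)
    by (subst lin_comb_add) (auto simp: lin_comb_smult Pi_iff subset_iff)
  then show ?case
    using c ad additive_subgroup.a_closed[OF ideal.axioms(1)[OF I]]
    by (intro bexI[of _ "\<lambda>b. a \<otimes>\<^bsub>R\<^esub> d b \<oplus>\<^bsub>R\<^esub> c b"]) auto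
qed

lemma lin_comb_in_smult_span:
  assumes I: "ideal I R" and K: "K \<subseteq> carrier V" and "finite A" "c \<in> A \<rightarrow> I" "g \<in> A \<rightarrow> K"
  shows "lin_comb V A c g \<in> smult_span V I K"
  using assms(3-5)
proof (induct A rule: finite_induct)
  case empty
  then show ?case by (simp add: smult_span.zero)
next
  case (insert a A)
  have I': "I \<subseteq> carrier R" using ideal.axioms(1)[OF I] by (rule additive_subgroup.a_subset)
  have "lin_comb V (insert a A) c g = c a \<odot>\<^bsub>V\<^esub> g a \<oplus>\<^bsub>V\<^esub> lin_comb V A c g"
    using insert I' K by (intro lin_comb_insert) auto
  then show ?case using insert by (auto intro!: smult_span.step)
qed

lemma ideal_smult_eq_smult_span:
  assumes I: "ideal I R"
  shows "ideal_smult I V = smult_span V I (carrier V)"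
proof
  note sub = submodule_smult_span[OF I order_refl]
  have I': "I \<subseteq> carrier R" using ideal.axioms(1)[OF I] by (rule additive_subgroup.a_subset)
  show "ideal_smult I V \<subseteq> smult_span V I (carrier V)"
    unfolding ideal_smult_def
    using smult_span_incl[OF I' order_refl]
    by (intro group.generate_subgroup_incl[OF M.a_group _ submodule.axioms(1)[OF sub]]) auto
  show "smult_span V I (carrier V) \<subseteq> ideal_smult I V"
  proof
    fix x assume "x \<in> smult_span V I (carrier V)"
    then show "x \<in> ideal_smult I V"
    proof induct
      case zero
      then show ?case unfolding ideal_smult_def using generate.one[of "add_monoid V"] by simp
    next
      case (step a x y)
      then have "a \<odot>\<^bsub>V\<^esub> x \<in> ideal_smult I V"
        unfolding ideal_smult_def by (intro generate.incl) auto
      then show ?case using step generate.eng[of _ "add_monoid V"] unfolding ideal_smult_def by fastforce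
    qed
  qed
qed

lemma nakayama:
  assumes I: "ideal I R" "\<And>r. r \<in> I \<Longrightarrow> \<one>\<^bsub>R\<^esub> \<ominus>\<^bsub>R\<^esub> r \<in> Units R"
    and A: "finite A" "A \<subseteq> carrier V" and sub: "lin_span R V A \<subseteq> smult_span V I (lin_span R V A)"
  shows "lin_span R V A = {\<zero>\<^bsub>V\<^esub>}"
  using A sub
proof (induct "card A" arbitrary: A rule: less_induct)
  case less
  have A': "(\<lambda>a. a) \<in> A \<rightarrow> carrier V" using less by auto
  show ?case
  proof (cases "A = {}")
    case True
    then show ?thesis by (auto simp: lin_span_def)
  next
    case False
    then obtain a where a: "a \<in> A" by auto
    have I': "I \<subseteq> carrier R" using ideal.axioms(1)[OF I(1)] by (rule additive_subgroup.a_subset)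
    have "a \<in> smult_span V I (lin_span R V A)"
      using lin_span_incl[OF less(2,3) a] less(4) by auto
    then obtain c where c: "c \<in> A \<rightarrow> I" "a = lin_comb V A c (\<lambda>a. a)"
      using smult_span_lin_span[OF I(1) less(2,3)] by auto
    then have c': "c \<in> A \<rightarrow> carrier R" using I' by auto
    let ?\<delta> = "\<lambda>b. if b = a then \<one>\<^bsub>R\<^esub> else \<zero>\<^bsub>R\<^esub>"
    let ?d = "\<lambda>b. ?\<delta> b \<ominus>\<^bsub>R\<^esub> c b"
    have "lin_comb V A ?d (\<lambda>a. a) = lin_comb V A ?\<delta> (\<lambda>a. a) \<ominus>\<^bsub>V\<^esub> lin_comb V A c (\<lambda>a. a)"
      by (rule lin_comb_minus[OF less(2) _ c' A']) auto
    also have "\<dots> = \<zero>\<^bsub>V\<^esub>"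
      using lin_comb_single[OF less(2) a A'] c(2)[symmetric] a less(3) by (auto simp: a_minus_def M.r_neg)
    finally have d: "lin_comb V A ?d (\<lambda>a. a) = \<zero>\<^bsub>V\<^esub>" .
    have "c a \<in> I" using a c(1) by auto
    then have "?d a \<in> Units R" using I(2) by simp
    then have "lin_span R V A \<subseteq> lin_span R V (A - {a})"
      using c' by (intro lin_span_exchange[OF less(2,3) _ d a]) auto
    moreover have "lin_span R V (A - {a}) \<subseteq> lin_span R V A"
      using less by (intro lin_span_mono) auto
    ultimately have eq: "lin_span R V A = lin_span R V (A - {a})" by auto
    show ?thesis
      unfolding eq using less(2-4) eq
      by (intro less(1) card_Diff1_less[OF less(2) a]) auto
  qed
qed

text \<open>\<open>module_basis\<close> speaks of a set, so the family must be injective: if g i = g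
  j, then 1 at i and -1 at j form a relation, against independence and 1 being different from
  0.\<close>

lemma module_basis_image:
  assumes "finite I" "g \<in> I \<rightarrow> carrier V" "\<one>\<^bsub>R\<^esub> \<noteq> \<zero>\<^bsub>R\<^esub>"
    and spans: "\<And>x. x \<in> carrier V \<Longrightarrow> \<exists>v\<in>I \<rightarrow> carrier R. x = lin_comb V I v g"
    and independent: "\<And>v i. v \<in> I \<rightarrow> carrier R \<Longrightarrow> lin_comb V I v g = \<zero>\<^bsub>V\<^esub> \<Longrightarrow> i \<in> I \<Longrightarrow> v i = \<zero>\<^bsub>R\<^esub>"
  shows "module_basis R V (g ` I)"
proof -
  let ?\<delta> = "\<lambda>i j. if j = i then \<one>\<^bsub>R\<^esub> else \<zero>\<^bsub>R\<^esub>"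
  have inj: "inj_on g I"
  proof (rule inj_onI, rule ccontr)
    fix i j assume ij: "i \<in> I" "j \<in> I" "g i = g j" "i \<noteq> j"
    have "lin_comb V I (\<lambda>k. ?\<delta> i k \<ominus>\<^bsub>R\<^esub> ?\<delta> j k) g = lin_comb V I (?\<delta> i) g \<ominus>\<^bsub>V\<^esub> lin_comb V I (?\<delta> j) g"
      using assms by (intro lin_comb_minus) auto
    also have "\<dots> = g i \<ominus>\<^bsub>V\<^esub> g j"
      using ij assms(1,2) by (simp add: lin_comb_single)
    also have "\<dots> = \<zero>\<^bsub>V\<^esub>" using ij assms(2) by (simp add: a_minus_def M.r_neg Pi_iff)
    finally have "?\<delta> i i \<ominus>\<^bsub>R\<^esub> ?\<delta> j i = \<zero>\<^bsub>R\<^esub>"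
      using independent[of "\<lambda>k. ?\<delta> i k \<ominus>\<^bsub>R\<^esub> ?\<delta> j k" i] ij by auto
    then show False using ij assms(3) by (simp add: a_minus_def split: if_splits)
  qed
  have sum: "(\<Oplus>\<^bsub>V\<^esub>b\<in>{b \<in> g ` I. c b \<noteq> \<zero>\<^bsub>R\<^esub>}. c b \<odot>\<^bsub>V\<^esub> b) = lin_comb V I (\<lambda>i. c (g i)) g"
    if "c \<in> g ` I \<rightarrow>\<^sub>E carrier R" for c
  proof -
    have "lin_comb V (g ` I) c (\<lambda>b. b) = lin_comb V {b \<in> g ` I. c b \<noteq> \<zero>\<^bsub>R\<^esub>} c (\<lambda>b. b)"
      using assms(1,2) that by (intro lin_comb_mono_neutral) auto
    moreover have "lin_comb V (g ` I) c (\<lambda>b. b) = lin_comb V I (\<lambda>i. c (g i)) g"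
      using that assms(2) by (intro lin_comb_reindex[OF inj]) auto
    ultimately show ?thesis by (simp add: lin_comb_def)
  qed
  have "\<exists>!c. c \<in> g ` I \<rightarrow>\<^sub>E carrier R \<and> finite {b \<in> g ` I. c b \<noteq> \<zero>\<^bsub>R\<^esub>} \<and>
        x = (\<Oplus>\<^bsub>V\<^esub>b\<in>{b \<in> g ` I. c b \<noteq> \<zero>\<^bsub>R\<^esub>}. c b \<odot>\<^bsub>V\<^esub> b)" if x: "x \<in> carrier V" for x
  proof -
    obtain v where v: "v \<in> I \<rightarrow> carrier R" "x = lin_comb V I v g" using spans[OF x] by auto
    define c where "c = (\<lambda>b\<in>g ` I. v (inv_into I g b))"
    have c: "c \<in> g ` I \<rightarrow>\<^sub>E carrier R" using v(1) by (auto simp: c_def inv_into_into Pi_iff)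
    have "lin_comb V I (\<lambda>i. c (g i)) g = x"
      unfolding v(2) using v(1) assms(2) inj by (intro lin_comb_cong) (auto simp: c_def)
    then have ex: "x = (\<Oplus>\<^bsub>V\<^esub>b\<in>{b \<in> g ` I. c b \<noteq> \<zero>\<^bsub>R\<^esub>}. c b \<odot>\<^bsub>V\<^esub> b)" using sum[OF c] by simp
    have uniq: "d = c" if d: "d \<in> g ` I \<rightarrow>\<^sub>E carrier R"
      "x = (\<Oplus>\<^bsub>V\<^esub>b\<in>{b \<in> g ` I. d b \<noteq> \<zero>\<^bsub>R\<^esub>}. d b \<odot>\<^bsub>V\<^esub> b)" for d
    proof (rule PiE_ext[OF d(1) c])
      fix b assume "b \<in> g ` I"
      then obtain i where i: "i \<in> I" "b = g i" by auto
      have "lin_comb V I (\<lambda>i. d (g i) \<ominus>\<^bsub>R\<^esub> c (g i)) g =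
          lin_comb V I (\<lambda>i. d (g i)) g \<ominus>\<^bsub>V\<^esub> lin_comb V I (\<lambda>i. c (g i)) g"
        using c d assms(1,2) by (intro lin_comb_minus) auto
      also have "\<dots> = x \<ominus>\<^bsub>V\<^esub> x"
        using d(2)[unfolded sum[OF d(1)]] ex[unfolded sum[OF c]] by simp
      also have "\<dots> = \<zero>\<^bsub>V\<^esub>" using x by (simp add: a_minus_def M.r_neg)
      finally have "d (g i) \<ominus>\<^bsub>R\<^esub> c (g i) = \<zero>\<^bsub>R\<^esub>"
        using independent[of "\<lambda>i. d (g i) \<ominus>\<^bsub>R\<^esub> c (g i)" i] c d i by auto
      moreover have "d (g i) \<in> carrier R" "c (g i) \<in> carrier R" using c d(1) i by auto
      ultimately show "d b = c b" using i by (simp add: R.r_right_minus_eq)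
    qed
    show ?thesis
    proof (rule ex1I[of _ c])
      show "c \<in> g ` I \<rightarrow>\<^sub>E carrier R \<and> finite {b \<in> g ` I. c b \<noteq> \<zero>\<^bsub>R\<^esub>} \<and>
        x = (\<Oplus>\<^bsub>V\<^esub>b\<in>{b \<in> g ` I. c b \<noteq> \<zero>\<^bsub>R\<^esub>}. c b \<odot>\<^bsub>V\<^esub> b)"
        using c ex assms(1) by (intro conjI) auto
    qed (elim conjE, rule uniq)
  qed
  then show ?thesis using assms(2) by (auto simp: module_basis_def)
qed

end

sublocale finite_basis \<subseteq> plain_module by unfold_locales

lemma plain_module: "module R V \<Longrightarrow> plain_module R V"
  by (simp add: plain_module_def)

lemma smult_span_mod_hom:
  assumes V: "module R V" and W: "module R W" and f: "f \<in> mod_hom R V W" and I: "I \<subseteq> carrier R"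
    and K: "K \<subseteq> carrier V" "f ` K \<subseteq> K'" and "x \<in> smult_span V I K"
  shows "f x \<in> smult_span W I K'"
  using assms(7)
proof induct
  case zero
  then show ?case using mod_hom_zero[OF V W f] by (simp add: smult_span.zero)
next
  case (step a x y)
  interpret V: plain_module R V using V by (rule plain_module)
  have "f (a \<odot>\<^bsub>V\<^esub> x \<oplus>\<^bsub>V\<^esub> y) = a \<odot>\<^bsub>W\<^esub> f x \<oplus>\<^bsub>W\<^esub> f y"
    using step I K V.smult_span_closed[OF I K(1)]
    by (subst mod_hom_add[OF f]) (auto simp: mod_hom_smult[OF f] subset_iff)
  then show ?case using step K by (auto intro: smult_span.step)
qed

lemma (in finite_basis) in_smult_span_iff:
  assumes I: "ideal I R" and x: "x \<in> carrier V"
  shows "x \<in> smult_span V I (carrier V) \<longleftrightarrow> (\<forall>b\<in>B. coords x b \<in> I)"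
proof
  have I': "I \<subseteq> carrier R" using ideal.axioms(1)[OF I] by (rule additive_subgroup.a_subset)
  assume "x \<in> smult_span V I (carrier V)"
  then show "\<forall>b\<in>B. coords x b \<in> I"
  proof induct
    case zero
    then show ?case using additive_subgroup.zero_closed[OF ideal.axioms(1)[OF I]] by (simp add: coords_zero)
  next
    case (step a x y)
    have y: "y \<in> carrier V" using step smult_span_closed[OF I' order_refl] by auto
    show ?case
    proof
      fix b assume b: "b \<in> B"
      have "coords (a \<odot>\<^bsub>V\<^esub> x \<oplus>\<^bsub>V\<^esub> y) b = a \<otimes>\<^bsub>R\<^esub> coords x b \<oplus>\<^bsub>R\<^esub> coords y b"
        using step y b I' by (simp add: coords_add coords_smult subset_iff)
      then show "coords (a \<odot>\<^bsub>V\<^esub> x \<oplus>\<^bsub>V\<^esub> y) b \<in> I"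
        using step b additive_subgroup.a_closed[OF ideal.axioms(1)[OF I]]
          ideal.I_r_closed[OF I step(1) coords_closed[OF step(2) b]] by auto
    qed
  qed
next
  assume "\<forall>b\<in>B. coords x b \<in> I"
  then have "lin_comb V B (coords x) (\<lambda>b. b) \<in> smult_span V I (carrier V)"
    using basis_closed finite_basis by (intro lin_comb_in_smult_span[OF I]) auto
  then show "x \<in> smult_span V I (carrier V)" using lin_comb_coords[OF x] by simp
qed

section \<open>Noetherian modules\<close>

text \<open>Spans and Nakayama's lemma are stated for modules; this makes them available for
  ideals.\<close>

lemma (in cring) submodule_self_module_iff: "submodule K R (self_module R) \<longleftrightarrow> ideal K R"
proof
  interpret S: plain_module R "self_module R" by (rule plain_module[OF module_self_module])
  {
    assume K: "submodule K R (self_module R)"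
    show "ideal K R"
    proof (rule idealI[OF ring_axioms])
      show "subgroup K (add_monoid R)"
      proof (rule add.subgroupI)
        show "K \<noteq> {}" using S.submodule_zero[OF K] by auto
        show "\<ominus> a \<in> K" if "a \<in> K" for a
        proof -
          have "(\<ominus> \<one>) \<otimes> a \<in> K" using S.submodule_smult[OF K _ that, of "\<ominus> \<one>"] by simp
          then show ?thesis using that S.submodule_subset[OF K] by (auto simp: l_minus subset_iff)
        qed
        show "K \<subseteq> carrier R" using S.submodule_subset[OF K] by simp
        show "a \<oplus> b \<in> K" if "a \<in> K" "b \<in> K" for a b
          using S.submodule_add[OF K that] by simp
      qed
      show "x \<otimes> a \<in> K" "a \<otimes> x \<in> K" if "a \<in> K" "x \<in> carrier R" for a x
        using S.submodule_smult[OF K that(2,1)] that S.submodule_subset[OF K] m_comm by (auto simp: subset_iff)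
    qed
  next
    assume K: "ideal K R"
    interpret K: ideal K R by (rule K)
    show "submodule K R (self_module R)"
      by (rule S.submoduleI') (auto intro: K.I_l_closed K.in_carrier)
  }
qed

lemma ideal_finitely_spanned:
  assumes "cring R" "noetherian_ring R" "ideal I R"
  shows "\<exists>A. finite A \<and> A \<subseteq> I \<and> I = lin_span R (self_module R) A"
proof -
  interpret cring R by fact
  interpret noetherian_ring R by fact
  interpret S: plain_module R "self_module R" by (rule plain_module[OF module_self_module])
  obtain A where A: "A \<subseteq> carrier R" "finite A" "I = Idl\<^bsub>R\<^esub> A" using finetely_gen[OF assms(3)] by auto
  have AI: "A \<subseteq> I" unfolding A(3) by (rule genideal_self[OF A(1)])
  have "ideal (lin_span R (self_module R) A) R"
    using S.submodule_lin_span[OF A(2)] A(1) by (simp add: submodule_self_module_iff)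
  then have "I \<subseteq> lin_span R (self_module R) A"
    unfolding A(3) using S.lin_span_incl[OF A(2)] A(1) by (intro genideal_minimal) auto
  moreover have "lin_span R (self_module R) A \<subseteq> I"
    using assms(3) A(2) AI by (intro S.lin_span_least) (auto simp: submodule_self_module_iff)
  ultimately show ?thesis using A AI by blast
qed

text \<open>Induction on the generators of the surrounding span. The coefficients of the new
  generator a in elements of \<open>K\<close> form an ideal \<open>J\<close>. Lifts to
  \<open>K\<close> of finitely many generators of \<open>J\<close>, together with generators of the
  intersection of \<open>K\<close> with the span of \<open>A\<close>, generate
  \<open>K\<close>.\<close>

lemma submodule_finitely_spanned:
  fixes R (structure) and V (structure)
  assumes "cring R" and noeth: "noetherian_ring R" and "module R V"
    and "finite A" "A \<subseteq> carrier V" "submodule K R V" "K \<subseteq> lin_span R V A"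
  shows "\<exists>A'. finite A' \<and> A' \<subseteq> K \<and> K = lin_span R V A'"
proof -
  interpret cring R by fact
  interpret V: plain_module R V using assms(3) by (rule plain_module)
  interpret S: plain_module R "self_module R" by (rule plain_module[OF module_self_module])
  show ?thesis
    using assms(4-7)
  proof (induct A arbitrary: K rule: finite_induct)
    case empty
    then have "K = {\<zero>\<^bsub>V\<^esub>}" using V.submodule_zero[of K] by (auto simp: lin_span_def)
    then show ?case by (intro exI[of _ "{}"]) (auto simp: lin_span_def)
  next
    case (insert a A)
    note K = insert(5)
    have A: "A \<subseteq> carrier V" "a \<in> carrier V" using insert by auto
    note sA = V.submodule_lin_span[OF insert(1) A(1)]
    define J where "J = {r \<in> carrier R. \<exists>y\<in>lin_span R V A. r \<odot>\<^bsub>V\<^esub> a \<oplus>\<^bsub>V\<^esub> y \<in> K}"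
    have "submodule J R (self_module R)"
    proof (rule S.submoduleI')
      show "\<zero>\<^bsub>self_module R\<^esub> \<in> J"
        using V.submodule_zero[OF K] V.submodule_zero[OF sA] A
        by (auto simp: J_def intro!: bexI[of _ "\<zero>\<^bsub>V\<^esub>"])
      fix r assume "r \<in> J"
      then obtain y where r: "r \<in> carrier R" and y: "y \<in> lin_span R V A" "r \<odot>\<^bsub>V\<^esub> a \<oplus>\<^bsub>V\<^esub> y \<in> K"
        by (auto simp: J_def)
      have yV: "y \<in> carrier V" using y V.submodule_subset[OF sA] by auto
      {
        fix s assume "s \<in> J"
        then obtain z where s: "s \<in> carrier R" and z: "z \<in> lin_span R V A" "s \<odot>\<^bsub>V\<^esub> a \<oplus>\<^bsub>V\<^esub> z \<in> K"
          by (auto simp: J_def)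
        have zV: "z \<in> carrier V" using z V.submodule_subset[OF sA] by auto
        have "(r \<oplus> s) \<odot>\<^bsub>V\<^esub> a \<oplus>\<^bsub>V\<^esub> (y \<oplus>\<^bsub>V\<^esub> z) = (r \<odot>\<^bsub>V\<^esub> a \<oplus>\<^bsub>V\<^esub> y) \<oplus>\<^bsub>V\<^esub> (s \<odot>\<^bsub>V\<^esub> a \<oplus>\<^bsub>V\<^esub> z)"
          using r s A yV zV by (simp add: V.smult_l_distr V.M.a_ac)
        also have "\<dots> \<in> K" using y(2) z(2) by (rule V.submodule_add[OF K])
        finally show "r \<oplus>\<^bsub>self_module R\<^esub> s \<in> J"
          using r s V.submodule_add[OF sA y(1) z(1)] by (auto simp: J_def)
      next
        fix s assume s: "s \<in> carrier R"
        have "(s \<otimes> r) \<odot>\<^bsub>V\<^esub> a \<oplus>\<^bsub>V\<^esub> s \<odot>\<^bsub>V\<^esub> y = s \<odot>\<^bsub>V\<^esub> (r \<odot>\<^bsub>V\<^esub> a \<oplus>\<^bsub>V\<^esub> y)"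
          using r s A yV by (simp add: V.smult_r_distr V.smult_assoc1)
        also have "\<dots> \<in> K" using y s by (intro V.submodule_smult[OF K])
        finally show "s \<odot>\<^bsub>self_module R\<^esub> r \<in> J"
          using r s V.submodule_smult[OF sA s y(1)] by (auto simp: J_def)
      }
    qed (auto simp: J_def)
    then have "ideal J R" by (simp add: submodule_self_module_iff)
    then obtain G where G: "finite G" "G \<subseteq> J" "J = lin_span R (self_module R) G"
      using ideal_finitely_spanned[OF assms(1) noeth] by blast
    have "\<forall>r\<in>G. \<exists>y\<in>lin_span R V A. r \<odot>\<^bsub>V\<^esub> a \<oplus>\<^bsub>V\<^esub> y \<in> K" using G(2) by (auto simp: J_def)
    then obtain y where y: "\<And>r. r \<in> G \<Longrightarrow> y r \<in> lin_span R V A"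
      "\<And>r. r \<in> G \<Longrightarrow> r \<odot>\<^bsub>V\<^esub> a \<oplus>\<^bsub>V\<^esub> y r \<in> K" by metis
    have GR: "\<And>r. r \<in> G \<Longrightarrow> r \<in> carrier R" using G(2) by (auto simp: J_def)
    have yV: "\<And>r. r \<in> G \<Longrightarrow> y r \<in> carrier V" using y V.submodule_subset[OF sA] by auto
    let ?k = "\<lambda>r. r \<odot>\<^bsub>V\<^esub> a \<oplus>\<^bsub>V\<^esub> y r"
    obtain A' where A': "finite A'" "A' \<subseteq> K \<inter> lin_span R V A" "K \<inter> lin_span R V A = lin_span R V A'"
      using insert(3)[OF A(1) V.submodule_Int[OF K sA]] by auto
    define B where "B = ?k ` G \<union> A'"
    have B: "finite B" "B \<subseteq> K" using G(1) A' y by (auto simp: B_def)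
    have BV: "B \<subseteq> carrier V" using B V.submodule_subset[OF K] by auto
    note sB = V.submodule_lin_span[OF B(1) BV]
    have "x \<in> lin_span R V B" if x: "x \<in> K" for x
    proof -
      obtain c where c: "c \<in> insert a A \<rightarrow> carrier R" "x = lin_comb V (insert a A) c (\<lambda>a. a)"
        using x insert(6) by (auto simp: lin_span_def)
      let ?y = "lin_comb V A c (\<lambda>a. a)"
      have xeq: "x = c a \<odot>\<^bsub>V\<^esub> a \<oplus>\<^bsub>V\<^esub> ?y"
        unfolding c(2) using insert c(1) by (intro V.lin_comb_insert) auto
      have ys: "?y \<in> lin_span R V A" using c(1) by (auto simp: lin_span_def)
      have yc: "?y \<in> carrier V" using ys V.submodule_subset[OF sA] by auto
      have ca: "c a \<in> carrier R" using c by auto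
      have "c a \<in> J" using ys x xeq ca by (auto simp: J_def)
      then obtain d where d: "d \<in> G \<rightarrow> carrier R" "c a = lin_comb (self_module R) G d (\<lambda>r. r)"
        using G(3) by (auto simp: lin_span_def)
      have ca': "c a = (\<Oplus>r\<in>G. d r \<otimes> r)" unfolding d(2) by (simp add: lin_comb_def finsum_self_module)
      \<comment> \<open>The combination of the lifts has the same coefficient at a as x, so the
        difference involves \<open>A\<close> only and falls under the induction hypothesis.\<close>
      have k: "lin_comb V G d ?k = c a \<odot>\<^bsub>V\<^esub> a \<oplus>\<^bsub>V\<^esub> lin_comb V G d y"
      proof -
        have "lin_comb V G d ?k = lin_comb V G d (\<lambda>r. r \<odot>\<^bsub>V\<^esub> a) \<oplus>\<^bsub>V\<^esub> lin_comb V G d y"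
          using d GR yV A by (intro V.lin_comb_add_right) auto
        also have "lin_comb V G d (\<lambda>r. r \<odot>\<^bsub>V\<^esub> a) = (\<Oplus>\<^bsub>V\<^esub>r\<in>G. (d r \<otimes> r) \<odot>\<^bsub>V\<^esub> a)"
          unfolding lin_comb_def using d GR A by (intro V.M.finsum_cong') (auto simp: V.smult_assoc1 Pi_iff)
        also have "\<dots> = c a \<odot>\<^bsub>V\<^esub> a"
          unfolding ca' using d GR A G(1) by (intro V.finsum_smult_left[symmetric]) auto
        finally show ?thesis .
      qed
      have dy: "lin_comb V G d y \<in> lin_span R V A"
        using y d G(1) by (intro V.submodule_lin_comb[OF sA]) auto
      have dyc: "lin_comb V G d y \<in> carrier V" using dy V.submodule_subset[OF sA] by auto
      have kK: "lin_comb V G d ?k \<in> K"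
        using y d G(1) by (intro V.submodule_lin_comb[OF K]) auto
      have kB: "lin_comb V G d ?k \<in> lin_span R V B"
        using y d G(1) V.lin_span_incl[OF B(1) BV] by (intro V.submodule_lin_comb[OF sB]) (auto simp: B_def)
      have kc: "lin_comb V G d ?k \<in> carrier V" using kK V.submodule_subset[OF K] by auto
      have "x \<ominus>\<^bsub>V\<^esub> lin_comb V G d ?k = ?y \<ominus>\<^bsub>V\<^esub> lin_comb V G d y"
        unfolding xeq k using ca A yc dyc by (intro V.M.add_minus_add_cancel) auto
      then have "x \<ominus>\<^bsub>V\<^esub> lin_comb V G d ?k \<in> K \<inter> lin_span R V A"
        using V.submodule_minus[OF K x kK] V.submodule_minus[OF sA ys dy] by auto
      also have "\<dots> \<subseteq> lin_span R V B"
        unfolding A'(3) using B(1) BV by (intro V.lin_span_mono) (auto simp: B_def)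
      finally have "lin_comb V G d ?k \<oplus>\<^bsub>V\<^esub> (x \<ominus>\<^bsub>V\<^esub> lin_comb V G d ?k) \<in> lin_span R V B"
        using kB by (intro V.submodule_add[OF sB])
      moreover have "x \<in> carrier V" using x V.submodule_subset[OF K] by auto
      then have "lin_comb V G d ?k \<oplus>\<^bsub>V\<^esub> (x \<ominus>\<^bsub>V\<^esub> lin_comb V G d ?k) = x"
        using kc by (simp add: a_minus_def V.M.a_ac V.M.r_neg V.M.r_neg1 V.M.r_neg2)
      ultimately show ?thesis by simp
    qed
    then have "K = lin_span R V B" using V.lin_span_least[OF K B] by auto
    then show ?case using B by blast
  qed
qed

section \<open>Existence of minimal free resolutions\<close>

lemma module_restrict:
  assumes "module R V" "submodule K R V"
  shows "module R (V\<lparr>carrier := K\<rparr>)"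
  by (rule submodule.submodule_is_module[OF assms(2,1)])

lemma lin_comb_restrict:
  fixes V :: "('r, 'v) module"
  assumes V: "module R V" and K: "submodule K R V" and "finite A" "c \<in> A \<rightarrow> carrier R" "g \<in> A \<rightarrow> K"
  shows "lin_comb (V\<lparr>carrier := K\<rparr>) A c g = lin_comb V A c g"
proof -
  interpret V: plain_module R V using V by (rule plain_module)
  have "id \<in> mod_hom R (V\<lparr>carrier := K\<rparr>) V"
    using V.submodule_subset[OF K] by (intro mod_homI) auto
  from mod_hom_lin_comb[OF module_restrict[OF V K] V this assms(3,4)] assms(5) show ?thesis by simp
qed

lemma lin_span_restrict:
  assumes V: "module R V" and K: "submodule K R V" and "finite A" "A \<subseteq> K"
  shows "lin_span R (V\<lparr>carrier := K\<rparr>) A = lin_span R V A"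
proof -
  have "lin_comb (V\<lparr>carrier := K\<rparr>) A c (\<lambda>a. a) = lin_comb V A c (\<lambda>a. a)" if "c \<in> A \<rightarrow> carrier R" for c
    using that assms by (intro lin_comb_restrict) auto
  then show ?thesis unfolding lin_span_def by (metis (no_types, lifting))
qed

lemma submodule_kernel:
  assumes V: "module R V" and W: "module R W" and f: "f \<in> mod_hom R V W"
  shows "submodule {x \<in> carrier V. f x = \<zero>\<^bsub>W\<^esub>} R V"
proof -
  interpret V: plain_module R V using V by (rule plain_module)
  interpret W: plain_module R W using W by (rule plain_module)
  show ?thesis
    by (rule V.submoduleI') (auto simp: mod_hom_add[OF f] mod_hom_smult[OF f] mod_hom_zero[OF V W f])
qed

lemma fg_module_iff:
  assumes "module R V"
  shows "fg_module R V \<longleftrightarrow> (\<exists>A. finite A \<and> A \<subseteq> carrier V \<and> carrier V = lin_span R V A)"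
proof -
  interpret V: plain_module R V using assms by (rule plain_module)
  have eq: "(\<forall>x\<in>carrier V. \<exists>c\<in>A \<rightarrow> carrier R. x = (\<Oplus>\<^bsub>V\<^esub>a\<in>A. c a \<odot>\<^bsub>V\<^esub> a)) \<longleftrightarrow> carrier V = lin_span R V A"
    if A: "finite A" "A \<subseteq> carrier V" for A
  proof -
    have "lin_span R V A \<subseteq> carrier V"
      by (rule V.submodule_subset[OF V.submodule_lin_span[OF A]])
    then show ?thesis by (auto simp: lin_span_def lin_comb_def)
  qed
  have "(\<exists>A. finite A \<and> A \<subseteq> carrier V \<and>
        (\<forall>x\<in>carrier V. \<exists>c\<in>A \<rightarrow> carrier R. x = (\<Oplus>\<^bsub>V\<^esub>a\<in>A. c a \<odot>\<^bsub>V\<^esub> a))) \<longleftrightarrow>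
      (\<exists>A. finite A \<and> A \<subseteq> carrier V \<and> carrier V = lin_span R V A)"
    by (rule arg_cong[where f = Ex], rule ext, rule conj_cong[OF refl], rule conj_cong[OF refl], rule eq)
  then show ?thesis by (simp only: fg_module_def assms simp_thms)
qed

text \<open>The element type is the one fixed for the terms of resolutions in \<open>syzygy\<close>,
  \<open>Tor\<close> and \<open>projective_dimension\<close>.\<close>

definition free_power :: "('r, 'x) ring_scheme \<Rightarrow> nat \<Rightarrow> ('r, nat \<Rightarrow> 'r) module" where
  "free_power R n = power_module {..<n} (self_module R)"

definition unit_vector :: "('r, 'x) ring_scheme \<Rightarrow> nat \<Rightarrow> nat \<Rightarrow> nat \<Rightarrow> 'r" where
  "unit_vector R n i = (\<lambda>j\<in>{..<n}. if i = j then \<one>\<^bsub>R\<^esub> else \<zero>\<^bsub>R\<^esub>)"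

context cring
begin

lemma module_free_power: "module R (free_power R n)"
  unfolding free_power_def by (intro module_power_module module_self_module)

lemma carrier_free_power: "carrier (free_power R n) = {..<n} \<rightarrow>\<^sub>E carrier R"
  by (simp add: free_power_def power_module_simps)

lemma unit_vector_closed: "unit_vector R n i \<in> carrier (free_power R n)"
  by (auto simp: unit_vector_def carrier_free_power)

lemma lin_comb_unit_vector:
  assumes "v \<in> {..<n} \<rightarrow> carrier R" "j < n"
  shows "lin_comb (free_power R n) {..<n} v (unit_vector R n) j = v j"
proof -
  have "lin_comb (free_power R n) {..<n} v (unit_vector R n) j =
      lin_comb (self_module R) {..<n} v (\<lambda>i. unit_vector R n i j)"
    unfolding free_power_def using assms unit_vector_closed
    by (intro power_module_lin_comb[OF module_self_module]) (auto simp: free_power_def)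
  also have "\<dots> = (\<Oplus>i\<in>{..<n}. v i \<otimes> (if i = j then \<one> else \<zero>))"
    using assms by (simp add: lin_comb_def finsum_self_module unit_vector_def)
  also have "\<dots> = v j" using assms by (intro finsum_single_coeff) auto
  finally show ?thesis .
qed

lemma lin_comb_unit_vector_eq:
  assumes "v \<in> carrier (free_power R n)"
  shows "lin_comb (free_power R n) {..<n} v (unit_vector R n) = v"
proof -
  interpret V: plain_module R "free_power R n" by (rule plain_module[OF module_free_power])
  have v: "v \<in> {..<n} \<rightarrow> carrier R" using assms by (auto simp: carrier_free_power)
  then have "lin_comb (free_power R n) {..<n} v (unit_vector R n) \<in> carrier (free_power R n)"
    using unit_vector_closed by (intro V.lin_comb_closed) auto
  then show ?thesis
    using assms lin_comb_unit_vector[OF v] unfolding carrier_free_power by (auto intro: PiE_ext)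
qed

lemma finite_basis_free_power:
  assumes "\<one> \<noteq> \<zero>"
  shows "finite_basis R (free_power R n) (unit_vector R n ` {..<n})"
proof -
  interpret V: plain_module R "free_power R n" by (rule plain_module[OF module_free_power])
  have "module_basis R (free_power R n) (unit_vector R n ` {..<n})"
  proof (rule V.module_basis_image)
    show "\<exists>v\<in>{..<n} \<rightarrow> carrier R. x = lin_comb (free_power R n) {..<n} v (unit_vector R n)"
      if "x \<in> carrier (free_power R n)" for x
      using lin_comb_unit_vector_eq[OF that] that by (intro bexI[of _ x]) (auto simp: carrier_free_power)
    show "v i = \<zero>" if v: "v \<in> {..<n} \<rightarrow> carrier R" "i \<in> {..<n}"
      and eq: "lin_comb (free_power R n) {..<n} v (unit_vector R n) = \<zero>\<^bsub>free_power R n\<^esub>" for v i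
      using lin_comb_unit_vector[OF v(1), of i] v(2) unfolding eq
      by (simp add: free_power_def power_module_simps)
  qed (use assms unit_vector_closed in auto)
  then show ?thesis
    by (intro finite_basis.intro finite_basis_axioms.intro module_free_power) auto
qed

end

text \<open>Locality in the form used by Nakayama's lemma and by the exchange of generators: a named
  ideal outside of which everything is a unit. \<open>maximal_ideal_eq\<close> identifies it with
  \<open>maximal_ideal\<close>.\<close>

locale local_ring_at = cring R + noetherian_ring R for R (structure) +
  fixes \<mm> :: "'a set"
  assumes ideal_m: "ideal \<mm> R" and one_notin: "\<one> \<notin> \<mm>"
    and units: "a \<in> carrier R \<Longrightarrow> a \<notin> \<mm> \<Longrightarrow> a \<in> Units R"
begin

lemma m_subset: "\<mm> \<subseteq> carrier R"
  using ideal.axioms(1)[OF ideal_m] by (rule additive_subgroup.a_subset)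

lemma zero_in_m: "\<zero> \<in> \<mm>"
  using additive_subgroup.zero_closed[OF ideal.axioms(1)[OF ideal_m]] .

lemma one_neq_zero: "\<one> \<noteq> \<zero>"
  using one_notin zero_in_m by metis

lemma one_minus_unit:
  assumes "r \<in> \<mm>"
  shows "\<one> \<ominus> r \<in> Units R"
proof (rule units)
  show "\<one> \<ominus> r \<in> carrier R" using assms m_subset by auto
  show "\<one> \<ominus> r \<notin> \<mm>"
  proof
    assume "\<one> \<ominus> r \<in> \<mm>"
    then have "(\<one> \<ominus> r) \<oplus> r \<in> \<mm>"
      using assms by (rule additive_subgroup.a_closed[OF ideal.axioms(1)[OF ideal_m]])
    also have "(\<one> \<ominus> r) \<oplus> r = \<one>"
      using assms m_subset by (auto simp: a_minus_def a_assoc l_neg)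
    finally show False using one_notin by simp
  qed
qed

lemma finitely_spanned:
  assumes "finite_basis R V B" "submodule K R V"
  shows "\<exists>A. finite A \<and> A \<subseteq> K \<and> K = lin_span R V A"
proof -
  interpret V: finite_basis R V B by fact
  have "carrier V \<subseteq> lin_span R V B"
  proof
    fix x assume x: "x \<in> carrier V"
    then show "x \<in> lin_span R V B"
      unfolding lin_span_def using V.lin_comb_coords[OF x] V.coords_in[OF x]
      by (intro CollectI exI[of _ "V.coords x"]) auto
  qed
  then show ?thesis
    using V.submodule_subset[OF assms(2)] V.basis_closed V.finite_basis
    by (intro submodule_finitely_spanned[OF is_cring noetherian_ring_axioms V.module_axioms V.finite_basis _ assms(2)]) auto
qed

lemma submodule_nakayama:
  assumes V: "finite_basis R V B" and K: "submodule K R V" and sub: "K \<subseteq> smult_span V \<mm> K"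
  shows "K = {\<zero>\<^bsub>V\<^esub>}"
proof -
  interpret V: finite_basis R V B by fact
  obtain A where A: "finite A" "A \<subseteq> K" "K = lin_span R V A" using finitely_spanned[OF V K] by blast
  have AV: "A \<subseteq> carrier V" using A(2) V.submodule_subset[OF K] by auto
  have "lin_span R V A = {\<zero>\<^bsub>V\<^esub>}"
    using sub by (intro V.nakayama[OF ideal_m one_minus_unit A(1) AV]) (simp_all flip: A(3))
  then show ?thesis using A(3) by simp
qed

text \<open>Generators of least possible number are chosen. If an element of the kernel had a
  coordinate outside \<open>\<mm>\<close>, that coordinate would be a unit, and
  \<open>lin_span_exchange\<close> would remove a generator.\<close>

lemma minimal_cover:
  assumes V: "fg_module R V"
  shows "\<exists>n \<phi>. \<phi> \<in> mod_hom R (free_power R n) V \<and> \<phi> ` carrier (free_power R n) = carrier V \<and>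
    {v \<in> carrier (free_power R n). \<phi> v = \<zero>\<^bsub>V\<^esub>} \<subseteq> ideal_smult \<mm> (free_power R n)"
proof -
  have mV: "module R V" using V by (simp add: fg_module_def)
  interpret V: plain_module R V using mV by (rule plain_module)
  let ?P = "\<lambda>A. finite A \<and> A \<subseteq> carrier V \<and> carrier V = lin_span R V A"
  have "\<exists>A. ?P A" using V fg_module_iff[OF mV] by simp
  then obtain A where "?P A" and min: "\<And>A'. ?P A' \<Longrightarrow> card A \<le> card A'"
    using ex_has_least_nat[of ?P _ card] by metis
  from this(1) have A1: "finite A" and A2: "A \<subseteq> carrier V" and A3: "carrier V = lin_span R V A" by blast+
  obtain h where h: "bij_betw h {..<card A} A"
    using ex_bij_betw_nat_finite[OF A1] by (auto simp: atLeast0LessThan)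
  let ?n = "card A"
  have hinj: "inj_on h {..<?n}" and himg: "h ` {..<?n} = A" using h by (auto simp: bij_betw_def)
  have hV: "h \<in> {..<?n} \<rightarrow> carrier V" using A2 himg by auto
  let ?F = "free_power R ?n"
  interpret F: finite_basis R ?F "unit_vector R ?n ` {..<?n}"
    by (rule finite_basis_free_power[OF one_neq_zero])
  let ?\<phi> = "\<lambda>v. lin_comb V {..<?n} v h"
  have hom: "?\<phi> \<in> mod_hom R ?F V"
  proof (rule mod_homI)
    fix v assume "v \<in> carrier ?F"
    then have v: "v \<in> {..<?n} \<rightarrow> carrier R" by (auto simp: carrier_free_power)
    show "?\<phi> v \<in> carrier V" using v hV by (rule V.lin_comb_closed)
    {
      fix w assume "w \<in> carrier ?F"
      then have w: "w \<in> {..<?n} \<rightarrow> carrier R" by (auto simp: carrier_free_power)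
      have "?\<phi> (v \<oplus>\<^bsub>?F\<^esub> w) = ?\<phi> (\<lambda>i. v i \<oplus> w i)"
        using v w hV by (intro V.lin_comb_cong) (auto simp: free_power_def power_module_simps)
      then show "?\<phi> (v \<oplus>\<^bsub>?F\<^esub> w) = ?\<phi> v \<oplus>\<^bsub>V\<^esub> ?\<phi> w" using V.lin_comb_add[OF v w hV] by simp
    next
      fix r assume r: "r \<in> carrier R"
      have "?\<phi> (r \<odot>\<^bsub>?F\<^esub> v) = ?\<phi> (\<lambda>i. r \<otimes> v i)"
        using v r hV by (intro V.lin_comb_cong) (auto simp: free_power_def power_module_simps)
      then show "?\<phi> (r \<odot>\<^bsub>?F\<^esub> v) = r \<odot>\<^bsub>V\<^esub> ?\<phi> v" using V.lin_comb_smult[OF _ r v hV] by simp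
    }
  qed
  have surj: "?\<phi> ` carrier ?F = carrier V"
  proof
    show "?\<phi> ` carrier ?F \<subseteq> carrier V" using mod_hom_closed[OF hom] by auto
    show "carrier V \<subseteq> ?\<phi> ` carrier ?F"
    proof
      fix x assume "x \<in> carrier V"
      then have "x \<in> lin_span R V A" using A3 by simp
      then obtain c where c: "c \<in> A \<rightarrow> carrier R" "x = lin_comb V A c (\<lambda>a. a)" by (auto simp: lin_span_def)
      have ch: "(\<lambda>i. c (h i)) \<in> {..<?n} \<rightarrow> carrier R" using c(1) himg by auto
      have "x = ?\<phi> (\<lambda>i. c (h i))"
        using V.lin_comb_reindex[OF hinj _ hV, of c] c unfolding himg by simp
      also have "\<dots> = ?\<phi> (\<lambda>i\<in>{..<?n}. c (h i))"
        using ch hV by (intro V.lin_comb_cong) auto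
      finally show "x \<in> ?\<phi> ` carrier ?F"
        using ch by (intro image_eqI[of _ _ "\<lambda>i\<in>{..<?n}. c (h i)"]) (auto simp: carrier_free_power)
    qed
  qed
  have "{v \<in> carrier ?F. ?\<phi> v = \<zero>\<^bsub>V\<^esub>} \<subseteq> smult_span ?F \<mm> (carrier ?F)"
  proof clarify
    fix v assume v: "v \<in> carrier ?F" and 0: "?\<phi> v = \<zero>\<^bsub>V\<^esub>"
    have v': "v \<in> {..<?n} \<rightarrow> carrier R" using v by (auto simp: carrier_free_power)
    have "v i \<in> \<mm>" if i: "i < ?n" for i
    proof (rule ccontr)
      assume "v i \<notin> \<mm>"
      then have u: "v i \<in> Units R" using units v' i by auto
      let ?c = "\<lambda>a. v (inv_into {..<?n} h a)"
      have "inv_into {..<?n} h a \<in> {..<?n}" if "a \<in> A" for a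
        using that inv_into_into[of a h "{..<?n}"] unfolding himg by simp
      then have c: "?c \<in> A \<rightarrow> carrier R" using v' by blast
      have "lin_comb V A ?c (\<lambda>a. a) = lin_comb V {..<?n} (\<lambda>i. ?c (h i)) h"
        using V.lin_comb_reindex[OF hinj _ hV, of ?c] c unfolding himg by simp
      also have "\<dots> = ?\<phi> v"
        using v' hV hinj by (intro V.lin_comb_cong) auto
      finally have "lin_comb V A ?c (\<lambda>a. a) = \<zero>\<^bsub>V\<^esub>" using 0 by simp
      moreover have hi: "h i \<in> A" using himg i by auto
      moreover have "?c (h i) \<in> Units R" using hinj i u by simp
      ultimately have "lin_span R V A \<subseteq> lin_span R V (A - {h i})"
        by (intro V.lin_span_exchange[OF A1 A2 c])
      moreover have "lin_span R V (A - {h i}) \<subseteq> lin_span R V A"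
        by (rule V.lin_span_mono[OF A1 Diff_subset A2])
      ultimately have "carrier V = lin_span R V (A - {h i})" unfolding A3 by (rule equalityI)
      then have "card A \<le> card (A - {h i})" using A1 A2 by (intro min conjI) auto
      then show False using card_Diff1_less[OF A1 hi] by simp
    qed
    then have "lin_comb ?F {..<?n} v (unit_vector R ?n) \<in> smult_span ?F \<mm> (carrier ?F)"
      using unit_vector_closed by (intro F.lin_comb_in_smult_span[OF ideal_m]) auto
    then show "v \<in> smult_span ?F \<mm> (carrier ?F)" using lin_comb_unit_vector_eq[OF v] by simp
  qed
  then show ?thesis
    using hom surj F.ideal_smult_eq_smult_span[OF ideal_m] by (intro exI[of _ ?n] exI[of _ ?\<phi>]) simp
qed

lemma fg_module_kernel:
  assumes "module R V" "\<phi> \<in> mod_hom R (free_power R n) V"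
  shows "fg_module R ((free_power R n)\<lparr>carrier := {v \<in> carrier (free_power R n). \<phi> v = \<zero>\<^bsub>V\<^esub>}\<rparr>)"
proof -
  let ?F = "free_power R n" and ?K = "{v \<in> carrier (free_power R n). \<phi> v = \<zero>\<^bsub>V\<^esub>}"
  have K: "submodule ?K R ?F" by (rule submodule_kernel[OF module_free_power assms])
  obtain A where A: "finite A" "A \<subseteq> ?K" "?K = lin_span R ?F A"
    using finitely_spanned[OF finite_basis_free_power[OF one_neq_zero] K] by blast
  have "carrier (?F\<lparr>carrier := ?K\<rparr>) = lin_span R (?F\<lparr>carrier := ?K\<rparr>) A"
    using A(3) lin_span_restrict[OF module_free_power K A(1,2)] by simp
  then show ?thesis
    using A(1,2) by (subst fg_module_iff[OF module_restrict[OF module_free_power K]]) auto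
qed

lemma fg_free_module_free_power: "fg_free_module R (free_power R n)"
  using finite_basis_free_power[OF one_neq_zero, of n] module_free_power
  unfolding fg_free_module_def finite_basis_def finite_basis_axioms_def by auto

lemma minimal_free_resolution_exists:
  assumes M: "fg_module R M" and m: "maximal_ideal R = \<mm>"
  shows "\<exists>P :: ('a, nat \<Rightarrow> 'a, 'm) resolution. minimal_free_resolution R M P"
proof -
  \<comment> \<open>A state of the recursion is a module V with a minimal cover
    \<open>\<phi>\<close> from R^n, and the next state covers the kernel. M has another element type
    than the kernels, so its cover \<open>n0\<close>, \<open>\<phi>0\<close> is chosen separately
    and the recursion starts with the first syzygy \<open>?V0\<close>.\<close>
  define ker where "ker = (\<lambda>(V :: ('a, nat \<Rightarrow> 'a) module, n, \<phi>).
    (free_power R n)\<lparr>carrier := {v \<in> carrier (free_power R n). \<phi> v = \<zero>\<^bsub>V\<^esub>}\<rparr>)"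
  define good where "good = (\<lambda>(V :: ('a, nat \<Rightarrow> 'a) module, n, \<phi>). fg_module R V \<and>
    \<phi> \<in> mod_hom R (free_power R n) V \<and> \<phi> ` carrier (free_power R n) = carrier V \<and>
    {v \<in> carrier (free_power R n). \<phi> v = \<zero>\<^bsub>V\<^esub>} \<subseteq> ideal_smult \<mm> (free_power R n))"
  obtain n0 \<phi>0 where 0: "\<phi>0 \<in> mod_hom R (free_power R n0) M" "\<phi>0 ` carrier (free_power R n0) = carrier M"
    "{v \<in> carrier (free_power R n0). \<phi>0 v = \<zero>\<^bsub>M\<^esub>} \<subseteq> ideal_smult \<mm> (free_power R n0)"
    using minimal_cover[OF M] by auto
  let ?V0 = "(free_power R n0)\<lparr>carrier := {v \<in> carrier (free_power R n0). \<phi>0 v = \<zero>\<^bsub>M\<^esub>}\<rparr>"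
  have mM: "module R M" using M by (simp add: fg_module_def)
  have ex: "\<exists>s. good s \<and> fst s = V" if "fg_module R V" for V :: "('a, nat \<Rightarrow> 'a) module"
    using minimal_cover[OF that] that by (auto simp: good_def)
  have next_fg: "fg_module R (ker s)" if "good s" for s
    using that by (auto simp: good_def ker_def fg_module_def intro!: fg_module_kernel[unfolded fg_module_def])
  have "\<exists>f. \<forall>k. (good (f k) \<and> (k = 0 \<longrightarrow> fst (f k) = ?V0)) \<and> fst (f (Suc k)) = ker (f k)"
  proof (rule dependent_nat_choice)
    show "\<exists>s. good s \<and> (0 = (0::nat) \<longrightarrow> fst s = ?V0)"
      using ex[OF fg_module_kernel[OF mM 0(1)]] by auto
    show "\<exists>y. (good y \<and> (Suc k = 0 \<longrightarrow> fst y = ?V0)) \<and> fst y = ker s"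
      if "good s \<and> (k = 0 \<longrightarrow> fst s = ?V0)" for s k
      using ex[OF next_fg] that by auto
  qed
  then obtain f where f: "\<And>k. good (f k)" "fst (f 0) = ?V0" "\<And>k. fst (f (Suc k)) = ker (f k)" by blast
  define V where "V k = fst (f k)" for k
  define num where "num k = fst (snd (f k))" for k
  define \<phi> where "\<phi> k = snd (snd (f k))" for k
  have fk: "f k = (V k, num k, \<phi> k)" for k by (simp add: V_def num_def \<phi>_def)
  have g: "fg_module R (V k)" "\<phi> k \<in> mod_hom R (free_power R (num k)) (V k)"
    "\<phi> k ` carrier (free_power R (num k)) = carrier (V k)"
    "{v \<in> carrier (free_power R (num k)). \<phi> k v = \<zero>\<^bsub>V k\<^esub>} \<subseteq> ideal_smult \<mm> (free_power R (num k))" for k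
    using f(1)[of k] unfolding fk good_def by auto
  have V0: "V 0 = ?V0" using f(2) by (simp add: V_def)
  have VS: "V (Suc k) = (free_power R (num k))\<lparr>carrier := {v \<in> carrier (free_power R (num k)). \<phi> k v = \<zero>\<^bsub>V k\<^esub>}\<rparr>" for k
    using f(3)[of k] unfolding fk by (simp add: ker_def)
  \<comment> \<open>A shift by one: state k covers syzygy k + 1, so R^(num k) sits in degree k + 1
    and \<open>\<phi> k\<close> is the differential leaving that degree.\<close>
  let ?n = "\<lambda>i. case i of 0 \<Rightarrow> n0 | Suc k \<Rightarrow> num k"
  define P :: "('a, nat \<Rightarrow> 'a, 'm) resolution" where
    "P = \<lparr>obj = (\<lambda>i. free_power R (?n i)), diff = (\<lambda>i. \<phi> (i - 1)), aug = \<phi>0\<rparr>"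
  have Vsub: "V k = (free_power R (?n k))\<lparr>carrier := carrier (V k)\<rparr>"
    "carrier (V k) \<subseteq> carrier (free_power R (?n k))" "\<zero>\<^bsub>V k\<^esub> = \<zero>\<^bsub>free_power R (?n k)\<^esub>"
    "x \<oplus>\<^bsub>V k\<^esub> y = x \<oplus>\<^bsub>free_power R (?n k)\<^esub> y" "r \<odot>\<^bsub>V k\<^esub> x = r \<odot>\<^bsub>free_power R (?n k)\<^esub> x" for k x y r
    by (cases k; auto simp: V0 VS)+
  have \<phi>_hom: "\<phi> k \<in> mod_hom R (free_power R (num k)) (free_power R (?n k))" for k
  proof (rule mod_homI)
    fix x assume x: "x \<in> carrier (free_power R (num k))"
    show "\<phi> k x \<in> carrier (free_power R (?n k))" using mod_hom_closed[OF g(2) x] Vsub(2) by (rule subsetD[rotated])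
    show "\<phi> k (x \<oplus>\<^bsub>free_power R (num k)\<^esub> y) = \<phi> k x \<oplus>\<^bsub>free_power R (?n k)\<^esub> \<phi> k y"
      if "y \<in> carrier (free_power R (num k))" for y
      using mod_hom_add[OF g(2) x that] Vsub(4) by simp
    show "\<phi> k (r \<odot>\<^bsub>free_power R (num k)\<^esub> x) = r \<odot>\<^bsub>free_power R (?n k)\<^esub> \<phi> k x"
      if "r \<in> carrier R" for r
      using mod_hom_smult[OF g(2) that x] Vsub(5) by simp
  qed
  have ker_eq: "carrier (V (Suc k)) = a_kernel (free_power R (num k)) (free_power R (?n k)) (\<phi> k)" for k
    by (simp add: VS a_kernel_def' Vsub(3))
  have "resolution_of R M P"
    unfolding resolution_of_def
    using module_free_power \<phi>_hom 0 g(3) ker_eq by (auto simp: P_def V0 a_kernel_def')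
  moreover have "\<phi> k ` carrier (free_power R (num k)) \<subseteq> ideal_smult \<mm> (free_power R (?n k))" for k
    using g(3,4) 0(3) by (cases k) (auto simp: V0 VS)
  ultimately show ?thesis
    unfolding minimal_free_resolution_def fg_free_resolution_def m
    using fg_free_module_free_power by (intro exI[of _ P]) (auto simp: P_def)
qed

end

section \<open>Local rings whose maximal ideal is a direct sum of two ideals\<close>

text \<open>All that is retained of the fiber product. In the application \<open>I\<close> is the
  maximal ideal of S times 0 and \<open>J\<close> is 0 times that of T. The conditions are symmetric
  in \<open>I\<close> and \<open>J\<close>, so \<open>swap\<close> yields the mirror image of every
  result.\<close>

locale fiber_ring = local_ring_at R \<mm> for R (structure) and \<mm> +
  fixes I J :: "'a set"
  assumes ideal_I: "ideal I R" and ideal_J: "ideal J R"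
    and I_Int_J: "I \<inter> J = {\<zero>}" and I_subset: "I \<subseteq> \<mm>" and J_subset: "J \<subseteq> \<mm>"
    and decompose: "r \<in> \<mm> \<Longrightarrow> \<exists>a\<in>I. \<exists>b\<in>J. r = a \<oplus> b"
    and I_nonzero: "I \<noteq> {\<zero>}" and J_nonzero: "J \<noteq> {\<zero>}"

lemma (in abelian_group) add_minus_cancel_left:
  assumes "p \<in> carrier G" "q \<in> carrier G"
  shows "(p \<oplus> q) \<ominus> p = q"
  using add_minus_add_cancel[OF assms(1,2) zero_closed] assms by (simp add: a_minus_def)

lemma (in fiber_ring) swap: "fiber_ring R \<mm> J I"
proof (intro fiber_ring.intro local_ring_at_axioms fiber_ring_axioms.intro ideal_J ideal_I
    J_subset I_subset J_nonzero I_nonzero)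
  show "J \<inter> I = {\<zero>}" using I_Int_J by (simp only: Int_commute)
  show "\<exists>a\<in>J. \<exists>b\<in>I. r = a \<oplus> b" if r: "r \<in> \<mm>" for r
  proof -
    obtain a b where ab: "a \<in> I" "b \<in> J" "r = a \<oplus> b" using decompose[OF r] by auto
    then have "r = b \<oplus> a" using I_subset J_subset m_subset by (auto intro!: a_comm)
    then show ?thesis using ab by blast
  qed
qed

context fiber_ring
begin

lemma I_carrier: "a \<in> I \<Longrightarrow> a \<in> carrier R" and J_carrier: "b \<in> J \<Longrightarrow> b \<in> carrier R"
  using I_subset J_subset m_subset by auto

lemma I_mult_J: "a \<in> I \<Longrightarrow> b \<in> J \<Longrightarrow> a \<otimes> b = \<zero>"
  using I_Int_J ideal.I_r_closed[OF ideal_I] ideal.I_l_closed[OF ideal_J] I_carrier J_carrier by blast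

text \<open>Decomposing the second factor of each product writes an element of the square of
  \<open>\<mm>\<close> as y + z with y in \<open>I\<close> and z in \<open>\<mm>\<close> times
  \<open>J\<close>. If the element is in \<open>J\<close>, then y is in both ideals and
  vanishes.\<close>

lemma m_square_Int_J:
  assumes "x \<in> smult_span (self_module R) \<mm> \<mm>" "x \<in> J"
  shows "x \<in> smult_span (self_module R) \<mm> J"
proof -
  interpret S: plain_module R "self_module R" by (rule plain_module[OF module_self_module])
  have J: "submodule J R (self_module R)" using ideal_J by (simp add: submodule_self_module_iff)
  have Jc: "J \<subseteq> carrier (self_module R)" using J_carrier by auto
  note sJ = S.submodule_smult_span[OF ideal_m Jc]
  have mJ: "smult_span (self_module R) \<mm> J \<subseteq> J"
  proof
    fix y assume "y \<in> smult_span (self_module R) \<mm> J"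
    then show "y \<in> J"
      using additive_subgroup.zero_closed[OF ideal.axioms(1)[OF ideal_J]]
        additive_subgroup.a_closed[OF ideal.axioms(1)[OF ideal_J]] ideal.I_l_closed[OF ideal_J] m_subset
      by induct auto
  qed
  have "\<exists>y\<in>I. \<exists>z\<in>smult_span (self_module R) \<mm> J. x = y \<oplus> z"
    using assms(1)
  proof induct
    case zero
    have "\<zero> \<in> I" using additive_subgroup.zero_closed[OF ideal.axioms(1)[OF ideal_I]] .
    then show ?case using S.submodule_zero[OF sJ] by (intro bexI[of _ \<zero>]) auto
  next
    case (step a b x)
    then obtain y z where yz: "y \<in> I" "z \<in> smult_span (self_module R) \<mm> J" "x = y \<oplus> z" by auto
    obtain i j where ij: "i \<in> I" "j \<in> J" "b = i \<oplus> j" using decompose[OF step(2)] by auto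
    have cl: "a \<in> carrier R" "i \<in> carrier R" "j \<in> carrier R" "y \<in> carrier R" "z \<in> carrier R"
      using step(1) m_subset ij I_carrier J_carrier yz mJ by auto
    have "a \<otimes> b \<oplus> x = (a \<otimes> i \<oplus> y) \<oplus> (a \<otimes> j \<oplus> z)"
      unfolding ij(3) yz(3) using cl by (simp add: r_distr a_ac)
    moreover have "a \<otimes> i \<oplus> y \<in> I"
      using ideal.I_l_closed[OF ideal_I ij(1) cl(1)] yz(1)
        additive_subgroup.a_closed[OF ideal.axioms(1)[OF ideal_I]] by auto
    moreover have "a \<otimes> j \<oplus> z \<in> smult_span (self_module R) \<mm> J"
      using smult_span.step[OF step(1) ij(2) yz(2)] by simp
    ultimately show ?case by auto
  qed
  then obtain y z where yz: "y \<in> I" "z \<in> smult_span (self_module R) \<mm> J" "x = y \<oplus> z" by auto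
  have cl: "y \<in> carrier R" "z \<in> carrier R" "z \<in> J" using yz I_carrier J_carrier mJ by auto
  have "y = x \<ominus> z" using cl yz(3) by (simp add: a_minus_def a_assoc r_neg)
  also have "\<dots> \<in> J"
    using assms(2) cl(3) additive_subgroup.a_closed[OF ideal.axioms(1)[OF ideal_J]]
      additive_subgroup.a_inv_closed[OF ideal.axioms(1)[OF ideal_J]] by (simp add: a_minus_def)
  finally have "y = \<zero>" using yz(1) I_Int_J by auto
  then show ?thesis using yz(2,3) cl by simp
qed

lemma J_not_m_J: "\<not> J \<subseteq> smult_span (self_module R) \<mm> J"
proof
  assume sub: "J \<subseteq> smult_span (self_module R) \<mm> J"
  interpret S: plain_module R "self_module R" by (rule plain_module[OF module_self_module])
  obtain A where A: "finite A" "A \<subseteq> J" "J = lin_span R (self_module R) A"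
    using ideal_finitely_spanned[OF is_cring noetherian_ring_axioms ideal_J] by blast
  have "A \<subseteq> carrier (self_module R)" using A(2) J_carrier by auto
  from S.nakayama[OF ideal_m one_minus_unit A(1) this] sub have "J = {\<zero>}"
    unfolding A(3)[symmetric] by simp
  then show False using J_nonzero by simp
qed

end

section \<open>The parts of a free module, and of a kernel, belonging to I and J\<close>

locale fiber_ring_module = fiber_ring R \<mm> I J + finite_basis R V B
  for R :: "('a, 'x) ring_scheme" (structure) and \<mm> I J and V :: "('a, 'm) module" (structure) and B
begin

abbreviation part :: "'a set \<Rightarrow> 'm set" where
  "part H \<equiv> smult_span V H (carrier V)"

lemma part_Int: "part I \<inter> part J = {\<zero>\<^bsub>V\<^esub>}"
proof -
  have "x = \<zero>\<^bsub>V\<^esub>" if x: "x \<in> part I" "x \<in> part J" for x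
  proof -
    have xV: "x \<in> carrier V" using x smult_span_closed[of I "carrier V"] I_carrier by auto
    show ?thesis
    proof (rule coords_eqI[OF xV M.zero_closed])
      fix b assume b: "b \<in> B"
      then have "coords x b \<in> I \<inter> J"
        using x in_smult_span_iff[OF ideal_I xV] in_smult_span_iff[OF ideal_J xV] by auto
      then show "coords x b = coords \<zero>\<^bsub>V\<^esub> b" using I_Int_J b by (auto simp: coords_zero)
    qed
  qed
  then show ?thesis by (auto intro: smult_span.zero)
qed

lemma I_smult_part_J:
  assumes "a \<in> I" "x \<in> part J"
  shows "a \<odot>\<^bsub>V\<^esub> x = \<zero>\<^bsub>V\<^esub>"
proof -
  have xV: "x \<in> carrier V" using assms smult_span_closed[of J "carrier V"] J_carrier by auto
  have a: "a \<in> carrier R" using assms I_carrier by auto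
  show ?thesis
  proof (rule coords_eqI[OF smult_closed[OF a xV] M.zero_closed])
    fix b assume b: "b \<in> B"
    then have "coords x b \<in> J" using assms in_smult_span_iff[OF ideal_J xV] by auto
    then show "coords (a \<odot>\<^bsub>V\<^esub> x) b = coords \<zero>\<^bsub>V\<^esub> b"
      using assms b a xV I_mult_J by (simp add: coords_smult coords_zero)
  qed
qed

lemma part_decompose:
  assumes "x \<in> part \<mm>"
  shows "\<exists>y\<in>part I. \<exists>z\<in>part J. x = y \<oplus>\<^bsub>V\<^esub> z"
  using assms
proof induct
  case zero
  show ?case by (intro bexI[of _ "\<zero>\<^bsub>V\<^esub>"] smult_span.zero) simp
next
  case (step a v x)
  have Vc: "part I \<subseteq> carrier V" "part J \<subseteq> carrier V"
    using smult_span_closed[OF _ order_refl] I_carrier J_carrier by (simp_all add: subsetI)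
  obtain y z where yz: "y \<in> part I" "z \<in> part J" "x = y \<oplus>\<^bsub>V\<^esub> z" using step by auto
  obtain i j where ij: "i \<in> I" "j \<in> J" "a = i \<oplus>\<^bsub>R\<^esub> j" using decompose[OF step(1)] by auto
  have "a \<odot>\<^bsub>V\<^esub> v \<oplus>\<^bsub>V\<^esub> x = (i \<odot>\<^bsub>V\<^esub> v \<oplus>\<^bsub>V\<^esub> y) \<oplus>\<^bsub>V\<^esub> (j \<odot>\<^bsub>V\<^esub> v \<oplus>\<^bsub>V\<^esub> z)"
    unfolding ij(3) yz(3) using ij I_carrier J_carrier step(2) yz Vc
    by (simp add: smult_l_distr M.a_ac subset_iff)
  then show ?case using ij yz step(2) by (blast intro: smult_span.step)
qed

end

locale fiber_ring_kernel = V: fiber_ring_module R \<mm> I J V B + W: fiber_ring_module R \<mm> I J W B'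
  for R :: "('a, 'x) ring_scheme" (structure) and \<mm> I J and V :: "('a, 'm) module" and B and W :: "('a, 'n) module" and B' +
  fixes d :: "'m \<Rightarrow> 'n" and K :: "'m set"
  assumes d: "d \<in> mod_hom R V W"
    and K: "K = {x \<in> carrier V. d x = \<zero>\<^bsub>W\<^esub>}"
    and K_minimal: "K \<subseteq> V.part \<mm>"
begin

lemma submodule_K: "submodule K R V"
  unfolding K by (rule submodule_kernel[OF V.module_axioms W.module_axioms d])

text \<open>A linear map respects the parts. If y + z is killed, then d y = - d z lies in both parts
  of W, which meet in 0; so y and z are killed separately.\<close>

lemma K_decompose:
  assumes "x \<in> K"
  shows "\<exists>y\<in>K \<inter> V.part I. \<exists>z\<in>K \<inter> V.part J. x = y \<oplus>\<^bsub>V\<^esub> z"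
proof -
  obtain y z where yz: "y \<in> V.part I" "z \<in> V.part J" "x = y \<oplus>\<^bsub>V\<^esub> z"
    using V.part_decompose K_minimal assms by blast
  have I: "I \<subseteq> carrier R" and J: "J \<subseteq> carrier R" using V.I_carrier V.J_carrier by auto
  have V: "y \<in> carrier V" "z \<in> carrier V"
    using yz V.smult_span_closed[OF I] V.smult_span_closed[OF J] by auto
  have im: "d ` carrier V \<subseteq> carrier W" using mod_hom_closed[OF d] by auto
  have dy: "d y \<in> W.part I" and dz: "d z \<in> W.part J"
    using smult_span_mod_hom[OF V.module_axioms W.module_axioms d I order_refl im yz(1)]
      smult_span_mod_hom[OF V.module_axioms W.module_axioms d J order_refl im yz(2)] by auto
  have c: "d y \<in> carrier W" "d z \<in> carrier W" using V im by auto
  have "d y \<oplus>\<^bsub>W\<^esub> d z = \<zero>\<^bsub>W\<^esub>" using assms yz(3) mod_hom_add[OF d V] unfolding K by simp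
  then have "d y = \<ominus>\<^bsub>W\<^esub> d z" using c by (simp add: W.M.minus_equality)
  also have "\<dots> \<in> W.part J"
    using dz by (rule W.submodule_uminus[OF W.submodule_smult_span[OF V.ideal_J order_refl]])
  finally have 0: "d y = \<zero>\<^bsub>W\<^esub>" using dy W.part_Int by auto
  then have "d z = \<zero>\<^bsub>W\<^esub>" using \<open>d y \<oplus>\<^bsub>W\<^esub> d z = \<zero>\<^bsub>W\<^esub>\<close> c by simp
  then show ?thesis using yz V 0 unfolding K by blast
qed

text \<open>Let A be the I-part of \<open>K\<close>. By \<open>K_decompose\<close>, an element of
  \<open>\<mm>\<close> times \<open>K\<close> is the sum of one in \<open>\<mm>\<close> times A and
  one in the J-part of V. For an element of A the second summand lies in both parts and vanishes, so
  A is contained in \<open>\<mm>\<close> times A.\<close>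

lemma K_nakayama:
  assumes sub: "K \<inter> V.part I \<subseteq> smult_span V \<mm> K"
  shows "K \<inter> V.part I = {\<zero>\<^bsub>V\<^esub>}"
proof (rule V.submodule_nakayama[OF V.finite_basis_axioms])
  let ?A = "K \<inter> V.part I"
  have I: "I \<subseteq> carrier R" and J: "J \<subseteq> carrier R" using V.I_carrier V.J_carrier by auto
  note sI = V.submodule_smult_span[OF V.ideal_I order_refl] and sJ = V.submodule_smult_span[OF V.ideal_J order_refl]
  show A: "submodule ?A R V" by (rule V.submodule_Int[OF submodule_K sI])
  have Ac: "?A \<subseteq> carrier V" by (rule V.submodule_subset[OF A])
  note sA = V.submodule_smult_span[OF V.ideal_m Ac]
  have AI: "smult_span V \<mm> ?A \<subseteq> V.part I"
  proof
    fix y assume "y \<in> smult_span V \<mm> ?A"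
    then show "y \<in> V.part I"
      by induct (use V.submodule_zero[OF sI] V.submodule_add[OF sI] V.submodule_smult[OF sI] V.m_subset in auto)
  qed
  have Jc: "V.part J \<subseteq> carrier V" by (rule V.submodule_subset[OF sJ])
  have split: "\<exists>y\<in>smult_span V \<mm> ?A. \<exists>z\<in>V.part J. x = y \<oplus>\<^bsub>V\<^esub> z" if "x \<in> smult_span V \<mm> K" for x
    using that
  proof induct
    case zero
    show ?case by (intro bexI[of _ "\<zero>\<^bsub>V\<^esub>"] smult_span.zero) simp
  next
    case (step a k x)
    obtain y z where yz: "y \<in> smult_span V \<mm> ?A" "z \<in> V.part J" "x = y \<oplus>\<^bsub>V\<^esub> z" using step by auto
    obtain i j where ij: "i \<in> ?A" "j \<in> K \<inter> V.part J" "k = i \<oplus>\<^bsub>V\<^esub> j" using K_decompose[OF step(2)] by auto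
    have a: "a \<in> carrier R" using step V.m_subset by auto
    have cl: "i \<in> carrier V" "j \<in> carrier V" "y \<in> carrier V" "z \<in> carrier V"
      using ij yz Ac Jc V.submodule_subset[OF sA] by auto
    have "a \<odot>\<^bsub>V\<^esub> k \<oplus>\<^bsub>V\<^esub> x = (a \<odot>\<^bsub>V\<^esub> i \<oplus>\<^bsub>V\<^esub> y) \<oplus>\<^bsub>V\<^esub> (a \<odot>\<^bsub>V\<^esub> j \<oplus>\<^bsub>V\<^esub> z)"
      unfolding ij(3) yz(3) using a cl by (simp add: V.smult_r_distr V.M.a_ac)
    moreover have "a \<odot>\<^bsub>V\<^esub> j \<oplus>\<^bsub>V\<^esub> z \<in> V.part J"
      using ij yz a by (intro V.submodule_add[OF sJ] V.submodule_smult[OF sJ]) auto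
    ultimately show ?case using smult_span.step[OF step(1) ij(1) yz(1)] by blast
  qed
  show "?A \<subseteq> smult_span V \<mm> ?A"
  proof
    fix x assume x: "x \<in> ?A"
    obtain y z where yz: "y \<in> smult_span V \<mm> ?A" "z \<in> V.part J" "x = y \<oplus>\<^bsub>V\<^esub> z"
      using split sub x by blast
    have cl: "y \<in> carrier V" "z \<in> carrier V" using yz Jc V.submodule_subset[OF sA] by auto
    have "z = x \<ominus>\<^bsub>V\<^esub> y" using yz(3) cl by (simp add: V.M.add_minus_cancel_left)
    also have "\<dots> \<in> V.part I" using x yz(1) AI by (intro V.submodule_minus[OF sI]) auto
    finally have "z = \<zero>\<^bsub>V\<^esub>" using yz(2) V.part_Int by auto
    then show "x \<in> smult_span V \<mm> ?A" using yz cl by simp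
  qed
qed

end

section \<open>Minimal resolutions and their orthogonal cycles\<close>

locale minimal_resolution = fiber_ring R \<mm> I J + free_resolution R M P B
  for R :: "('a, 'x) ring_scheme" (structure) and \<mm> I J and M :: "('a, 'm) module" and P :: "('a, 'f, 'm) resolution" and B +
  assumes minimal: "diff P (Suc i) ` carrier (obj P (Suc i)) \<subseteq> smult_span (obj P i) \<mm> (carrier (obj P i))"
begin

lemma swap_minimal_resolution: "minimal_resolution R \<mm> J I M P B"
  by (intro minimal_resolution.intro swap free_resolution_axioms minimal_resolution_axioms.intro minimal)

text \<open>Syzygy i + 2 inside the term of degree i + 1: \<open>cycles 0\<close> is the second
  syzygy and \<open>cycles 1\<close> the third.\<close>

definition cycles :: "nat \<Rightarrow> 'f set" where
  "cycles i = {x \<in> carrier (obj P (Suc i)). diff P (Suc i) x = \<zero>\<^bsub>obj P i\<^esub>}"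

lemma cycles_image: "cycles i = diff P (Suc (Suc i)) ` carrier (obj P (Suc (Suc i)))"
  unfolding diff_exact cycles_def by (simp add: a_kernel_def')

sublocale Z: fiber_ring_kernel R \<mm> I J "obj P (Suc i)" "B (Suc i)" "obj P i" "B i" "diff P (Suc i)" "cycles i" for i
proof (intro fiber_ring_kernel.intro fiber_ring_module.intro fiber_ring_axioms basis fiber_ring_kernel_axioms.intro)
  show "cycles i \<subseteq> smult_span (obj P (Suc i)) \<mm> (carrier (obj P (Suc i)))"
    unfolding cycles_image by (rule minimal)
qed (use diff in \<open>auto simp: cycles_def\<close>)

text \<open>Read contrapositively: every lift of a cycle outside \<open>\<mm>\<close> times the
  cycles lies outside \<open>\<mm>\<close> times the free module, so it has a unit among its
  coordinates.\<close>

lemma image_m_cycles: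
  assumes "u \<in> smult_span (obj P (Suc (Suc i))) \<mm> (carrier (obj P (Suc (Suc i))))"
  shows "diff P (Suc (Suc i)) u \<in> smult_span (obj P (Suc i)) \<mm> (cycles i)"
  using assms unfolding cycles_image
  by (intro smult_span_mod_hom[OF obj obj diff m_subset order_refl order_refl])

end

text \<open>The assumption \<open>exact\<close> is vanishing of the homology of M tensor Q in degree
  5, the form that Tor takes after balancing.\<close>

locale minimal_resolution_pair = F: minimal_resolution R \<mm> I J M P B + L: minimal_resolution R \<mm> I J N Q C
  for R :: "('a, 'x) ring_scheme" (structure) and \<mm> I J and M :: "('a, 'm) module" and P :: "('a, 'f, 'm) resolution" and B
    and N :: "('a, 'n) module" and Q :: "('a, 'g, 'n) resolution" and C +
  assumes exact: "z \<in> carrier (power_module (C 5) M) \<Longrightarrow> L.delta M 4 z = \<zero>\<^bsub>power_module (C 4) M\<^esub> \<Longrightarrow>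
      \<exists>y\<in>carrier (power_module (C 6) M). L.delta M 5 y = z"
begin

sublocale resolution_pair R M P B N Q C by unfold_locales

text \<open>The ideals are exchanged but the modules are kept, because \<open>exact\<close> does not
  treat M and N alike.\<close>

lemma swap_pair: "minimal_resolution_pair R \<mm> J I M P B N Q C"
  by (intro minimal_resolution_pair.intro F.swap_minimal_resolution L.swap_minimal_resolution
      minimal_resolution_pair_axioms.intro exact)

lemma coords_orthogonal:
  assumes "u \<in> smult_span (obj P i) H (carrier (obj P i))" "x \<in> smult_span (obj Q m) H' (carrier (obj Q m))"
    and HH: "H = I \<and> H' = J \<or> H = J \<and> H' = I" and c: "c \<in> C m"
  shows "L.F.coords m x c \<odot>\<^bsub>obj P i\<^esub> u = \<zero>\<^bsub>obj P i\<^esub>"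
proof -
  interpret F2: fiber_ring_module R \<mm> J I "obj P i" "B i"
    by (intro fiber_ring_module.intro F.swap F.basis)
  have H': "ideal H' R" "H' \<subseteq> carrier R" using HH F.ideal_I F.ideal_J F.I_carrier F.J_carrier by auto
  have "x \<in> carrier (obj Q m)" using assms(2) L.F.smult_span_closed[OF H'(2) order_refl] by auto
  then have "L.F.coords m x c \<in> H'" using assms(2) L.F.in_smult_span_iff[OF H'(1)] c by auto
  then show ?thesis using HH assms(1) F.Z.W.I_smult_part_J F2.I_smult_part_J by auto
qed

text \<open>For orthogonal cycles \<open>u = d u'\<close> and \<open>x = d x'\<close>, the tensor \<open>u' \<otimes> x'\<close> starts the chase
  that ends in a cycle of degree 5; exactness there makes \<open>u' \<otimes> x'\<close> a boundary, and boundaries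
  have coefficients in the maximal ideal.\<close>

lemma orthogonal_cycles:
  assumes im: "i + m = 1" and u: "u \<in> F.cycles i" and x: "x \<in> L.cycles m"
    and H: "u \<in> smult_span (obj P (Suc i)) H (carrier (obj P (Suc i)))"
      "x \<in> smult_span (obj Q (Suc m)) H' (carrier (obj Q (Suc m)))"
      "H = I \<and> H' = J \<or> H = J \<and> H' = I"
  shows "u \<in> smult_span (obj P (Suc i)) \<mm> (F.cycles i) \<or> x \<in> smult_span (obj Q (Suc m)) \<mm> (L.cycles m)"
proof -
  let ?V = "obj P (Suc (Suc i))" and ?W = "obj Q (Suc (Suc m))"
  obtain u' where u': "u' \<in> carrier ?V" "u = diff P (Suc (Suc i)) u'" using u by (auto simp: F.cycles_image)
  obtain x' where x': "x' \<in> carrier ?W" "x = diff Q (Suc (Suc m)) x'" using x by (auto simp: L.cycles_image)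
  show ?thesis
  \<comment> \<open>Either all coordinates of x' lie in \<open>\<mm>\<close>, which settles x, or
    there is a unit coordinate by which the boundary formula for u' can be divided.\<close>
  proof (cases "\<forall>c\<in>C (Suc (Suc m)). L.F.coords (Suc (Suc m)) x' c \<in> \<mm>")
    case True
    then have "x' \<in> smult_span ?W \<mm> (carrier ?W)" using L.F.in_smult_span_iff[OF F.ideal_m x'(1)] by simp
    then show ?thesis unfolding x'(2) by (intro disjI2 L.image_m_cycles)
  next
    case False
    then obtain c where c: "c \<in> C (Suc (Suc m))" "L.F.coords (Suc (Suc m)) x' c \<notin> \<mm>" by auto
    let ?s = "L.F.coords (Suc (Suc m)) x' c"
    have s: "?s \<in> Units R" using c L.F.coords_closed[OF x'(1)] by (intro F.units) auto
    have "\<exists>a\<in>carrier (obj P (Suc (Suc (Suc i)))). \<exists>b\<in>C (Suc (Suc (Suc m))) \<rightarrow> carrier ?V.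
      ?s \<odot>\<^bsub>?V\<^esub> u' = diff P (Suc (Suc (Suc i))) a \<oplus>\<^bsub>?V\<^esub>
        lin_comb ?V (C (Suc (Suc (Suc m)))) (\<lambda>c'. L.diff_matrix (Suc (Suc m)) c' c) b"
    \<comment> \<open>The tensor u' by x' has degree (i + 2) + (m + 2) = 5, one more than n.\<close>
    proof (rule elementary_tensor_boundary[where n = 4, OF _ _ u'(1) x'(1) _ c(1)])
      show "\<exists>y\<in>carrier (power_module (C (Suc (Suc 4))) M). L.delta M (Suc 4) y = z"
        if "z \<in> carrier (power_module (C (Suc 4)) M)" "L.delta M 4 z = \<zero>\<^bsub>power_module (C 4) M\<^esub>" for z
        using exact[of z] that by simp
      show "Suc (Suc i) + Suc m = 4" using im by simp
      show "L.F.coords (Suc m) (diff Q (Suc (Suc m)) x') c \<odot>\<^bsub>obj P (Suc i)\<^esub> diff P (Suc (Suc i)) u' =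
          \<zero>\<^bsub>obj P (Suc i)\<^esub>" if "c \<in> C (Suc m)" for c
        using coords_orthogonal[OF H that] u'(2) x'(2) by simp
    qed
    then obtain a b where a: "a \<in> carrier (obj P (Suc (Suc (Suc i))))"
      and b: "b \<in> C (Suc (Suc (Suc m))) \<rightarrow> carrier ?V"
      and eq: "?s \<odot>\<^bsub>?V\<^esub> u' = diff P (Suc (Suc (Suc i))) a \<oplus>\<^bsub>?V\<^esub>
        lin_comb ?V (C (Suc (Suc (Suc m)))) (\<lambda>c'. L.diff_matrix (Suc (Suc m)) c' c) b" by blast
    note sm = F.F.submodule_smult_span[OF F.ideal_m order_refl, of "Suc (Suc i)"]
    have D: "L.diff_matrix (Suc (Suc m)) c' c \<in> \<mm>" if c': "c' \<in> C (Suc (Suc (Suc m)))" for c'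
    proof -
      have d: "diff Q (Suc (Suc (Suc m))) c' \<in> carrier ?W"
        using c' L.F.basis_closed mod_hom_closed[OF L.diff] by blast
      have "diff Q (Suc (Suc (Suc m))) c' \<in> smult_span ?W \<mm> (carrier ?W)"
        using c' L.F.basis_closed L.minimal by blast
      then show ?thesis
        using L.F.in_smult_span_iff[OF F.ideal_m d] c(1) by (simp add: L.diff_matrix_def)
    qed
    have "diff P (Suc (Suc (Suc i))) a \<in> smult_span ?V \<mm> (carrier ?V)"
      using a F.minimal by blast
    moreover have "lin_comb ?V (C (Suc (Suc (Suc m)))) (\<lambda>c'. L.diff_matrix (Suc (Suc m)) c' c) b
        \<in> smult_span ?V \<mm> (carrier ?V)"
      using D b L.F.finite_basis by (intro F.F.lin_comb_in_smult_span[OF F.ideal_m order_refl]) auto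
    ultimately have "?s \<odot>\<^bsub>?V\<^esub> u' \<in> smult_span ?V \<mm> (carrier ?V)"
      unfolding eq by (rule F.F.submodule_add[OF sm])
    then have "inv ?s \<odot>\<^bsub>?V\<^esub> (?s \<odot>\<^bsub>?V\<^esub> u') \<in> smult_span ?V \<mm> (carrier ?V)"
      by (rule F.F.submodule_smult[OF sm F.Units_inv_closed[OF s]])
    also have "inv ?s \<odot>\<^bsub>?V\<^esub> (?s \<odot>\<^bsub>?V\<^esub> u') = u'"
      using F.F.smult_assoc1[OF F.Units_inv_closed[OF s] F.Units_closed[OF s] u'(1)]
        F.Units_l_inv[OF s] F.F.smult_one[OF u'(1)] by simp
    finally show ?thesis unfolding u'(2) by (intro disjI1 F.image_m_cycles)
  qed
qed

text \<open>Let a = d a' and x be witnesses; a' has a unit coordinate s. For t in \<open>J\<close>,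
  t a is 0, so t a' is a third syzygy in the J-part and is orthogonal to x. Hence t a' lies in
  \<open>\<mm>\<close> times the third syzygy, and its coordinate t s lies in the square of
  \<open>\<mm>\<close>. So \<open>J\<close> is contained in \<open>\<mm>\<close> times
  \<open>J\<close>, which Nakayama's lemma forbids for a nonzero ideal.\<close>

lemma not_both_I_parts:
  assumes "\<not> F.cycles 0 \<inter> F.Z.V.part 0 I \<subseteq> smult_span (obj P (Suc 0)) \<mm> (F.cycles 0)"
    and "\<not> L.cycles 0 \<inter> L.Z.V.part 0 I \<subseteq> smult_span (obj Q (Suc 0)) \<mm> (L.cycles 0)"
  shows False
proof -
  let ?V = "obj P (Suc (Suc 0))"
  interpret S: plain_module R "self_module R" by (rule plain_module[OF F.module_self_module])
  obtain a where a: "a \<in> F.cycles 0" "a \<in> F.Z.V.part 0 I" "a \<notin> smult_span (obj P (Suc 0)) \<mm> (F.cycles 0)"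
    using assms(1) by auto
  obtain x where x: "x \<in> L.cycles 0" "x \<in> L.Z.V.part 0 I" "x \<notin> smult_span (obj Q (Suc 0)) \<mm> (L.cycles 0)"
    using assms(2) by auto
  obtain a' where a': "a' \<in> carrier ?V" "a = diff P (Suc (Suc 0)) a'" using a(1) by (auto simp: F.cycles_image)
  have "a' \<notin> smult_span ?V \<mm> (carrier ?V)" using a(3) F.image_m_cycles unfolding a'(2) by blast
  then obtain b where b: "b \<in> B (Suc (Suc 0))" "F.F.coords (Suc (Suc 0)) a' b \<notin> \<mm>"
    using F.F.in_smult_span_iff[OF F.ideal_m a'(1)] by auto
  let ?s = "F.F.coords (Suc (Suc 0)) a' b"
  have s: "?s \<in> Units R" using b F.F.coords_closed[OF a'(1)] by (intro F.units) auto
  interpret F2: fiber_ring_module R \<mm> J I "obj P (Suc 0)" "B (Suc 0)"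
    by (intro fiber_ring_module.intro F.swap F.basis)
  note sq = S.submodule_smult_span[OF F.ideal_m, of \<mm>]
  have "t \<in> smult_span (self_module R) \<mm> J" if t: "t \<in> J" for t
  proof -
    have tR: "t \<in> carrier R" using t F.J_carrier by auto
    let ?u = "t \<odot>\<^bsub>?V\<^esub> a'"
    have "diff P (Suc (Suc 0)) ?u = t \<odot>\<^bsub>obj P (Suc 0)\<^esub> a"
      using mod_hom_smult[OF F.diff tR a'(1)] a'(2) by simp
    also have "\<dots> = \<zero>\<^bsub>obj P (Suc 0)\<^esub>" using F2.I_smult_part_J[OF t a(2)] .
    finally have u: "?u \<in> F.cycles (Suc 0)" using tR a'(1) by (simp add: F.cycles_def)
    have uJ: "?u \<in> smult_span ?V J (carrier ?V)"
      using F.J_carrier t a'(1) by (intro F.F.smult_span_incl) auto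
    \<comment> \<open>The other alternative of \<open>orthogonal_cycles\<close> is excluded by the
      choice of x.\<close>
    have "?u \<in> smult_span ?V \<mm> (F.cycles (Suc 0))"
      using orthogonal_cycles[of "Suc 0" 0 ?u x J I] u uJ x by auto
    then have "F.F.coords (Suc (Suc 0)) ?u b \<in> smult_span (self_module R) \<mm> \<mm>"
    proof (rule smult_span_mod_hom[OF F.obj F.module_self_module F.F.coords_mod_hom[OF b(1)] F.m_subset, rotated 2])
      show K: "F.cycles (Suc 0) \<subseteq> carrier ?V" by (auto simp: F.cycles_def)
      show "(\<lambda>x. F.F.coords (Suc (Suc 0)) x b) ` F.cycles (Suc 0) \<subseteq> \<mm>"
        using F.Z.K_minimal[of "Suc 0"] F.F.in_smult_span_iff[OF F.ideal_m] K b(1) by blast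
    qed
    then have "t \<otimes> ?s \<in> smult_span (self_module R) \<mm> \<mm>"
      using F.F.coords_smult[OF tR a'(1) b(1)] by simp
    then have "inv ?s \<odot>\<^bsub>self_module R\<^esub> (t \<otimes> ?s) \<in> smult_span (self_module R) \<mm> \<mm>"
      using F.m_subset s by (intro S.submodule_smult[OF sq]) auto
    also have "inv ?s \<odot>\<^bsub>self_module R\<^esub> (t \<otimes> ?s) = t"
    proof -
      have "inv ?s \<otimes> (t \<otimes> ?s) = t \<otimes> (inv ?s \<otimes> ?s)"
        using s tR by (intro F.m_lcomm) auto
      then show ?thesis using s tR by simp
    qed
    finally show ?thesis using t by (rule F.m_square_Int_J)
  qed
  then show False using F.J_not_m_J by auto
qed

text \<open>One J-element x outside \<open>\<mm>\<close> times the second syzygy of N is orthogonal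
  to the entire I-part of the third syzygy of M. That part therefore lies in \<open>\<mm>\<close>
  times the third syzygy and vanishes by \<open>K_nakayama\<close>.\<close>

lemma F_cycles_I_part:
  assumes "\<not> L.cycles 0 \<inter> L.Z.V.part 0 J \<subseteq> smult_span (obj Q (Suc 0)) \<mm> (L.cycles 0)"
  shows "F.cycles 1 \<inter> F.Z.V.part 1 I = {\<zero>\<^bsub>obj P 2\<^esub>}"
proof -
  obtain x where x: "x \<in> L.cycles 0" "x \<in> L.Z.V.part 0 J" "x \<notin> smult_span (obj Q (Suc 0)) \<mm> (L.cycles 0)"
    using assms by auto
  have "u \<in> smult_span (obj P (Suc 1)) \<mm> (F.cycles 1)" if "u \<in> F.cycles 1 \<inter> F.Z.V.part 1 I" for u
    using orthogonal_cycles[of 1 0 u x I J] that x by auto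
  then have "F.cycles 1 \<inter> F.Z.V.part 1 I \<subseteq> smult_span (obj P (Suc 1)) \<mm> (F.cycles 1)" by (rule subsetI)
  then show ?thesis using F.Z.K_nakayama[of 1] by (simp add: numeral_2_eq_2)
qed

text \<open>The same argument in bidegree (0, 1): now the second syzygy of M supplies the fixed
  element and the third syzygy of N loses a part.\<close>

lemma L_cycles_J_part:
  assumes "\<not> F.cycles 0 \<inter> F.Z.V.part 0 I \<subseteq> smult_span (obj P (Suc 0)) \<mm> (F.cycles 0)"
  shows "L.cycles 1 \<inter> L.Z.V.part 1 J = {\<zero>\<^bsub>obj Q 2\<^esub>}"
proof -
  interpret L': minimal_resolution R \<mm> J I N Q C by (rule L.swap_minimal_resolution)
  obtain u where u: "u \<in> F.cycles 0" "u \<in> F.Z.V.part 0 I" "u \<notin> smult_span (obj P (Suc 0)) \<mm> (F.cycles 0)"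
    using assms by auto
  have "x \<in> smult_span (obj Q (Suc 1)) \<mm> (L.cycles 1)" if "x \<in> L.cycles 1 \<inter> L.Z.V.part 1 J" for x
    using orthogonal_cycles[of 0 1 u x I J] that u by auto
  then have "L.cycles 1 \<inter> L.Z.V.part 1 J \<subseteq> smult_span (obj Q (Suc 1)) \<mm> (L.cycles 1)" by (rule subsetI)
  then show ?thesis using L'.Z.K_nakayama[of 1] by (simp add: numeral_2_eq_2)
qed

end

text \<open>The third syzygy has only a J-part, so it lies in J P_2. Conversely J P_2 is mapped into
  the J-part of the second syzygy, which is 0. Consequently the second syzygy is P_2 / J
  P_2.\<close>

lemma (in minimal_resolution) cycles_1_eq:
  assumes 0: "cycles 0 \<inter> Z.V.part 0 J = {\<zero>\<^bsub>obj P 1\<^esub>}" and 1: "cycles 1 \<inter> Z.V.part 1 I = {\<zero>\<^bsub>obj P 2\<^esub>}"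
  shows "cycles 1 = smult_span (obj P 2) J (carrier (obj P 2))"
proof
  show "cycles 1 \<subseteq> smult_span (obj P 2) J (carrier (obj P 2))"
  proof
    fix x assume "x \<in> cycles 1"
    then obtain y z where yz: "y \<in> cycles 1 \<inter> Z.V.part 1 I" "z \<in> cycles 1 \<inter> Z.V.part 1 J"
      "x = y \<oplus>\<^bsub>obj P (Suc 1)\<^esub> z"
      using Z.K_decompose[of x 1] by blast
    then have y: "y = \<zero>\<^bsub>obj P (Suc 1)\<^esub>" 
      using yz(1) unfolding 1 by (simp add: numeral_2_eq_2)
    have "z \<in> carrier (obj P (Suc 1))" using yz(2) by (auto simp: cycles_def)
    then show "x \<in> smult_span (obj P 2) J (carrier (obj P 2))" 
      using yz(2,3) unfolding y by (simp add: numeral_2_eq_2)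
  qed
  show "smult_span (obj P 2) J (carrier (obj P 2)) \<subseteq> cycles 1"
  proof
    fix u assume u: "u \<in> smult_span (obj P 2) J (carrier (obj P 2))"
    have J: "J \<subseteq> carrier R" using J_carrier by auto
    have uV: "u \<in> carrier (obj P (Suc (Suc 0)))" 
      using u F.smult_span_closed[OF J order_refl, of 2] by (auto simp: numeral_2_eq_2)
    have im: "diff P (Suc (Suc 0)) ` carrier (obj P (Suc (Suc 0))) \<subseteq> carrier (obj P (Suc 0))"
      using mod_hom_closed[OF diff] by blast
    have "diff P (Suc (Suc 0)) u \<in> Z.V.part 0 J"
      using u by (intro smult_span_mod_hom[OF obj obj diff J order_refl im]) (simp add: numeral_2_eq_2)
    moreover have "diff P (Suc (Suc 0)) u \<in> cycles 0" using uV by (auto simp: cycles_image)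
    ultimately have "diff P (Suc (Suc 0)) u = \<zero>\<^bsub>obj P (Suc 0)\<^esub>" using 0 by auto
    then show "u \<in> cycles 1" using uV by (simp add: cycles_def)
  qed
qed

text \<open>Otherwise \<open>K_nakayama\<close>, with the ideals exchanged, would make the J-part
  vanish too, and a syzygy with both parts zero is zero.\<close>

lemma (in minimal_resolution) cycles_0_parts:
  assumes "cycles 0 \<noteq> {\<zero>\<^bsub>obj P 1\<^esub>}" "cycles 0 \<inter> Z.V.part 0 I = {\<zero>\<^bsub>obj P 1\<^esub>}"
  shows "\<not> cycles 0 \<inter> Z.V.part 0 J \<subseteq> smult_span (obj P (Suc 0)) \<mm> (cycles 0)"
proof
  interpret S: minimal_resolution R \<mm> J I M P B by (rule swap_minimal_resolution)
  assume "cycles 0 \<inter> Z.V.part 0 J \<subseteq> smult_span (obj P (Suc 0)) \<mm> (cycles 0)"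
  then have J: "cycles 0 \<inter> Z.V.part 0 J = {\<zero>\<^bsub>obj P (Suc 0)\<^esub>}" by (rule S.Z.K_nakayama)
  have "x = \<zero>\<^bsub>obj P (Suc 0)\<^esub>" if x: "x \<in> cycles 0" for x
  proof -
    obtain y z where yz: "y \<in> cycles 0 \<inter> Z.V.part 0 I" "z \<in> cycles 0 \<inter> Z.V.part 0 J"
      "x = y \<oplus>\<^bsub>obj P (Suc 0)\<^esub> z"
      using Z.K_decompose[OF x] by blast
    then have "y = \<zero>\<^bsub>obj P (Suc 0)\<^esub>" "z = \<zero>\<^bsub>obj P (Suc 0)\<^esub>" using assms(2) J by auto
    then show ?thesis using yz(3) F.M.l_zero[OF F.M.zero_closed, of "Suc 0"] by simp
  qed
  moreover have "\<zero>\<^bsub>obj P (Suc 0)\<^esub> \<in> cycles 0" using J by blast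
  ultimately have "cycles 0 = {\<zero>\<^bsub>obj P (Suc 0)\<^esub>}" by blast
  then show False using assms(1) by simp
qed

context minimal_resolution_pair
begin

text \<open>The I-part on the M-side excludes one on the N-side; as the second syzygy of N is
  nonzero, it must have a J-part; this in turn excludes a J-part on the M-side. These two surviving
  parts then remove the I-part of the third syzygy of M and the J-part of that of N.\<close>

lemma cycles_1:
  assumes I: "\<not> F.cycles 0 \<inter> F.Z.V.part 0 I \<subseteq> smult_span (obj P (Suc 0)) \<mm> (F.cycles 0)"
    and L: "L.cycles 0 \<noteq> {\<zero>\<^bsub>obj Q 1\<^esub>}"
  shows "F.cycles 1 = smult_span (obj P 2) J (carrier (obj P 2)) \<and>
    L.cycles 1 = smult_span (obj Q 2) I (carrier (obj Q 2))"
proof -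
  interpret S: minimal_resolution_pair R \<mm> J I M P B N Q C by (rule swap_pair)
  have LI: "L.cycles 0 \<inter> L.Z.V.part 0 I = {\<zero>\<^bsub>obj Q (Suc 0)\<^esub>}"
    using not_both_I_parts[OF I] by (intro L.Z.K_nakayama) blast
  have LJ: "\<not> L.cycles 0 \<inter> L.Z.V.part 0 J \<subseteq> smult_span (obj Q (Suc 0)) \<mm> (L.cycles 0)"
    using L LI by (intro L.cycles_0_parts) simp_all
  have FJ: "F.cycles 0 \<inter> F.Z.V.part 0 J = {\<zero>\<^bsub>obj P (Suc 0)\<^esub>}"
    using S.not_both_I_parts[OF _ LJ] by (intro S.F.Z.K_nakayama) blast
  have "F.cycles 1 = smult_span (obj P 2) J (carrier (obj P 2))"
    using FJ F_cycles_I_part[OF LJ] by (intro F.cycles_1_eq) simp_all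
  moreover have "L.cycles 1 = smult_span (obj Q 2) I (carrier (obj Q 2))"
    using LI L_cycles_J_part[OF I] by (intro S.L.cycles_1_eq) simp_all
  ultimately show ?thesis by blast
qed

lemma cycles_alternative:
  "F.cycles 0 = {\<zero>\<^bsub>obj P 1\<^esub>} \<or> L.cycles 0 = {\<zero>\<^bsub>obj Q 1\<^esub>} \<or>
   (F.cycles 1 = smult_span (obj P 2) J (carrier (obj P 2)) \<and>
    L.cycles 1 = smult_span (obj Q 2) I (carrier (obj Q 2))) \<or>
   (F.cycles 1 = smult_span (obj P 2) I (carrier (obj P 2)) \<and>
    L.cycles 1 = smult_span (obj Q 2) J (carrier (obj Q 2)))"
proof -
  interpret S: minimal_resolution_pair R \<mm> J I M P B N Q C by (rule swap_pair)
  have "\<not> F.cycles 0 \<inter> F.Z.V.part 0 J \<subseteq> smult_span (obj P (Suc 0)) \<mm> (F.cycles 0)"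
    if "F.cycles 0 \<noteq> {\<zero>\<^bsub>obj P 1\<^esub>}" "F.cycles 0 \<inter> F.Z.V.part 0 I \<subseteq> smult_span (obj P (Suc 0)) \<mm> (F.cycles 0)"
    using that F.Z.K_nakayama[of 0] by (intro F.cycles_0_parts) simp_all
  then show ?thesis using cycles_1 S.cycles_1 by blast
qed

end

section \<open>Projective dimension at most one\<close>

text \<open>\<open>projective_module\<close> asks for a free module on the type of functions from
  the elements of the module to the ring. A free module is shown to be projective by copying it to
  that type along an injection \<open>g\<close>.\<close>

definition transported_module :: "('m \<Rightarrow> 'n) \<Rightarrow> ('r, 'm) module \<Rightarrow> ('r, 'n) module" where
  "transported_module g V = \<lparr>carrier = g ` carrier V, monoid.mult = (\<lambda>x y. x), one = g \<zero>\<^bsub>V\<^esub>,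
     ring.zero = g \<zero>\<^bsub>V\<^esub>, add = (\<lambda>x y. g (inv_into UNIV g x \<oplus>\<^bsub>V\<^esub> inv_into UNIV g y)), smult = (\<lambda>r x. g (r \<odot>\<^bsub>V\<^esub> inv_into UNIV g x))\<rparr>"

lemma transported_module_simps:
  "carrier (transported_module g V) = g ` carrier V" "\<zero>\<^bsub>transported_module g V\<^esub> = g \<zero>\<^bsub>V\<^esub>"
  "x \<oplus>\<^bsub>transported_module g V\<^esub> y = g (inv_into UNIV g x \<oplus>\<^bsub>V\<^esub> inv_into UNIV g y)"
  "r \<odot>\<^bsub>transported_module g V\<^esub> x = g (r \<odot>\<^bsub>V\<^esub> inv_into UNIV g x)"
  by (simp_all add: transported_module_def)

lemma module_transported_module:
  assumes "module R V" "inj g"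
  shows "module R (transported_module g V)"
proof -
  interpret V: module R V by fact
  show ?thesis
  proof (rule moduleI)
    show "abelian_group (transported_module g V)"
    proof (rule abelian_groupI)
      fix x assume "x \<in> carrier (transported_module g V)"
      then obtain y where y: "y \<in> carrier V" "x = g y" by (auto simp: transported_module_simps)
      then show "\<exists>z\<in>carrier (transported_module g V). z \<oplus>\<^bsub>transported_module g V\<^esub> x = \<zero>\<^bsub>transported_module g V\<^esub>"
        using assms(2)
        by (intro bexI[of _ "g (\<ominus>\<^bsub>V\<^esub> y)"]) (auto simp: transported_module_simps V.M.l_neg)
    qed (use assms(2) in \<open>auto simp: transported_module_simps V.M.a_ac\<close>)
  qed (use assms(2) in \<open>auto simp: transported_module_simps V.smult_l_distr V.smult_r_distr V.smult_assoc1 V.is_cring\<close>)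
qed

lemma (in finite_basis) projective_module:
  assumes "\<one>\<^bsub>R\<^esub> \<noteq> \<zero>\<^bsub>R\<^esub>"
  shows "projective_module R V"
proof -
  \<comment> \<open>Each element goes to its indicator function, which is injective because 1 and 0
    differ.\<close>
  define g :: "'m \<Rightarrow> 'm \<Rightarrow> 'r" where "g x y = (if x = y then \<one>\<^bsub>R\<^esub> else \<zero>\<^bsub>R\<^esub>)" for x y
  have inj: "inj g"
  proof (rule injI)
    fix x y assume "g x = g y"
    then have "g x x = g y x" by simp
    then show "x = y" using assms by (simp add: g_def split: if_splits)
  qed
  let ?F = "transported_module g V"
  have F: "module R ?F" by (rule module_transported_module[OF module_axioms inj])
  interpret F: plain_module R ?F by (rule plain_module[OF F])
  have hom: "g \<in> mod_hom R V ?F" and hom': "inv_into UNIV g \<in> mod_hom R ?F V"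
    using inj by (auto intro!: mod_homI simp: transported_module_simps)
  have "module_basis R ?F (g ` B)"
  proof (rule F.module_basis_image[OF finite_basis _ assms])
    show "g \<in> B \<rightarrow> carrier ?F" using basis_closed by (auto simp: transported_module_simps)
    have lc: "lin_comb ?F B v g = g (lin_comb V B v (\<lambda>b. b))" if "v \<in> B \<rightarrow> carrier R" for v
      using that basis_closed finite_basis
      by (intro mod_hom_lin_comb[OF module_axioms F hom, symmetric]) auto
    show "\<exists>v\<in>B \<rightarrow> carrier R. x = lin_comb ?F B v g" if x: "x \<in> carrier ?F" for x
    proof -
      obtain y where y: "y \<in> carrier V" "x = g y" using x by (auto simp: transported_module_simps)
      have "coords y \<in> B \<rightarrow> carrier R" using coords_in[OF y(1)] by auto
      then show ?thesis using y lc[of "coords y"] by (intro bexI[of _ "coords y"]) (simp_all add: lin_comb_coords)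
    qed
    show "v i = \<zero>\<^bsub>R\<^esub>" if v: "v \<in> B \<rightarrow> carrier R" "i \<in> B" and 0: "lin_comb ?F B v g = \<zero>\<^bsub>?F\<^esub>" for v i
    proof -
      have "lin_comb V B v (\<lambda>b. b) = \<zero>\<^bsub>V\<^esub>"
        using 0 inj unfolding lc[OF v(1)] by (simp add: transported_module_simps inj_eq)
      then show ?thesis using coords_unique[OF v] coords_zero[OF v(2)] by simp
    qed
  qed
  then have "free_module R ?F" using F by (auto simp: free_module_def)
  then show ?thesis
    unfolding projective_module_def using hom hom' inj module_axioms
    by (intro conjI exI[of _ ?F] exI[of _ g] exI[of _ "inv_into UNIV g"]) auto
qed

text \<open>If the differential out of degree 1 is injective, the resolution can be cut off there
  and continued by the zero module R^0.\<close>

lemma (in local_ring_at) projective_dimension_le_1: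
  fixes P :: "('a, nat \<Rightarrow> 'a, 'm) resolution"
  assumes P: "free_resolution R M P B"
    and 0: "\<And>x. x \<in> carrier (obj P 1) \<Longrightarrow> diff P 1 x = \<zero>\<^bsub>obj P 0\<^esub> \<Longrightarrow> x = \<zero>\<^bsub>obj P 1\<^esub>"
  shows "projective_dimension R M \<le> 1"
proof -
  interpret P: free_resolution R M P B by (rule P)
  let ?O = "free_power R 0"
  \<comment> \<open>Beyond degree 1 the differentials are constantly zero, where zero has to be that
    of the target: of \<open>obj P 1\<close> in degree 2 and of R^0 above.\<close>
  define Q :: "('a, nat \<Rightarrow> 'a, 'm) resolution" where
    "Q = \<lparr>obj = (\<lambda>i. if i \<le> 1 then obj P i else ?O),
      diff = (\<lambda>i. if i \<le> 1 then diff P i else (\<lambda>_. if i = 2 then \<zero>\<^bsub>obj P 1\<^esub> else \<zero>\<^bsub>?O\<^esub>)), aug = aug P\<rparr>"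
  have O: "carrier ?O = {\<zero>\<^bsub>?O\<^esub>}"
    by (auto simp: carrier_free_power free_power_def power_module_simps)
  interpret O: module R ?O by (rule module_free_power)
  have mods: "module R (obj Q i)" for i
    using P.obj module_free_power by (simp add: Q_def)
  have z: "\<zero>\<^bsub>obj P 1\<^esub> \<in> carrier (obj P 1)" using P.F.M.zero_closed[of 1] by simp
  have d1: "diff P 1 \<in> mod_hom R (obj P 1) (obj P 0)" using P.diff[of 0] by simp
  have homs: "diff Q (Suc i) \<in> mod_hom R (obj Q (Suc i)) (obj Q i)" for i
  proof (cases i)
    case 0
    then show ?thesis using d1 by (simp add: Q_def)
  next
    case (Suc j)
    then show ?thesis using P.F.M.zero_closed[of 1] P.F.smult_r_null[of _ 1]
      by (cases j) (auto simp: Q_def intro!: mod_homI)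
  qed
  have "resolution_of R M Q"
    unfolding resolution_of_def
  proof (intro conjI allI mods homs)
    show "aug Q \<in> mod_hom R (obj Q 0) M" "aug Q ` carrier (obj Q 0) = carrier M"
      using P.aug P.aug_surj by (simp_all add: Q_def)
    show "diff Q 1 ` carrier (obj Q 1) = a_kernel (obj Q 0) M (aug Q)"
      using P.aug_exact by (simp add: Q_def)
    show "diff Q (Suc (Suc i)) ` carrier (obj Q (Suc (Suc i))) =
      a_kernel (obj Q (Suc i)) (obj Q i) (diff Q (Suc i))" for i
    proof (cases i)
      case 0
      have "{x \<in> carrier (obj P 1). diff P 1 x = \<zero>\<^bsub>obj P 0\<^esub>} = {\<zero>\<^bsub>obj P 1\<^esub>}"
        using assms(2) z mod_hom_zero[OF P.obj P.obj d1] by auto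
      then show ?thesis using 0 by (simp add: Q_def O a_kernel_def')
    next
      case (Suc j)
      then show ?thesis by (cases j) (auto simp: Q_def O a_kernel_def')
    qed
  qed
  moreover have "projective_module R (obj Q i)" for i
    using finite_basis.projective_module[OF P.basis one_neq_zero]
      finite_basis.projective_module[OF finite_basis_free_power[OF one_neq_zero] one_neq_zero]
    by (simp add: Q_def)
  moreover have "\<forall>i>1. carrier (obj Q i) = {\<zero>\<^bsub>obj Q i\<^esub>}" using O by (simp add: Q_def)
  ultimately show ?thesis
    unfolding projective_dimension_def one_enat_def by (intro Inf_lower) auto
qed

section \<open>Free modules over a quotient\<close>

lemma descended_module_simps:
  "carrier (descended_module R f U) = carrier U" "\<zero>\<^bsub>descended_module R f U\<^esub> = \<zero>\<^bsub>U\<^esub>"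
  "x \<oplus>\<^bsub>descended_module R f U\<^esub> y = x \<oplus>\<^bsub>U\<^esub> y"
  "s \<odot>\<^bsub>descended_module R f U\<^esub> x = inv_into (carrier R) f s \<odot>\<^bsub>U\<^esub> x"
  by (simp_all add: descended_module_def)

lemma finsum_descended_module: "finsum (descended_module R f U) g A = finsum U g A"
  by (simp add: finsum_def finprod_def descended_module_def)

lemma submodule_image:
  assumes V: "module R V" and W: "module R W" and d: "d \<in> mod_hom R V W"
  shows "submodule (d ` carrier V) R W"
proof -
  interpret V: plain_module R V using V by (rule plain_module)
  interpret W: plain_module R W using W by (rule plain_module)
  show ?thesis
  proof (rule W.submoduleI')
    show "\<zero>\<^bsub>W\<^esub> \<in> d ` carrier V"
      by (rule image_eqI[OF _ V.M.zero_closed]) (rule mod_hom_zero[OF V W d, symmetric])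
    fix x assume "x \<in> d ` carrier V"
    then obtain a where a: "a \<in> carrier V" "x = d a" by auto
    {
      fix y assume "y \<in> d ` carrier V"
      then obtain b where b: "b \<in> carrier V" "y = d b" by auto
      show "x \<oplus>\<^bsub>W\<^esub> y \<in> d ` carrier V"
        unfolding a(2) b(2) mod_hom_add[OF d a(1) b(1), symmetric] using a(1) b(1) by (intro imageI) simp
    next
      fix r assume r: "r \<in> carrier R"
      show "r \<odot>\<^bsub>W\<^esub> x \<in> d ` carrier V"
        unfolding a(2) mod_hom_smult[OF d r a(1), symmetric] using a(1) r by (intro imageI) simp
    }
  qed (use mod_hom_closed[OF d] in auto)
qed

lemma ring_hom_ideal_kernel:
  "cring R \<Longrightarrow> cring S \<Longrightarrow> h \<in> ring_hom R S \<Longrightarrow> ideal (a_kernel R S h) R"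
  by (intro ring_hom_ring.kernel_is_ideal ring_hom_ringI2) (simp_all add: cring.axioms)

text \<open>The image of d is V modulo J V, with J the kernel of f. The ring acts on it through S,
  and the images of a basis of V form a basis over S.\<close>

lemma free_along_image:
  fixes R (structure) and S (structure)
  assumes S: "cring S" "\<one>\<^bsub>S\<^esub> \<noteq> \<zero>\<^bsub>S\<^esub>" and f: "f \<in> ring_hom R S" "f ` carrier R = carrier S"
    and V: "finite_basis R V B" and W: "module R W" and d: "d \<in> mod_hom R V W"
    and ker: "\<And>x. x \<in> carrier V \<Longrightarrow>
      d x = \<zero>\<^bsub>W\<^esub> \<longleftrightarrow> x \<in> smult_span V (a_kernel R S f) (carrier V)"
  shows "free_along R S f (W\<lparr>carrier := d ` carrier V\<rparr>)"
proof -
  interpret V: finite_basis R V B by fact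
  interpret S: cring S by fact
  interpret f: ring_hom_cring R S f
    by (intro ring_hom_cring.intro V.is_cring S.is_cring ring_hom_cring_axioms.intro f)
  let ?J = "a_kernel R S f"
  have J: "ideal ?J R" by (rule ring_hom_ideal_kernel[OF V.R.is_cring S(1) f(1)])
  have J_iff: "r \<in> ?J \<longleftrightarrow> r \<in> carrier R \<and> f r = \<zero>\<^bsub>S\<^esub>" for r unfolding a_kernel_def' by (rule mem_Collect_eq)
  let ?U = "W\<lparr>carrier := d ` carrier V\<rparr>"
  let ?D = "descended_module R f ?U"
  note sub = submodule_image[OF V.module_axioms W d]
  interpret W: plain_module R W using W by (rule plain_module)
  have U: "module R ?U" by (rule module_restrict[OF W sub])
  interpret U: plain_module R ?U using U by (rule plain_module)
  have dU: "d \<in> mod_hom R V ?U" using d by (auto simp: mod_hom_def hom_def)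
  have kill: "r \<odot>\<^bsub>?U\<^esub> x = \<zero>\<^bsub>?U\<^esub>" if r: "r \<in> ?J" and x: "x \<in> carrier ?U" for r x
  proof -
    obtain a where a: "a \<in> carrier V" "x = d a" using x by auto
    have rR: "r \<in> carrier R" using r J_iff by auto
    have "?J \<subseteq> carrier R" using J_iff by auto
    then have "r \<odot>\<^bsub>V\<^esub> a \<in> smult_span V ?J (carrier V)" using r a(1) by (intro V.smult_span_incl) auto
    then have "d (r \<odot>\<^bsub>V\<^esub> a) = \<zero>\<^bsub>W\<^esub>" using ker[of "r \<odot>\<^bsub>V\<^esub> a"] rR a(1) by simp
    then show ?thesis using a mod_hom_smult[OF d rR a(1)] by simp
  qed
  have inv_f: "inv_into (carrier R) f s \<in> carrier R" "f (inv_into (carrier R) f s) = s" if "s \<in> carrier S" for s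
    using that f(2) by (auto intro: inv_into_into f_inv_into_f)
  \<comment> \<open>\<open>descended_module\<close> picks a preimage of each scalar. As the kernel
    of f annihilates the image of d, every preimage acts in the same way, so the module laws for S
    can be transferred from R.\<close>
  have smult_eq: "r \<odot>\<^bsub>?U\<^esub> x = r' \<odot>\<^bsub>?U\<^esub> x"
    if r: "r \<in> carrier R" "r' \<in> carrier R" "f r = f r'" and x: "x \<in> carrier ?U" for r r' x
  proof -
    have "r \<ominus>\<^bsub>R\<^esub> r' \<in> ?J"
      using r by (simp add: J_iff a_minus_def S.r_neg)
    then have "(r \<ominus>\<^bsub>R\<^esub> r') \<odot>\<^bsub>?U\<^esub> x = \<zero>\<^bsub>?U\<^esub>" using x by (rule kill)
    moreover have "r \<odot>\<^bsub>?U\<^esub> x = ((r \<ominus>\<^bsub>R\<^esub> r') \<oplus>\<^bsub>R\<^esub> r') \<odot>\<^bsub>?U\<^esub> x"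
      using r by (simp add: a_minus_def V.R.a_assoc V.R.l_neg)
    moreover have "\<dots> = (r \<ominus>\<^bsub>R\<^esub> r') \<odot>\<^bsub>?U\<^esub> x \<oplus>\<^bsub>?U\<^esub> r' \<odot>\<^bsub>?U\<^esub> x"
      using r x by (intro U.smult_l_distr) auto
    ultimately show ?thesis using U.smult_closed[OF r(2) x] U.M.l_zero by metis
  qed
  have smult_D: "f r \<odot>\<^bsub>?D\<^esub> x = r \<odot>\<^bsub>?U\<^esub> x" if r: "r \<in> carrier R" and x: "x \<in> carrier ?U" for r x
    unfolding descended_module_simps using inv_f[of "f r"] r x by (intro smult_eq) auto
  have smult_D': "\<exists>r\<in>carrier R. s = f r \<and> (\<forall>x\<in>carrier ?U. s \<odot>\<^bsub>?D\<^esub> x = r \<odot>\<^bsub>?U\<^esub> x)" if "s \<in> carrier S" for s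
    using inv_f[OF that] by (intro bexI[of _ "inv_into (carrier R) f s"]) (auto simp: descended_module_simps)
  have D: "module S ?D"
  proof (rule moduleI[OF S.is_cring])
    show "abelian_group ?D"
    proof (rule abelian_groupI, unfold descended_module_simps)
      fix x assume x: "x \<in> carrier ?U"
      show "\<zero>\<^bsub>?U\<^esub> \<oplus>\<^bsub>?U\<^esub> x = x" by (rule U.M.l_zero[OF x])
      show "\<exists>y\<in>carrier ?U. y \<oplus>\<^bsub>?U\<^esub> x = \<zero>\<^bsub>?U\<^esub>"
        by (rule bexI[where x = "\<ominus>\<^bsub>?U\<^esub> x"]) (rule U.M.l_neg[OF x], rule U.M.a_inv_closed[OF x])
      fix y assume y: "y \<in> carrier ?U"
      show "x \<oplus>\<^bsub>?U\<^esub> y \<in> carrier ?U" by (rule U.M.a_closed[OF x y])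
      show "x \<oplus>\<^bsub>?U\<^esub> y = y \<oplus>\<^bsub>?U\<^esub> x" by (rule U.M.a_comm[OF x y])
      fix z assume z: "z \<in> carrier ?U"
      show "x \<oplus>\<^bsub>?U\<^esub> y \<oplus>\<^bsub>?U\<^esub> z = x \<oplus>\<^bsub>?U\<^esub> (y \<oplus>\<^bsub>?U\<^esub> z)" by (rule U.M.a_assoc[OF x y z])
    qed (rule U.M.zero_closed)
    fix s x assume s: "s \<in> carrier S" and x: "x \<in> carrier ?D"
    then have xU: "x \<in> carrier ?U" by (simp only: descended_module_simps)
    obtain r where r: "r \<in> carrier R" "s = f r" using s f(2) by auto
    show "s \<odot>\<^bsub>?D\<^esub> x \<in> carrier ?D"
      unfolding r(2) smult_D[OF r(1) xU] unfolding descended_module_simps by (rule U.smult_closed[OF r(1) xU])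
    {
      fix t assume "t \<in> carrier S"
      then obtain q where q: "q \<in> carrier R" "t = f q" using f(2) by auto
      have "s \<oplus>\<^bsub>S\<^esub> t = f (r \<oplus>\<^bsub>R\<^esub> q)" "s \<otimes>\<^bsub>S\<^esub> t = f (r \<otimes>\<^bsub>R\<^esub> q)" using r q by auto
      then show "(s \<oplus>\<^bsub>S\<^esub> t) \<odot>\<^bsub>?D\<^esub> x = s \<odot>\<^bsub>?D\<^esub> x \<oplus>\<^bsub>?D\<^esub> t \<odot>\<^bsub>?D\<^esub> x"
        "s \<otimes>\<^bsub>S\<^esub> t \<odot>\<^bsub>?D\<^esub> x = s \<odot>\<^bsub>?D\<^esub> (t \<odot>\<^bsub>?D\<^esub> x)"
        using U.smult_l_distr[OF r(1) q(1) xU] U.smult_assoc1[OF r(1) q(1) xU]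
          smult_D[OF r(1) xU] smult_D[OF q(1) xU] smult_D[OF V.R.a_closed[OF r(1) q(1)] xU]
          smult_D[OF V.R.m_closed[OF r(1) q(1)] xU] smult_D[OF r(1) U.smult_closed[OF q(1) xU]] r(2) q(2)
        by (simp_all only: descended_module_simps(3))
    next
      fix y assume "y \<in> carrier ?D"
      then have yU: "y \<in> carrier ?U" by (simp only: descended_module_simps)
      show "s \<odot>\<^bsub>?D\<^esub> (x \<oplus>\<^bsub>?D\<^esub> y) = s \<odot>\<^bsub>?D\<^esub> x \<oplus>\<^bsub>?D\<^esub> s \<odot>\<^bsub>?D\<^esub> y"
        using U.smult_r_distr[OF r(1) xU yU] smult_D[OF r(1) xU] smult_D[OF r(1) yU]
          smult_D[OF r(1) U.M.a_closed[OF xU yU]] r(2)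
        by (simp only: descended_module_simps(3))
    }
  next
    fix x assume "x \<in> carrier ?D"
    then have xU: "x \<in> carrier ?U" by (simp only: descended_module_simps)
    show "\<one>\<^bsub>S\<^esub> \<odot>\<^bsub>?D\<^esub> x = x"
      using smult_D[OF V.R.one_closed xU] U.smult_one[OF xU] by (simp only: f.hom_one)
  qed
  interpret D: plain_module S ?D by (rule plain_module[OF D])
  have dD: "d b \<in> carrier ?D" "d b \<in> carrier ?U" if "b \<in> B" for b
    using that V.basis_closed by (auto simp: descended_module_simps)
  have lc: "lin_comb ?D B (\<lambda>b. f (c b)) d = d (lin_comb V B c (\<lambda>b. b))" if c: "c \<in> B \<rightarrow> carrier R" for c
  proof -
    have "lin_comb ?D B (\<lambda>b. f (c b)) d = (\<Oplus>\<^bsub>?D\<^esub>b\<in>B. c b \<odot>\<^bsub>?U\<^esub> d b)"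
      unfolding lin_comb_def
    proof (rule D.M.finsum_cong')
      show "(\<lambda>b. c b \<odot>\<^bsub>?U\<^esub> d b) \<in> B \<rightarrow> carrier ?D"
        unfolding descended_module_simps
      proof
        fix b assume b: "b \<in> B"
        have "c b \<in> carrier R" using c b by auto
        then show "c b \<odot>\<^bsub>?U\<^esub> d b \<in> carrier ?U" by (rule U.smult_closed[OF _ dD(2)[OF b]])
      qed
      show "f (c b) \<odot>\<^bsub>?D\<^esub> d b = c b \<odot>\<^bsub>?U\<^esub> d b" if b: "b \<in> B" for b
        using c b by (intro smult_D[OF _ dD(2)[OF b]]) auto
    qed simp
    also have "\<dots> = lin_comb ?U B c d" by (simp only: finsum_descended_module lin_comb_def)
    also have "\<dots> = d (lin_comb V B c (\<lambda>b. b))"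
      using c V.basis_closed V.finite_basis
      by (intro mod_hom_lin_comb[OF V.module_axioms U dU, symmetric]) auto
    finally show ?thesis .
  qed
  have "module_basis S ?D (d ` B)"
  proof (rule D.module_basis_image[OF V.finite_basis _ S(2)])
    show "d \<in> B \<rightarrow> carrier ?D" using dD by auto
    show "\<exists>v\<in>B \<rightarrow> carrier S. x = lin_comb ?D B v d" if "x \<in> carrier ?D" for x
    proof -
      obtain a where a: "a \<in> carrier V" "x = d a" using \<open>x \<in> carrier ?D\<close> by (auto simp: descended_module_simps)
      have c: "V.coords a \<in> B \<rightarrow> carrier R" using V.coords_in[OF a(1)] by auto
      then show ?thesis
        using lc[OF c] a by (intro bexI[of _ "\<lambda>b. f (V.coords a b)"]) (auto simp: V.lin_comb_coords)
    qed
    show "v b = \<zero>\<^bsub>S\<^esub>" if v: "v \<in> B \<rightarrow> carrier S" "b \<in> B" and 0: "lin_comb ?D B v d = \<zero>\<^bsub>?D\<^esub>" for v b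
    proof -
      \<comment> \<open>Independence: with lifted coefficients the combination of basis vectors lies
        in the kernel of d, that is in J V. Its coordinates, which are the lifts, are then in J and
        map to 0 in S.\<close>
      let ?c = "\<lambda>b. inv_into (carrier R) f (v b)"
      have c: "?c \<in> B \<rightarrow> carrier R" using v(1) inv_f by auto
      let ?x = "lin_comb V B ?c (\<lambda>b. b)"
      have x: "?x \<in> carrier V" using c V.basis_closed by (intro V.lin_comb_closed) auto
      have "d ?x = lin_comb ?D B v d"
        unfolding lc[OF c, symmetric] using v inv_f dD by (intro D.lin_comb_cong) auto
      also have "\<dots> = \<zero>\<^bsub>W\<^esub>" using 0 by (simp add: descended_module_simps)
      finally have "V.coords ?x b \<in> ?J" using ker[OF x] V.in_smult_span_iff[OF J x] v(2) by auto
      then have "f (?c b) = \<zero>\<^bsub>S\<^esub>" unfolding V.coords_unique[OF c v(2)] J_iff by simp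
      moreover have "v b \<in> carrier S" using v by auto
      ultimately show ?thesis using inv_f(2)[of "v b"] by simp
    qed
  qed
  then show ?thesis
    unfolding free_along_def free_module_def using kill D by blast
qed

section \<open>Fiber products of local rings\<close>

lemma in_a_kernel_iff: "x \<in> a_kernel R S h \<longleftrightarrow> x \<in> carrier R \<and> h x = \<zero>\<^bsub>S\<^esub>"
  unfolding a_kernel_def' by (rule mem_Collect_eq)

text \<open>A nonempty chain of ideals of a Noetherian ring contains its own union, so Zorn's lemma
  applies to the proper ideals above I.\<close>

lemma (in noetherian_ring) maximalideal_exists:
  assumes I: "ideal I R" and one: "\<one> \<notin> I"
  shows "\<exists>M. maximalideal M R \<and> I \<subseteq> M"
proof -
  let ?A = "{J. ideal J R \<and> I \<subseteq> J \<and> \<one> \<notin> J}"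
  have "\<exists>M\<in>?A. \<forall>J\<in>?A. M \<subseteq> J \<longrightarrow> J = M"
  proof (rule subset_Zorn_nonempty)
    show "?A \<noteq> {}" using assms by blast
    fix C assume C: "C \<noteq> {}" "subset.chain ?A C"
    have "subset.chain {J. ideal J R} C" using C(2) unfolding subset.chain_def by blast
    then have "\<Union>C \<in> C" by (rule ideal_chain_is_trivial[OF C(1)])
    then show "\<Union>C \<in> ?A" using C(2) unfolding subset.chain_def by blast
  qed
  then obtain M where M: "ideal M R" "I \<subseteq> M" "\<one> \<notin> M"
    and max: "\<And>J. ideal J R \<Longrightarrow> I \<subseteq> J \<Longrightarrow> \<one> \<notin> J \<Longrightarrow> M \<subseteq> J \<Longrightarrow> J = M" by auto
  have "maximalideal M R"
  proof (rule maximalidealI[OF M(1)])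
    show "carrier R \<noteq> M" using M(3) by auto
    show "J = M \<or> J = carrier R" if J: "ideal J R" "M \<subseteq> J" "J \<subseteq> carrier R" for J
    proof (cases "\<one> \<in> J")
      case True
      then show ?thesis using ideal.one_imp_carrier[OF J(1)] by auto
    next
      case False
      have "I \<subseteq> J" using M(2) J(2) by (rule order_trans)
      then show ?thesis using max[OF J(1) _ False J(2)] by simp
    qed
  qed
  then show ?thesis using M(2) by blast
qed

text \<open>The kernel of a surjection onto a field is maximal, hence the only maximal ideal. A
  nonunit s generates a proper ideal, which lies in a maximal one, so s has residue 0.\<close>

lemma (in local_ring) unit_if_nonzero_residue:
  assumes k: "field k" and f: "f \<in> ring_hom R k" "f ` carrier R = carrier k"
    and s: "s \<in> carrier R" "f s \<noteq> \<zero>\<^bsub>k\<^esub>"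
  shows "s \<in> Units R"
proof (rule ccontr)
  assume nu: "s \<notin> Units R"
  interpret k: field k by (rule k)
  interpret f: ring_hom_cring R k f
    by (intro ring_hom_cring.intro is_cring k.is_cring ring_hom_cring_axioms.intro f)
  let ?K = "a_kernel R k f"
  have K_iff: "x \<in> ?K \<longleftrightarrow> x \<in> carrier R \<and> f x = \<zero>\<^bsub>k\<^esub>" for x by (rule in_a_kernel_iff)
  have K: "ideal ?K R" by (rule ring_hom_ideal_kernel[OF is_cring k.is_cring f(1)])
  have max: "maximalideal ?K R"
  proof (rule maximalidealI[OF K])
    show "carrier R \<noteq> ?K"
    proof
      assume "carrier R = ?K"
      then have "\<one> \<in> ?K" using one_closed by blast
      then have "f \<one> = \<zero>\<^bsub>k\<^esub>" unfolding K_iff by (rule conjunct2)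
      then show False using f.hom_one k.one_not_zero by metis
    qed
    show "J = ?K \<or> J = carrier R" if J: "ideal J R" "?K \<subseteq> J" "J \<subseteq> carrier R" for J
    proof (cases "J \<subseteq> ?K")
      case False
      then obtain x where x: "x \<in> J" "x \<notin> ?K" by blast
      then have xR: "x \<in> carrier R" and fx: "f x \<noteq> \<zero>\<^bsub>k\<^esub>" using J(3) by (auto simp: K_iff)
      then have u: "f x \<in> Units k" using k.field_Units by auto
      then have "inv\<^bsub>k\<^esub> (f x) \<in> f ` carrier R" unfolding f(2) by auto
      then obtain y where y: "y \<in> carrier R" "f y = inv\<^bsub>k\<^esub> (f x)" by auto
      have yx: "y \<otimes> x \<in> J" by (rule ideal.I_l_closed[OF J(1) x(1) y(1)])
      have "f (\<one> \<ominus> y \<otimes> x) = \<one>\<^bsub>k\<^esub> \<ominus>\<^bsub>k\<^esub> f y \<otimes>\<^bsub>k\<^esub> f x"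
        using xR y(1) by (simp add: a_minus_def)
      also have "\<dots> = \<zero>\<^bsub>k\<^esub>" using u unfolding y(2) by (simp add: a_minus_def k.r_neg)
      finally have "\<one> \<ominus> y \<otimes> x \<in> ?K" using xR y(1) by (simp add: K_iff)
      then have "(\<one> \<ominus> y \<otimes> x) \<oplus> y \<otimes> x \<in> J"
        using J(2) yx by (intro additive_subgroup.a_closed[OF ideal.axioms(1)[OF J(1)]]) auto
      also have "(\<one> \<ominus> y \<otimes> x) \<oplus> y \<otimes> x = \<one>"
        using xR y(1) by (simp add: a_minus_def a_assoc l_neg)
      finally show ?thesis using ideal.one_imp_carrier[OF J(1)] by simp
    qed (use J in auto)
  qed
  have "\<one> \<notin> PIdl s"
  proof
    assume "\<one> \<in> PIdl s"
    then obtain y where "y \<in> carrier R" "\<one> = y \<otimes> s" by (auto simp: cgenideal_def)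
    then have "s \<in> Units R" using s(1) m_comm[of y s] unfolding Units_def by auto
    then show False using nu by simp
  qed
  then obtain L where L: "maximalideal L R" "PIdl s \<subseteq> L"
    using maximalideal_exists[OF cgenideal_ideal[OF s(1)]] by blast
  have "L = ?K" using unique_maximal_ideal L(1) max by blast
  then have "s \<in> ?K" using L(2) cgenideal_self[OF s(1)] by auto
  then show False using s(2) by (simp add: K_iff)
qed

lemma (in local_ring_at) maximal_ideal_eq: "maximal_ideal R = \<mm>"
  unfolding maximal_ideal_def
proof (rule the_equality)
  have unit: "J = carrier R" if J: "ideal J R" "a \<in> J" "a \<notin> \<mm>" for J a
  proof -
    have a: "a \<in> carrier R" using additive_subgroup.a_subset[OF ideal.axioms(1)[OF J(1)]] J(2) by blast
    then have "inv a \<otimes> a \<in> J" using units[OF a J(3)] J by (intro ideal.I_l_closed) auto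
    then have "\<one> \<in> J" using units[OF a J(3)] by simp
    then show ?thesis by (rule ideal.one_imp_carrier[OF J(1)])
  qed
  show "maximalideal \<mm> R"
  proof (rule maximalidealI[OF ideal_m])
    show "carrier R \<noteq> \<mm>" using one_notin by auto
    show "J = \<mm> \<or> J = carrier R" if "ideal J R" "\<mm> \<subseteq> J" "J \<subseteq> carrier R" for J
      using unit[OF that(1)] that(2) by blast
  qed
  fix L assume L: "maximalideal L R"
  then have Li: "ideal L R" by (rule maximalideal.axioms(1))
  have "L \<subseteq> \<mm>" using unit[OF Li] maximalideal.I_notcarr[OF L] by blast
  then show "L = \<mm>"
    using maximalideal.I_maximal[OF L ideal_m _ m_subset] one_notin by auto
qed

section \<open>The fiber product as a local Noetherian ring\<close>

lemma fiber_product_simps: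
  "carrier (fiber_product S T f g) = {(s, t). s \<in> carrier S \<and> t \<in> carrier T \<and> f s = g t}"
  "\<one>\<^bsub>fiber_product S T f g\<^esub> = (\<one>\<^bsub>S\<^esub>, \<one>\<^bsub>T\<^esub>)" "\<zero>\<^bsub>fiber_product S T f g\<^esub> = (\<zero>\<^bsub>S\<^esub>, \<zero>\<^bsub>T\<^esub>)"
  "(s, t) \<otimes>\<^bsub>fiber_product S T f g\<^esub> (s', t') = (s \<otimes>\<^bsub>S\<^esub> s', t \<otimes>\<^bsub>T\<^esub> t')"
  "(s, t) \<oplus>\<^bsub>fiber_product S T f g\<^esub> (s', t') = (s \<oplus>\<^bsub>S\<^esub> s', t \<oplus>\<^bsub>T\<^esub> t')"
  by (simp_all add: fiber_product_def RDirProd_def DirProd_def monoid.defs)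

locale fiber_product_of_local_rings =
  S: local_ring S + T: local_ring T + k: field k
  for S :: "('s, 'x) ring_scheme" and T :: "('t, 'y) ring_scheme" and k :: "('k, 'z) ring_scheme" +
  fixes f :: "'s \<Rightarrow> 'k" and g :: "'t \<Rightarrow> 'k"
  assumes f: "f \<in> ring_hom S k" "f ` carrier S = carrier k" "f \<notin> ring_iso S k"
    and g: "g \<in> ring_hom T k" "g ` carrier T = carrier k" "g \<notin> ring_iso T k"
begin

sublocale f: ring_hom_cring S k f
  by (intro ring_hom_cring.intro S.is_cring k.is_cring ring_hom_cring_axioms.intro f)
sublocale g: ring_hom_cring T k g
  by (intro ring_hom_cring.intro T.is_cring k.is_cring ring_hom_cring_axioms.intro g)

abbreviation R :: "('s \<times> 't) ring" where "R \<equiv> fiber_product S T f g"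

lemma swap: "fiber_product_of_local_rings T S k g f"
  by (intro fiber_product_of_local_rings.intro fiber_product_of_local_rings_axioms.intro f g
      S.local_ring_axioms T.local_ring_axioms k.field_axioms)

text \<open>That S differs from k is expressed by f not being an isomorphism; for a surjective f
  this is a nonzero kernel, hence a nonzero ideal \<open>I\<close> of the fiber product.\<close>

lemma nontrivial_kernel: "\<exists>s\<in>carrier S. s \<noteq> \<zero>\<^bsub>S\<^esub> \<and> f s = \<zero>\<^bsub>k\<^esub>"
proof (rule ccontr)
  assume *: "\<not> ?thesis"
  have "inj_on f (carrier S)"
  proof (rule inj_onI)
    fix x y assume xy: "x \<in> carrier S" "y \<in> carrier S" "f x = f y"
    then have "f (x \<ominus>\<^bsub>S\<^esub> y) = \<zero>\<^bsub>k\<^esub>" by (simp add: a_minus_def k.r_neg)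
    then have "x \<ominus>\<^bsub>S\<^esub> y = \<zero>\<^bsub>S\<^esub>" using * S.minus_closed[OF xy(1,2)] by blast
    then show "x = y" using xy by (simp add: S.r_right_minus_eq)
  qed
  then show False using f by (auto simp: ring_iso_def bij_betw_def)
qed

sublocale R: cring R
proof (rule cringI)
  show "abelian_group R"
  proof (rule abelian_groupI)
    fix x assume "x \<in> carrier R"
    then show "\<exists>y\<in>carrier R. y \<oplus>\<^bsub>R\<^esub> x = \<zero>\<^bsub>R\<^esub>"
      by (intro bexI[of _ "(\<ominus>\<^bsub>S\<^esub> fst x, \<ominus>\<^bsub>T\<^esub> snd x)"]) (auto simp: fiber_product_simps S.l_neg T.l_neg)
  qed (auto simp: fiber_product_simps S.a_ac T.a_ac)
  show "comm_monoid R"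
    by (rule comm_monoidI) (auto simp: fiber_product_simps S.m_ac T.m_ac)
qed (auto simp: fiber_product_simps S.l_distr T.l_distr)

lemma fst_hom: "fst \<in> ring_hom R S" and snd_hom: "snd \<in> ring_hom R T"
  by (auto intro!: ring_hom_memI simp: fiber_product_simps)

lemma fst_surj: "fst ` carrier R = carrier S"
proof
  show "carrier S \<subseteq> fst ` carrier R"
  proof
    fix s assume s: "s \<in> carrier S"
    then have "f s \<in> g ` carrier T" unfolding g(2) by simp
    then obtain t where "t \<in> carrier T" "f s = g t" by auto
    then show "s \<in> fst ` carrier R" using s by (intro image_eqI[of _ _ "(s, t)"]) (auto simp: fiber_product_simps)
  qed
qed (auto simp: fiber_product_simps)

lemma snd_surj: "snd ` carrier R = carrier T"
proof
  show "carrier T \<subseteq> snd ` carrier R"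
  proof
    fix t assume t: "t \<in> carrier T"
    then have "g t \<in> f ` carrier S" unfolding f(2) by simp
    then obtain s where "s \<in> carrier S" "g t = f s" by auto
    then show "t \<in> snd ` carrier R" using t by (intro image_eqI[of _ _ "(s, t)"]) (auto simp: fiber_product_simps)
  qed
qed (auto simp: fiber_product_simps)

sublocale fst: ring_hom_cring R S fst
  by (intro ring_hom_cring.intro R.is_cring S.is_cring ring_hom_cring_axioms.intro fst_hom)
sublocale snd: ring_hom_cring R T snd
  by (intro ring_hom_cring.intro R.is_cring T.is_cring ring_hom_cring_axioms.intro snd_hom)

lemma residue_hom: "f \<circ> fst \<in> ring_hom R k"
  using fst_hom f(1) by (rule ring_hom_trans)

sublocale res: ring_hom_cring R k "f \<circ> fst"
  by (intro ring_hom_cring.intro R.is_cring k.is_cring ring_hom_cring_axioms.intro residue_hom)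

text \<open>An ideal L is controlled by its projection to S and by its intersection with 0 x T.
  Surjectivity of the projections makes these an ideal of S and an ideal of T, so both are finitely
  generated; lifts of the first generators together with the second ones generate L.\<close>

lemma noetherian: "noetherian_ring R"
proof (rule R.noetherian_ringI)
  fix L assume L: "ideal L R"
  interpret RM: plain_module R "self_module R" by (rule plain_module[OF R.module_self_module])
  interpret SM: plain_module S "self_module S" by (rule plain_module[OF S.module_self_module])
  interpret TM: plain_module T "self_module T" by (rule plain_module[OF T.module_self_module])
  interpret L: ideal L R by (rule L)
  have Lc: "\<And>x. x \<in> L \<Longrightarrow> x \<in> carrier R" by (rule L.in_carrier)
  have "submodule (fst ` L) S (self_module S)"
  proof (rule SM.submoduleI')
    show "fst ` L \<subseteq> carrier (self_module S)" using Lc fst_surj by auto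
    show "\<zero>\<^bsub>self_module S\<^esub> \<in> fst ` L"
      by (rule image_eqI[OF _ L.zero_closed]) (simp add: fiber_product_simps)
    fix x assume "x \<in> fst ` L"
    then obtain a where a: "a \<in> L" "x = fst a" by auto
    {
      fix y assume "y \<in> fst ` L"
      then obtain b where b: "b \<in> L" "y = fst b" by auto
      show "x \<oplus>\<^bsub>self_module S\<^esub> y \<in> fst ` L"
        using a b Lc by (intro image_eqI[OF _ L.a_closed[OF a(1) b(1)]]) simp
    next
      fix s assume "s \<in> carrier S"
      then have "s \<in> fst ` carrier R" unfolding fst_surj .
      then obtain r where r: "r \<in> carrier R" "s = fst r" by auto
      show "s \<odot>\<^bsub>self_module S\<^esub> x \<in> fst ` L"
        using a r Lc by (intro image_eqI[OF _ L.I_l_closed[OF a(1) r(1)]]) simp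
    }
  qed
  then have "ideal (fst ` L) S" unfolding S.submodule_self_module_iff .
  then obtain G where G: "finite G" "G \<subseteq> fst ` L" "fst ` L = lin_span S (self_module S) G"
    by (elim ideal_finitely_spanned[OF S.is_cring S.noetherian_ring_axioms, THEN exE] conjE) (rule that)
  let ?L2 = "{t. (\<zero>\<^bsub>S\<^esub>, t) \<in> L}"
  have "submodule ?L2 T (self_module T)"
  proof (rule TM.submoduleI')
    show "?L2 \<subseteq> carrier (self_module T)" using Lc by (auto simp: fiber_product_simps)
    show "\<zero>\<^bsub>self_module T\<^esub> \<in> ?L2" using L.zero_closed by (simp add: fiber_product_simps)
    fix x assume x: "x \<in> ?L2"
    show "x \<oplus>\<^bsub>self_module T\<^esub> y \<in> ?L2" if "y \<in> ?L2" for y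
      using L.a_closed[of "(\<zero>\<^bsub>S\<^esub>, x)" "(\<zero>\<^bsub>S\<^esub>, y)"] x that by (simp add: fiber_product_simps)
    show "t \<odot>\<^bsub>self_module T\<^esub> x \<in> ?L2" if "t \<in> carrier T" for t
    proof -
      have "t \<in> snd ` carrier R" using that unfolding snd_surj .
      then obtain s where r: "(s, t) \<in> carrier R" by auto
      then have "s \<in> carrier S" by (simp add: fiber_product_simps)
      then show ?thesis using L.I_l_closed[OF _ r, of "(\<zero>\<^bsub>S\<^esub>, x)"] x by (simp add: fiber_product_simps)
    qed
  qed
  then have "ideal ?L2 T" unfolding T.submodule_self_module_iff .
  then obtain G2 where G2: "finite G2" "G2 \<subseteq> ?L2" "?L2 = lin_span T (self_module T) G2"
    by (elim ideal_finitely_spanned[OF T.is_cring T.noetherian_ring_axioms, THEN exE] conjE) (rule that)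
  define h where "h = inv_into L fst"
  have h: "h s \<in> L \<and> s = fst (h s)" if "s \<in> G" for s
    unfolding h_def using inv_into_into[of s fst L] f_inv_into_f[of s fst L] subsetD[OF G(2) that] by simp
  let ?A = "h ` G \<union> Pair \<zero>\<^bsub>S\<^esub> ` G2"
  have A: "finite ?A" "?A \<subseteq> L" using G G2 h by auto
  have "L \<subseteq> K" if K: "ideal K R" "?A \<subseteq> K" for K
  proof
    note sK = R.submodule_self_module_iff[THEN iffD2, OF K(1)]
    fix x assume x: "x \<in> L"
    then have "fst x \<in> lin_span S (self_module S) G" using G(3) by blast
    then obtain c where c: "c \<in> G \<rightarrow> carrier S" "fst x = lin_comb (self_module S) G c (\<lambda>a. a)"
      by (auto simp: lin_span_def)
    define r where "r s = inv_into (carrier R) fst (c s)" for s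
    have r: "r s \<in> carrier R \<and> fst (r s) = c s" if "s \<in> G" for s
    proof -
      have "c s \<in> fst ` carrier R" unfolding fst_surj using c(1) that by (rule funcset_mem)
      then show ?thesis unfolding r_def by (simp only: inv_into_into f_inv_into_f simp_thms)
    qed
    let ?y = "lin_comb (self_module R) G r h"
    have yL: "?y \<in> L"
      using r h G(1) by (intro RM.submodule_lin_comb[OF R.submodule_self_module_iff[THEN iffD2, OF L]]) auto
    have yK: "?y \<in> K" using r K(2) G(1) by (intro RM.submodule_lin_comb[OF sK]) auto
    have "fst ?y = (\<Oplus>\<^bsub>S\<^esub>s\<in>G. fst (r s \<otimes>\<^bsub>R\<^esub> h s))"
      unfolding lin_comb_def finsum_self_module self_module_simps using r h Lc
      by (subst fst.hom_finsum) (auto simp: o_def)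
    also have "\<dots> = (\<Oplus>\<^bsub>S\<^esub>s\<in>G. c s \<otimes>\<^bsub>S\<^esub> s)"
    proof (rule S.finsum_cong')
      show "(\<lambda>s. c s \<otimes>\<^bsub>S\<^esub> s) \<in> G \<rightarrow> carrier S" 
      proof
        fix s assume s: "s \<in> G"
        have "fst (h s) \<in> carrier S" using h[OF s] Lc by (intro fst.hom_closed) blast
        with conjunct2[OF h[OF s]] have "s \<in> carrier S" by (rule ssubst)
        then show "c s \<otimes>\<^bsub>S\<^esub> s \<in> carrier S" using c(1) s by blast
      qed
      show "fst (r s \<otimes>\<^bsub>R\<^esub> h s) = c s \<otimes>\<^bsub>S\<^esub> s" if "s \<in> G" for s
        using r[OF that] h[OF that] fst.hom_mult[of "r s" "h s"] Lc[of "h s"] by simp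
    qed simp
    also have "\<dots> = fst x" unfolding c(2) by (simp add: lin_comb_def finsum_self_module)
    finally have fst_y: "fst ?y = fst x" .
    \<comment> \<open>Subtracting \<open>?y\<close> makes the first component zero, and the
      generators coming from \<open>G2\<close> take over.\<close>
    let ?z = "x \<ominus>\<^bsub>R\<^esub> ?y"
    have xy: "x \<in> carrier R" "?y \<in> carrier R" using x yL Lc by auto
    have zL: "?z \<in> L" unfolding a_minus_def using x yL by (intro L.a_closed L.a_inv_closed)
    have "fst ?z = \<zero>\<^bsub>S\<^esub>" using xy fst_y by (simp add: a_minus_def S.r_neg)
    then have z: "?z = (\<zero>\<^bsub>S\<^esub>, snd ?z)" by (simp add: prod_eq_iff)
    then have "snd ?z \<in> ?L2" using zL by simp
    then have "snd ?z \<in> lin_span T (self_module T) G2" using G2(3) by blast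
    then obtain d where d: "d \<in> G2 \<rightarrow> carrier T" "snd ?z = lin_comb (self_module T) G2 d (\<lambda>a. a)"
      by (auto simp: lin_span_def)
    define q where "q t = inv_into (carrier R) snd (d t)" for t
    have q: "q t \<in> carrier R \<and> snd (q t) = d t" if "t \<in> G2" for t
    proof -
      have "d t \<in> snd ` carrier R" unfolding snd_surj using d(1) that by (rule funcset_mem)
      then show ?thesis unfolding q_def by (simp only: inv_into_into f_inv_into_f simp_thms)
    qed
    let ?w = "lin_comb (self_module R) G2 q (Pair \<zero>\<^bsub>S\<^esub>)"
    have PL: "\<And>t. t \<in> G2 \<Longrightarrow> (\<zero>\<^bsub>S\<^esub>, t) \<in> carrier R" using G2(2) Lc by auto
    have wK: "?w \<in> K" using q K(2) G2(1) by (intro RM.submodule_lin_comb[OF sK]) auto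
    have prodq: "q t \<otimes>\<^bsub>R\<^esub> (\<zero>\<^bsub>S\<^esub>, t) = (\<zero>\<^bsub>S\<^esub>, d t \<otimes>\<^bsub>T\<^esub> t)" if t: "t \<in> G2" for t
    proof -
      obtain s where "q t = (s, d t)" "s \<in> carrier S"
        using q[OF t] by (cases "q t") (auto simp: fiber_product_simps)
      then show ?thesis by (simp add: fiber_product_simps)
    qed
    have cl: "(\<lambda>t. (\<zero>\<^bsub>S\<^esub>, d t \<otimes>\<^bsub>T\<^esub> t)) \<in> G2 \<rightarrow> carrier R"
    proof
      fix t assume t: "t \<in> G2"
      show "(\<zero>\<^bsub>S\<^esub>, d t \<otimes>\<^bsub>T\<^esub> t) \<in> carrier R"
        using R.m_closed[of "q t" "(\<zero>\<^bsub>S\<^esub>, t)"] q[OF t] PL[OF t] unfolding prodq[OF t] by blast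
    qed
    have w: "?w = (\<Oplus>\<^bsub>R\<^esub>t\<in>G2. (\<zero>\<^bsub>S\<^esub>, d t \<otimes>\<^bsub>T\<^esub> t))"
      unfolding lin_comb_def finsum_self_module self_module_simps
      using cl prodq by (intro R.finsum_cong') auto
    have "fst ?w = (\<Oplus>\<^bsub>S\<^esub>t\<in>G2. \<zero>\<^bsub>S\<^esub>)"
      unfolding w using cl by (subst fst.hom_finsum) (auto simp: o_def)
    then have "fst ?w = \<zero>\<^bsub>S\<^esub>" by simp
    moreover have "snd ?w = (\<Oplus>\<^bsub>T\<^esub>t\<in>G2. d t \<otimes>\<^bsub>T\<^esub> t)"
      unfolding w using cl by (subst snd.hom_finsum) (auto simp: o_def)
    then have "snd ?w = snd ?z" unfolding d(2) by (simp add: lin_comb_def finsum_self_module)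
    ultimately have "?z = ?w" using z by (simp add: prod_eq_iff)
    then have "?z \<oplus>\<^bsub>R\<^esub> ?y \<in> K"
      using wK yK additive_subgroup.a_closed[OF ideal.axioms(1)[OF K(1)]] by simp
    also have "?z \<oplus>\<^bsub>R\<^esub> ?y = x" using xy by (simp add: a_minus_def R.a_assoc R.l_neg)
    finally show "x \<in> K" .
  qed
  then have "L \<subseteq> Idl\<^bsub>R\<^esub> ?A" unfolding genideal_def by blast
  moreover have "Idl\<^bsub>R\<^esub> ?A \<subseteq> L" by (rule R.genideal_minimal[OF L A(2)])
  ultimately show "\<exists>A\<subseteq>carrier R. finite A \<and> L = Idl\<^bsub>R\<^esub> A"
    using A Lc by (intro exI[of _ ?A]) blast
qed

text \<open>Both components have the same nonzero residue and are units. Their inverses have equal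
  residues by uniqueness of inverses in k, so the pair of inverses belongs to the fiber
  product.\<close>

lemma unit_if_nonzero_residue:
  assumes "x \<in> carrier R" "f (fst x) \<noteq> \<zero>\<^bsub>k\<^esub>"
  shows "x \<in> Units R"
proof -
  obtain s t where x: "x = (s, t)" "s \<in> carrier S" "t \<in> carrier T" "f s = g t"
    using assms(1) by (auto simp: fiber_product_simps)
  have s: "s \<in> Units S"
    using assms(2) x by (intro S.unit_if_nonzero_residue[OF k.field_axioms f(1,2)]) auto
  have t: "t \<in> Units T"
    using assms(2) x by (intro T.unit_if_nonzero_residue[OF k.field_axioms g(1,2)]) auto
  let ?s = "inv\<^bsub>S\<^esub> s" and ?t = "inv\<^bsub>T\<^esub> t"
  have cl: "?s \<in> carrier S" "?t \<in> carrier T" using s t by auto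
  have "f ?s = g ?t"
  proof (rule k.inv_unique)
    show "f ?s \<otimes>\<^bsub>k\<^esub> f s = \<one>\<^bsub>k\<^esub>" using s x(2) cl by (simp flip: f.hom_mult)
    show "f s \<otimes>\<^bsub>k\<^esub> g ?t = \<one>\<^bsub>k\<^esub>" using t x cl by (simp flip: g.hom_mult)
  qed (use x cl in auto)
  then have "(?s, ?t) \<in> carrier R" using cl by (simp add: fiber_product_simps)
  moreover have "(?s, ?t) \<otimes>\<^bsub>R\<^esub> x = \<one>\<^bsub>R\<^esub>" "x \<otimes>\<^bsub>R\<^esub> (?s, ?t) = \<one>\<^bsub>R\<^esub>"
    using s t x by (simp_all add: fiber_product_simps)
  ultimately show ?thesis using assms(1) unfolding Units_def by auto
qed

lemma kernel_iffs:
  "x \<in> a_kernel R S fst \<longleftrightarrow> x \<in> carrier R \<and> fst x = \<zero>\<^bsub>S\<^esub>"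
  "x \<in> a_kernel R T snd \<longleftrightarrow> x \<in> carrier R \<and> snd x = \<zero>\<^bsub>T\<^esub>"
  "x \<in> a_kernel R k (f \<circ> fst) \<longleftrightarrow> x \<in> carrier R \<and> f (fst x) = \<zero>\<^bsub>k\<^esub>"
  unfolding in_a_kernel_iff o_apply by (rule refl)+

text \<open>The roles are crossed: \<open>I\<close> is the kernel of the projection to T and
  \<open>J\<close> that of the projection to S, so R/J is S and R/I is T.\<close>

lemma fiber_ring: "fiber_ring R (a_kernel R k (f \<circ> fst)) (a_kernel R T snd) (a_kernel R S fst)"
proof (intro fiber_ring.intro local_ring_at.intro local_ring_at_axioms.intro fiber_ring_axioms.intro
    R.cring_axioms noetherian ring_hom_ideal_kernel
    S.is_cring T.is_cring k.is_cring fst_hom snd_hom residue_hom)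
  show "\<one>\<^bsub>R\<^esub> \<notin> a_kernel R k (f \<circ> fst)" by (simp add: kernel_iffs fiber_product_simps)
  show "x \<in> Units R" if "x \<in> carrier R" "x \<notin> a_kernel R k (f \<circ> fst)" for x
    using that by (intro unit_if_nonzero_residue) (auto simp: kernel_iffs)
  show "a_kernel R T snd \<inter> a_kernel R S fst = {\<zero>\<^bsub>R\<^esub>}"
    by (auto simp: kernel_iffs fiber_product_simps)
  show "a_kernel R T snd \<subseteq> a_kernel R k (f \<circ> fst)" "a_kernel R S fst \<subseteq> a_kernel R k (f \<circ> fst)"
    by (auto simp: kernel_iffs fiber_product_simps)
  show "\<exists>a\<in>a_kernel R T snd. \<exists>b\<in>a_kernel R S fst. r = a \<oplus>\<^bsub>R\<^esub> b" if "r \<in> a_kernel R k (f \<circ> fst)" for r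
    using that
    by (intro bexI[of _ "(fst r, \<zero>\<^bsub>T\<^esub>)"] bexI[of _ "(\<zero>\<^bsub>S\<^esub>, snd r)"])
      (auto simp: kernel_iffs fiber_product_simps)
  obtain s where "s \<in> carrier S" "s \<noteq> \<zero>\<^bsub>S\<^esub>" "f s = \<zero>\<^bsub>k\<^esub>" using nontrivial_kernel by auto
  then have "(s, \<zero>\<^bsub>T\<^esub>) \<in> a_kernel R T snd" "(s, \<zero>\<^bsub>T\<^esub>) \<noteq> \<zero>\<^bsub>R\<^esub>"
    by (auto simp: kernel_iffs fiber_product_simps)
  then show "a_kernel R T snd \<noteq> {\<zero>\<^bsub>R\<^esub>}" by blast
  obtain t where "t \<in> carrier T" "t \<noteq> \<zero>\<^bsub>T\<^esub>" "g t = \<zero>\<^bsub>k\<^esub>"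
    using fiber_product_of_local_rings.nontrivial_kernel[OF swap] by auto
  then have "(\<zero>\<^bsub>S\<^esub>, t) \<in> a_kernel R S fst" "(\<zero>\<^bsub>S\<^esub>, t) \<noteq> \<zero>\<^bsub>R\<^esub>"
    by (auto simp: kernel_iffs fiber_product_simps)
  then show "a_kernel R S fst \<noteq> {\<zero>\<^bsub>R\<^esub>}" by blast
qed

end

section \<open>Choice of resolutions and bases, and the theorem\<close>

lemma free_resolution_bases:
  assumes "module R M" "fg_free_resolution R M P"
  shows "\<exists>B. free_resolution R M P B"
proof -
  have "\<exists>B. finite_basis R (obj P i) B" for i
    using assms(2) unfolding fg_free_resolution_def fg_free_module_def finite_basis_def finite_basis_axioms_def
    by blast
  then obtain B where "\<And>i. finite_basis R (obj P i) (B i)" by metis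
  then show ?thesis using assms unfolding free_resolution_def fg_free_resolution_def by blast
qed

lemma (in fiber_ring) minimal_resolution_bases:
  assumes M: "module R M" and P: "minimal_free_resolution R M P"
  shows "\<exists>B. minimal_resolution R \<mm> I J M P B"
proof -
  obtain B where B: "free_resolution R M P B"
    using free_resolution_bases[OF M conjunct1[OF P[unfolded minimal_free_resolution_def]]] by blast
  interpret free_resolution R M P B by (rule B)
  have "diff P (Suc i) ` carrier (obj P (Suc i)) \<subseteq> smult_span (obj P i) \<mm> (carrier (obj P i))" for i
    using P F.ideal_smult_eq_smult_span[OF ideal_m]
    unfolding minimal_free_resolution_def maximal_ideal_eq by simp
  then show ?thesis
    by (intro exI[of _ B] minimal_resolution.intro minimal_resolution_axioms.intro B fiber_ring_axioms)
qed

lemma (in minimal_resolution) free_along_syzygy: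
  fixes S :: "('s, 'y) ring_scheme"
  assumes "cring S" "\<one>\<^bsub>S\<^esub> \<noteq> \<zero>\<^bsub>S\<^esub>" "h \<in> ring_hom R S" "h ` carrier R = carrier S"
    and c: "cycles 1 = smult_span (obj P 2) (a_kernel R S h) (carrier (obj P 2))"
  shows "free_along R S h ((obj P 1)\<lparr>carrier := diff P 2 ` carrier (obj P 2)\<rparr>)"
proof -
  have "free_along R S h ((obj P (Suc 0))\<lparr>carrier := diff P (Suc (Suc 0)) ` carrier (obj P (Suc (Suc 0)))\<rparr>)"
  proof (rule free_along_image[OF assms(1-4) basis obj diff])
    fix x assume x: "x \<in> carrier (obj P (Suc (Suc 0)))"
    have "x \<in> cycles 1 \<longleftrightarrow> diff P (Suc (Suc 0)) x = \<zero>\<^bsub>obj P (Suc 0)\<^esub>" using x by (simp add: cycles_def)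
    then show "diff P (Suc (Suc 0)) x = \<zero>\<^bsub>obj P (Suc 0)\<^esub> \<longleftrightarrow>
        x \<in> smult_span (obj P (Suc (Suc 0))) (a_kernel R S h) (carrier (obj P (Suc (Suc 0))))"
      unfolding c by (simp add: numeral_2_eq_2)
  qed
  then show ?thesis by (simp add: numeral_2_eq_2)
qed

theorem theorem1p15:
  fixes S :: "('s, 'x) ring_scheme"
    and T :: "('t, 'y) ring_scheme"
    and k :: "('k, 'z) ring_scheme"
    and \<pi>S :: "'s \<Rightarrow> 'k"
    and \<pi>T :: "'t \<Rightarrow> 'k"
    and R :: "('s \<times> 't) ring"
    and M :: "('s \<times> 't, 'm) module"
    and N :: "('s \<times> 't, 'n) module"
  assumes "local_ring S"
    and "local_ring T"
    and "field k"
    and "\<pi>S \<in> ring_hom S k" and "\<pi>S ` carrier S = carrier k"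
    and "\<pi>T \<in> ring_hom T k" and "\<pi>T ` carrier T = carrier k"
    and "\<pi>S \<notin> ring_iso S k"
    and "\<pi>T \<notin> ring_iso T k"
    and "R = fiber_product S T \<pi>S \<pi>T"
    and "fg_module R M"
    and "fg_module R N"
    and "trivial_group (Tor R 5 M N)"
  shows "projective_dimension R M \<le> 1
    \<or> projective_dimension R N \<le> 1
    \<or> (free_along R S fst (syzygy R 2 M) \<and> free_along R T snd (syzygy R 2 N))
    \<or> (free_along R T snd (syzygy R 2 M) \<and> free_along R S fst (syzygy R 2 N))"
proof -
  interpret X: fiber_product_of_local_rings S T k \<pi>S \<pi>T
    by (intro fiber_product_of_local_rings.intro fiber_product_of_local_rings_axioms.intro assms(1-9))
  let ?I = "a_kernel R T snd" and ?J = "a_kernel R S fst" and ?m = "a_kernel R k (\<pi>S \<circ> fst)"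
  interpret R: fiber_ring R ?m ?I ?J using X.fiber_ring unfolding assms(10) .
  \<comment> \<open>\<open>P\<close> and \<open>Q\<close> are the minimal resolutions selected
    inside \<open>syzygy\<close>, and \<open>G\<close> is the free resolution selected inside
    \<open>Tor\<close>. \<open>G\<close> may differ from \<open>P\<close> and need not be minimal,
    so it is used only to transfer vanishing to M tensor Q.\<close>
  define P :: "('s \<times> 't, nat \<Rightarrow> 's \<times> 't, 'm) resolution" where "P = (SOME P. minimal_free_resolution R M P)"
  define Q :: "('s \<times> 't, nat \<Rightarrow> 's \<times> 't, 'n) resolution" where "Q = (SOME Q. minimal_free_resolution R N Q)"
  define G :: "('s \<times> 't, nat \<Rightarrow> 's \<times> 't, 'm) resolution" where "G = (SOME P. fg_free_resolution R M P)"
  have mM: "module R M" and mN: "module R N" using assms(11,12) by (auto simp: fg_module_def)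
  have P: "minimal_free_resolution R M P"
    unfolding P_def by (rule someI_ex[OF R.minimal_free_resolution_exists[OF assms(11) R.maximal_ideal_eq]])
  have Q: "minimal_free_resolution R N Q"
    unfolding Q_def by (rule someI_ex[OF R.minimal_free_resolution_exists[OF assms(12) R.maximal_ideal_eq]])
  have "\<exists>P :: ('s \<times> 't, nat \<Rightarrow> 's \<times> 't, 'm) resolution. fg_free_resolution R M P"
    using P by (auto simp: minimal_free_resolution_def)
  then have G: "fg_free_resolution R M G" unfolding G_def by (rule someI_ex)
  obtain B where B: "minimal_resolution R ?m ?I ?J M P B" using R.minimal_resolution_bases[OF mM P] by blast
  obtain C where C: "minimal_resolution R ?m ?I ?J N Q C" using R.minimal_resolution_bases[OF mN Q] by blast
  obtain A where A: "free_resolution R M G A" using free_resolution_bases[OF mM G] by blast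
  interpret F: minimal_resolution R ?m ?I ?J M P B by (rule B)
  interpret L: minimal_resolution R ?m ?I ?J N Q C by (rule C)
  interpret GL: resolution_pair R M G A N Q C by (intro resolution_pair.intro A L.free_resolution_axioms)
  have "trivial_group (tensor_homology R G N (Suc 4))"
    using assms(13) by (simp add: Tor_def G_def)
  note exact = GL.trivial_Tor_delta_exact[OF this]
  interpret FL: minimal_resolution_pair R ?m ?I ?J M P B N Q C
  proof (intro minimal_resolution_pair.intro B C minimal_resolution_pair_axioms.intro)
    show "\<exists>y\<in>carrier (power_module (C 6) M). L.delta M 5 y = z"
      if "z \<in> carrier (power_module (C 5) M)" "L.delta M 4 z = \<zero>\<^bsub>power_module (C 4) M\<^esub>" for z
      using exact[of z] that by simp
  qed
  have syz: "syzygy R 2 M = (obj P 1)\<lparr>carrier := diff P 2 ` carrier (obj P 2)\<rparr>"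
    "syzygy R 2 N = (obj Q 1)\<lparr>carrier := diff Q 2 ` carrier (obj Q 2)\<rparr>"
    by (simp_all add: syzygy_def P_def Q_def Let_def)
  have S1: "\<one>\<^bsub>S\<^esub> \<noteq> \<zero>\<^bsub>S\<^esub>" using X.f.hom_one X.f.hom_zero X.k.one_not_zero by metis
  have T1: "\<one>\<^bsub>T\<^esub> \<noteq> \<zero>\<^bsub>T\<^esub>" using X.g.hom_one X.g.hom_zero X.k.one_not_zero by metis
  note homs = X.fst_hom[folded assms(10)] X.fst_surj[folded assms(10)] X.snd_hom[folded assms(10)]
    X.snd_surj[folded assms(10)]
  note along_S = F.free_along_syzygy[OF X.S.is_cring S1 homs(1,2)] L.free_along_syzygy[OF X.S.is_cring S1 homs(1,2)]
  note along_T = F.free_along_syzygy[OF X.T.is_cring T1 homs(3,4)] L.free_along_syzygy[OF X.T.is_cring T1 homs(3,4)]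
  have "projective_dimension R M \<le> 1" if "F.cycles 0 = {\<zero>\<^bsub>obj P 1\<^esub>}"
    using that unfolding F.cycles_def
    by (intro R.projective_dimension_le_1[OF F.free_resolution_axioms]) auto
  moreover have "projective_dimension R N \<le> 1" if "L.cycles 0 = {\<zero>\<^bsub>obj Q 1\<^esub>}"
    using that unfolding L.cycles_def
    by (intro R.projective_dimension_le_1[OF L.free_resolution_axioms]) auto
  \<comment> \<open>A third syzygy equal to J times its free module makes the second syzygy free
    over S, since \<open>?J\<close> is the kernel of \<open>fst\<close>; with I it becomes free over
    T. The two mixed cases of \<open>cycles_alternative\<close> are thus alternatives (3) and
    (4).\<close>
  ultimately show ?thesis
    using FL.cycles_alternative along_S along_T unfolding syz by blast
qed

end
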